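(* Let $\alpha\in(0,2]$, $\alpha+\gamma\in[0,2]$, $\beta\in(0,1]$, $H\in[1/2,1)$, $\psi(s)=s^{\alpha/2}(1+s)^{\gamma/2}$, $\tau:=\max\{\frac2\beta(1-\beta-H),0\}$, and suppose $\sum_{\ell\ge1}(2\ell+1)(\psi(\lambda_\ell))^\tau A^i_\ell<\infty$ for $i=1,2$. Let $\mathbf f_0(\xi,\mathbf x)$ be a centred random tangent field in $\mathbf L_2(\Omega\times\mathbb S^2)$ whose Fourier coefficients $\hat f_{\ell m}:=\langle\mathbf f_0,\mathbf y_{\ell,m}\rangle$, $\tilde f_{\ell m}:=\langle\mathbf f_0,\mathbf z_{\ell,m}\rangle$ are normally distributed with mean zero and variances $\hat\sigma_\ell^2$ and $\tilde\sigma_\ell^2$ respectively, satisfy for all $\ell,\ell'\ge1$, $|m|\le\ell$, $|m'|\le\ell'$ $$\mathbb E\big[\hat f_{\ell m}\overline{\tilde f_{\ell'm'}}\big]=0,\qquad \mathbb E\big[\hat f_{\ell m}\overline{\hat f_{\ell'm'}}\big]=\delta_{\ell\ell'}\delta_{mm'}\hat\sigma_\ell^2,\qquad \mathbb E\big[\tilde f_{\ell m}\overline{\tilde f_{\ell'm'}}\big]=\delta_{\ell\ell'}\delta_{mm'}\tilde\sigma_\ell^2,$$ with $\sum_{\ell\ge1}(2\ell+1)\hat\sigma_\ell^2<\infty$ and $\sum_{\ell\ge1}(2\ell+1)\tilde\sigma_\ell^2<\infty$, and are uncorrelated with the processes $\hat B_{\ell'm'}(t),\tilde B_{\ell'm'}(t)$.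 Let $t_0>0$ and $$\begin{aligned}\mathbf X(t,\mathbf x)=\sum_{\ell=1}^\infty\sum_{m=-\ell}^{\ell}\Big\{&\Big(\hat f_{\ell m}E_{\beta,1}\big(-t_0^\beta\psi(\lambda_\ell)\big)+\int_0^t(t-s)^{\beta-1}E_{\beta,\beta}\big(-(t-s)^\beta\psi(\lambda_\ell)\big)\,\mathrm d\hat B_{\ell m}(s)\Big)\mathbf y_{\ell,m}(\mathbf x)\\&+\Big(\tilde f_{\ell m}E_{\beta,1}\big(-t_0^\beta\psi(\lambda_\ell)\big)+\int_0^t(t-s)^{\beta-1}E_{\beta,\beta}\big(-(t-s)^\beta\psi(\lambda_\ell)\big)\,\mathrm d\tilde B_{\ell m}(s)\Big)\mathbf z_{\ell,m}(\mathbf x)\Big\},\end{aligned}$$ and for $L\in\mathbb N$ let $\mathbf X_L(t,\mathbf x)$ be the same expression with the sum over $\ell$ restricted to $1\le\ell\le L$. Let $t>0$. Below, $C>0$ denotes constants (possibly different from place to place) not depending on $L$. Then: (i) $$\|\mathbf X(t,\cdot)-\mathbf X_L(t,\cdot)\|_{\mathbf L_2(\Omega\times\mathbb S^2)}\le C\Big(\sum_{\ell=L+1}^\infty(2\ell+1)\big(\hat\sigma_\ell^2+\tilde\sigma_\ell^2+(A^1_\ell+A^2_\ell)(\psi(\lambda_\ell))^\tau\big)\Big)^{1/2}.$$ (ii) If for some $\nu>2$ there exist constants $C_0>0$ and $\ell_0\in\mathbb N$ such that $\hat\sigma_\ell^2+\tilde\sigma_\ell^2+(A^1_\ell+A^2_\ell)(\psi(\lambda_\ell))^\tau\le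 C_0\,\ell^{-\nu}$ for all $\ell\ge\ell_0$, then $$\|\mathbf X(t,\cdot)-\mathbf X_L(t,\cdot)\|_{\mathbf L_2(\Omega\times\mathbb S^2)}\le CL^{-\frac{\nu-2}2}.$$ (iii) Under the decay hypothesis in (ii), for any $\varepsilon>0$, $$\mathbf P\big(|\mathbf X(t,\mathbf x)-\mathbf X_L(t,\mathbf x)|\ge\varepsilon\big)\le\frac{C}{L^{\nu-2}\varepsilon^2},$$ with $C$ independent of $\varepsilon$.
   Context: Vector spherical harmonics. $\mathbb S^2\subset\mathbb R^3$ is the unit sphere with surface measure, $\Delta^*$ its Laplace–Beltrami operator, $\{Y_{\ell,m}\}$ an orthonormal basis of complex spherical harmonics, $\Delta^*Y_{\ell,m}=-\lambda_\ell Y_{\ell,m}$, $\lambda_\ell=\ell(\ell+1)$. For column vectors in $\mathbb C^3$, $\mathbf a\cdot\mathbf b=\mathbf a^T\overline{\mathbf b}$, $|\mathbf a|=\sqrt{\mathbf a\cdot\mathbf a}$. A field $\mathbf f:\mathbb S^2\to\mathbb C^3$ is tangent if $\mathbf f(\mathbf x)\cdot\mathbf x=0$; for square-integrable tangent fields $\langle\mathbf f,\mathbf g\rangle=\int_{\mathbb S^2}\mathbf f\cdot\mathbf g$. The surface gradient is $\nabla^*=(I-\mathbf x\mathbf x^T)\nabla$ and the surface curl is $\mathbf L=Q_{\mathbf x}\nabla$, $Q_{\mathbf x}=\begin{pmatrix}0&-x_3&x_2\\ x_3&0&-x_1\\ -x_2&x_1&0\end{pmatrix}$. For $\ell\ge1$,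 $|m|\le\ell$: $\mathbf y_{\ell,m}=\mathbf L Y_{\ell,m}/\sqrt{\lambda_\ell}$ and $\mathbf z_{\ell,m}=\nabla^*Y_{\ell,m}/\sqrt{\lambda_\ell}$; together they form an orthonormal basis of the space of square-integrable tangent fields. On a probability space $(\Omega,\mathcal F,\mathbf P)$, $\mathbf L_2(\Omega\times\mathbb S^2)$ is the space of random tangent fields with $\|\mathbf f\|^2_{\mathbf L_2(\Omega\times\mathbb S^2)}=\mathbb E\int_{\mathbb S^2}|\mathbf f(\cdot,\mathbf x)|^2<\infty$. Noise. A real fractional Brownian motion with Hurst index $H$ and variance $A$ at $t=1$ is a centred Gaussian process with value $0$ at $t=0$ and $\mathbb E|B(t)-B(s)|^2=A|t-s|^{2H}$; a complex one is $B^1+\mathrm iB^2$ with $B^1,B^2$ independent real ones of Hurst index $H$ and variance $A$ at $t=1$. $\hat B_{\ell m},\tilde B_{\ell m}$ ($\ell\ge1$, $|m|\le\ell$) are independent centred complex fractional Brownian motions with Hurst index $H$ and variances $A^1_\ell$, $A^2_\ell$ at $t=1$ respectively, with $\sum_\ell(2\ell+1)A^i_\ell<\infty$, $i=1,2$. For deterministic $g$, $\int_0^tg\,\mathrm dB=\int_0^tg\,\mathrm dB^1+\mathrm i\int_0^tg\,\mathrm dB^2$ (Riemann–Stieltjes integrals). $E_{a,b}(z)=\sum_{k\ge0}z^k/\Gamma(ak+b)$ is the generalized Mittag-Leffler function. *)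

theory Defs
  imports "HOL-Probability.Probability"
begin

section \<open>The sphere and tangent fields\<close>

text \<open>
  Surface measure on the unit sphere: the measure of a Borel set \<open>A\<close> is three times the volume of
  the solid cone \<open>{r x | x \<in> A, 0 < r < 1}\<close>. The total mass is \<open>4 \<pi>\<close>.
\<close>
definition sphere_measure :: "(real^3) measure" where
  "sphere_measure =
     distr (density (restrict_space lborel (ball 0 1 - {0})) (\<lambda>_. 3))
           (restrict_space borel (sphere 0 1)) (\<lambda>x. x /\<^sub>R norm x)"

text \<open>
  The Hermitian product of \<open>\<complex>\<^sup>3\<close>, linear in the first argument; the associated norm is the library
  norm of \<open>complex^3\<close>.
\<close>
definition cdot :: "complex^3 \<Rightarrow> complex^3 \<Rightarrow> complex" where
  "cdot a b = (\<Sum>i\<in>UNIV. a $ i * cnj (b $ i))"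

definition cvec :: "real^3 \<Rightarrow> complex^3" where
  "cvec x = (\<chi> i. complex_of_real (x $ i))"

definition tangent_inner :: "(real^3 \<Rightarrow> complex^3) \<Rightarrow> (real^3 \<Rightarrow> complex^3) \<Rightarrow> complex" where
  "tangent_inner f g = (LINT x|sphere_measure. cdot (f x) (g x))"

definition partial_deriv :: "3 \<Rightarrow> (real^3 \<Rightarrow> complex) \<Rightarrow> real^3 \<Rightarrow> complex" where
  "partial_deriv i f x = vector_derivative (\<lambda>h. f (x + h *\<^sub>R axis i 1)) (at 0)"

definition gradient :: "(real^3 \<Rightarrow> complex) \<Rightarrow> real^3 \<Rightarrow> complex^3" where
  "gradient f x = (\<chi> i. partial_deriv i f x)"

definition laplacian :: "(real^3 \<Rightarrow> complex) \<Rightarrow> real^3 \<Rightarrow> complex" where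
  "laplacian f x = (\<Sum>i\<in>UNIV. partial_deriv i (partial_deriv i f) x)"

text \<open>
  Only the values on the sphere of a function \<open>f\<close> are used: differential operators are applied to
  its extension that is constant along rays. The surface gradient and the surface curl do not depend
  on the chosen smooth extension; the Laplacian of this particular one is the Laplace--Beltrami
  operator on the sphere.
\<close>
definition radial_ext :: "(real^3 \<Rightarrow> complex) \<Rightarrow> real^3 \<Rightarrow> complex" where
  "radial_ext f x = f (x /\<^sub>R norm x)"

definition laplace_beltrami :: "(real^3 \<Rightarrow> complex) \<Rightarrow> real^3 \<Rightarrow> complex" where
  "laplace_beltrami f x = laplacian (radial_ext f) x"

definition tangential_proj :: "real^3 \<Rightarrow> complex^3^3" where
  "tangential_proj x = mat 1 - (\<chi> i j. complex_of_real (x $ i * x $ j))"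

definition cross_matrix :: "real^3 \<Rightarrow> complex^3^3" where
  "cross_matrix x = vector
     [vector [0, - complex_of_real (x $ 3), complex_of_real (x $ 2)],
      vector [complex_of_real (x $ 3), 0, - complex_of_real (x $ 1)],
      vector [- complex_of_real (x $ 2), complex_of_real (x $ 1), 0]]"

definition surface_gradient :: "(real^3 \<Rightarrow> complex) \<Rightarrow> real^3 \<Rightarrow> complex^3" where
  "surface_gradient f x = tangential_proj x *v gradient (radial_ext f) x"

definition surface_curl :: "(real^3 \<Rightarrow> complex) \<Rightarrow> real^3 \<Rightarrow> complex^3" where
  "surface_curl f x = cross_matrix x *v gradient (radial_ext f) x"


section \<open>Scalar and vector spherical harmonics\<close>

definition eigval :: "nat \<Rightarrow> real" where
  "eigval l = real l * (real l + 1)"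

text \<open>
  Spherical harmonics of degree \<open>l\<close>: restrictions to the sphere of homogeneous harmonic polynomials
  of degree \<open>l\<close>.
\<close>
definition spherical_harmonic :: "nat \<Rightarrow> (real^3 \<Rightarrow> complex) \<Rightarrow> bool" where
  "spherical_harmonic l f \<longleftrightarrow>
     (\<exists>p. polynomial_function p \<and> (\<forall>r x. p (r *\<^sub>R x) = r ^ l *\<^sub>R p x) \<and>
          (\<forall>x. laplacian p x = 0) \<and> (\<forall>x\<in>sphere 0 1. f x = p x))"

definition scalar_inner :: "(real^3 \<Rightarrow> complex) \<Rightarrow> (real^3 \<Rightarrow> complex) \<Rightarrow> complex" where
  "scalar_inner f g = (LINT x|sphere_measure. f x * cnj (g x))"

text \<open>
  The eigenvalue equation is a consequence of the first condition; it is listed because it fixes the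
  normalisation \<open>eigval l\<close>. The last condition is completeness: every square-integrable \<open>f\<close> is
  the sum in \<open>L\<^sub>2\<close> of its Fourier series.
\<close>
definition spherical_harmonic_basis :: "(nat \<Rightarrow> int \<Rightarrow> real^3 \<Rightarrow> complex) \<Rightarrow> bool" where
  "spherical_harmonic_basis Y \<longleftrightarrow>
     (\<forall>l m. \<bar>m\<bar> \<le> int l \<longrightarrow> spherical_harmonic l (Y l m)) \<and>
     (\<forall>l m. \<bar>m\<bar> \<le> int l \<longrightarrow>
        (\<forall>x\<in>sphere 0 1. laplace_beltrami (Y l m) x = - complex_of_real (eigval l) * Y l m x)) \<and>
     (\<forall>l m l' m'. \<bar>m\<bar> \<le> int l \<longrightarrow> \<bar>m'\<bar> \<le> int l' \<longrightarrow>
        scalar_inner (Y l m) (Y l' m') = (if l = l' \<and> m = m' then 1 else 0)) \<and>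
     (\<forall>f. f \<in> borel_measurable sphere_measure \<longrightarrow>
        integrable sphere_measure (\<lambda>x. (cmod (f x))\<^sup>2) \<longrightarrow>
        (\<lambda>N. LINT x|sphere_measure.
           (cmod (f x - (\<Sum>l\<le>N. \<Sum>m=- int l..int l. scalar_inner f (Y l m) * Y l m x)))\<^sup>2)
        \<longlonglongrightarrow> 0)"

definition vsh_y :: "(nat \<Rightarrow> int \<Rightarrow> real^3 \<Rightarrow> complex) \<Rightarrow> nat \<Rightarrow> int \<Rightarrow> real^3 \<Rightarrow> complex^3" where
  "vsh_y Y l m x = surface_curl (Y l m) x /\<^sub>R sqrt (eigval l)"

definition vsh_z :: "(nat \<Rightarrow> int \<Rightarrow> real^3 \<Rightarrow> complex) \<Rightarrow> nat \<Rightarrow> int \<Rightarrow> real^3 \<Rightarrow> complex^3" where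
  "vsh_z Y l m x = surface_gradient (Y l m) x /\<^sub>R sqrt (eigval l)"


section \<open>Random tangent fields\<close>

definition random_tangent_L2 :: "'w measure \<Rightarrow> ('w \<Rightarrow> real^3 \<Rightarrow> complex^3) \<Rightarrow> bool" where
  "random_tangent_L2 M f \<longleftrightarrow>
     case_prod f \<in> borel_measurable (M \<Otimes>\<^sub>M sphere_measure) \<and>
     (AE p in M \<Otimes>\<^sub>M sphere_measure. cdot (f (fst p) (snd p)) (cvec (snd p)) = 0) \<and>
     integrable (M \<Otimes>\<^sub>M sphere_measure) (\<lambda>p. (norm (f (fst p) (snd p)))\<^sup>2)"

definition L2_norm_field :: "'w measure \<Rightarrow> ('w \<Rightarrow> real^3 \<Rightarrow> complex^3) \<Rightarrow> real" where
  "L2_norm_field M f = sqrt (LINT \<omega>|M. LINT x|sphere_measure. (norm (f \<omega> x))\<^sup>2)"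


section \<open>Gaussian variables and fractional Brownian motion\<close>

text \<open>Centred normal real random variables; the degenerate case of variance \<open>0\<close> is allowed.\<close>
definition centred_normal :: "'w measure \<Rightarrow> ('w \<Rightarrow> real) \<Rightarrow> bool" where
  "centred_normal M Z \<longleftrightarrow> Z \<in> borel_measurable M \<and>
     ((AE \<omega> in M. Z \<omega> = 0) \<or> (\<exists>\<sigma>>0. distributed M lborel Z (normal_density 0 \<sigma>)))"

text \<open>
  Complex normal variables with mean zero and variance \<open>v\<close>: real and imaginary part are jointly
  normal; no circular symmetry is required.
\<close>
definition complex_centred_normal :: "'w measure \<Rightarrow> real \<Rightarrow> ('w \<Rightarrow> complex) \<Rightarrow> bool" where
  "complex_centred_normal M v Z \<longleftrightarrow>
     (\<forall>a b. centred_normal M (\<lambda>\<omega>. a * Re (Z \<omega>) + b * Im (Z \<omega>))) \<and>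
     (LINT \<omega>|M. (cmod (Z \<omega>))\<^sup>2) = v"

definition real_fbm :: "'w measure \<Rightarrow> real \<Rightarrow> real \<Rightarrow> (real \<Rightarrow> 'w \<Rightarrow> real) \<Rightarrow> bool" where
  "real_fbm M H A B \<longleftrightarrow>
     (\<forall>T c. finite T \<longrightarrow> T \<subseteq> {0..} \<longrightarrow> centred_normal M (\<lambda>\<omega>. \<Sum>s\<in>T. c s * B s \<omega>)) \<and>
     (AE \<omega> in M. B 0 \<omega> = 0) \<and>
     (\<forall>s\<ge>0. \<forall>t\<ge>0. (LINT \<omega>|M. (B t \<omega> - B s \<omega>)\<^sup>2) = A * \<bar>t - s\<bar> powr (2 * H))"

definition sample_path :: "(real \<Rightarrow> 'w \<Rightarrow> 'b) \<Rightarrow> 'w \<Rightarrow> real \<Rightarrow> 'b" where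
  "sample_path B \<omega> = (\<lambda>s\<in>{0..}. B s \<omega>)"

definition complex_fbm :: "'w measure \<Rightarrow> real \<Rightarrow> real \<Rightarrow> (real \<Rightarrow> 'w \<Rightarrow> complex) \<Rightarrow> bool" where
  "complex_fbm M H A B \<longleftrightarrow>
     real_fbm M H A (\<lambda>s \<omega>. Re (B s \<omega>)) \<and> real_fbm M H A (\<lambda>s \<omega>. Im (B s \<omega>)) \<and>
     prob_space.indep_var M
       (Pi\<^sub>M {0..} (\<lambda>_. borel)) (sample_path (\<lambda>s \<omega>. Re (B s \<omega>)))
       (Pi\<^sub>M {0..} (\<lambda>_. borel)) (sample_path (\<lambda>s \<omega>. Im (B s \<omega>)))"

definition harmonic_index :: "(nat \<times> int) set" where
  "harmonic_index = {(l, m). 1 \<le> l \<and> \<bar>m\<bar> \<le> int l}"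

text \<open>Mutual independence, as processes, of all the members of the two families together.\<close>
definition indep_processes ::
  "'w measure \<Rightarrow> (nat \<Rightarrow> int \<Rightarrow> real \<Rightarrow> 'w \<Rightarrow> complex) \<Rightarrow> (nat \<Rightarrow> int \<Rightarrow> real \<Rightarrow> 'w \<Rightarrow> complex) \<Rightarrow> bool"
  where
  "indep_processes M B1 B2 \<longleftrightarrow>
     prob_space.indep_vars M (\<lambda>_. Pi\<^sub>M {0..} (\<lambda>_. borel))
       (\<lambda>(b, l, m). sample_path (if b then B1 l m else B2 l m))
       ((UNIV :: bool set) \<times> harmonic_index)"


section \<open>Riemann--Stieltjes integrals with respect to a process\<close>

definition rs_sum ::
  "(real \<Rightarrow> 'w \<Rightarrow> real) \<Rightarrow> (real \<Rightarrow> real) \<Rightarrow> (real \<times> real set) set \<Rightarrow> 'w \<Rightarrow> real" where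
  "rs_sum B g p \<omega> = (\<Sum>(c, K)\<in>p. g c * (B (Sup K) \<omega> - B (Inf K) \<omega>))"

text \<open>
  \<open>J\<close> is the limit in probability of the Riemann--Stieltjes sums over \<open>[0, u]\<close> as the mesh tends
  to \<open>0\<close>. This includes limits in mean square and pathwise limits.
\<close>
definition has_rs_integral ::
  "'w measure \<Rightarrow> (real \<Rightarrow> 'w \<Rightarrow> real) \<Rightarrow> (real \<Rightarrow> real) \<Rightarrow> real \<Rightarrow> ('w \<Rightarrow> real) \<Rightarrow> bool" where
  "has_rs_integral M B g u J \<longleftrightarrow> J \<in> borel_measurable M \<and>
     (\<forall>\<epsilon>>0. \<forall>\<eta>>0. \<exists>\<delta>>0. \<forall>p. p tagged_division_of {0..u} \<longrightarrow> (\<lambda>c. ball c \<delta>) fine p \<longrightarrow>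
        measure M {\<omega>\<in>space M. \<bar>rs_sum B g p \<omega> - J \<omega>\<bar> > \<epsilon>} < \<eta>)"

text \<open>
  The integrands of interest have an integrable singularity at the upper limit \<open>t\<close>, where
  Riemann--Stieltjes sums are unbounded. The integral over \<open>[0, t]\<close> is therefore the improper one,
  the limit of the integrals over \<open>[0, u]\<close> as \<open>u\<close> increases to \<open>t\<close>.
\<close>
definition has_improper_rs_integral ::
  "'w measure \<Rightarrow> (real \<Rightarrow> 'w \<Rightarrow> real) \<Rightarrow> (real \<Rightarrow> real) \<Rightarrow> real \<Rightarrow> ('w \<Rightarrow> real) \<Rightarrow> bool" where
  "has_improper_rs_integral M B g t I \<longleftrightarrow> I \<in> borel_measurable M \<and>
     (\<exists>J. (\<forall>u\<in>{0<..<t}. has_rs_integral M B g u (J u)) \<and>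
          (\<forall>\<epsilon>>0. ((\<lambda>u. measure M {\<omega>\<in>space M. \<bar>J u \<omega> - I \<omega>\<bar> > \<epsilon>}) \<longlongrightarrow> 0) (at_left t)))"

definition has_complex_rs_integral ::
  "'w measure \<Rightarrow> (real \<Rightarrow> 'w \<Rightarrow> complex) \<Rightarrow> (real \<Rightarrow> real) \<Rightarrow> real \<Rightarrow> ('w \<Rightarrow> complex) \<Rightarrow> bool" where
  "has_complex_rs_integral M B g t I \<longleftrightarrow>
     (\<exists>I1 I2. has_improper_rs_integral M (\<lambda>s \<omega>. Re (B s \<omega>)) g t I1 \<and>
              has_improper_rs_integral M (\<lambda>s \<omega>. Im (B s \<omega>)) g t I2 \<and>
              (\<forall>\<omega>. I \<omega> = complex_of_real (I1 \<omega>) + \<i> * complex_of_real (I2 \<omega>)))"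


section \<open>The solution and its truncation\<close>

definition mittag_leffler :: "real \<Rightarrow> real \<Rightarrow> real \<Rightarrow> real" where
  "mittag_leffler a b z = (\<Sum>k. z ^ k / Gamma (a * real k + b))"

definition psi :: "real \<Rightarrow> real \<Rightarrow> real \<Rightarrow> real" where
  "psi \<alpha> \<gamma> s = s powr (\<alpha> / 2) * (1 + s) powr (\<gamma> / 2)"

definition noise_kernel :: "real \<Rightarrow> real \<Rightarrow> real \<Rightarrow> real \<Rightarrow> real" where
  "noise_kernel \<beta> c t s = (t - s) powr (\<beta> - 1) * mittag_leffler \<beta> \<beta> (- ((t - s) powr \<beta>) * c)"

text \<open>
  Partial sum of degrees \<open>1, \<dots>, N\<close>, given the Fourier coefficients \<open>fh\<close>, \<open>ft\<close> of the initial
  condition and the stochastic integrals \<open>Ih\<close>, \<open>It\<close>; \<open>c l\<close> stands for the value of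
  \<open>psi\<close> at \<open>eigval l\<close>.
\<close>
definition partial_field ::
  "(nat \<Rightarrow> int \<Rightarrow> real^3 \<Rightarrow> complex) \<Rightarrow> real \<Rightarrow> real \<Rightarrow> (nat \<Rightarrow> real) \<Rightarrow>
   (nat \<Rightarrow> int \<Rightarrow> 'w \<Rightarrow> complex) \<Rightarrow> (nat \<Rightarrow> int \<Rightarrow> 'w \<Rightarrow> complex) \<Rightarrow>
   (nat \<Rightarrow> int \<Rightarrow> 'w \<Rightarrow> complex) \<Rightarrow> (nat \<Rightarrow> int \<Rightarrow> 'w \<Rightarrow> complex) \<Rightarrow>
   nat \<Rightarrow> 'w \<Rightarrow> real^3 \<Rightarrow> complex^3" where
  "partial_field Y \<beta> t0 c fh ft Ih It N \<omega> x =
     (\<Sum>l=1..N. \<Sum>m=- int l..int l.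
        (fh l m \<omega> * complex_of_real (mittag_leffler \<beta> 1 (- (t0 powr \<beta>) * c l)) + Ih l m \<omega>)
          *s vsh_y Y l m x +
        (ft l m \<omega> * complex_of_real (mittag_leffler \<beta> 1 (- (t0 powr \<beta>) * c l)) + It l m \<omega>)
          *s vsh_z Y l m x)"

text \<open>The field \<open>X\<close> is the sum, in the space of random tangent fields, of the series with partial
  sums \<open>S N\<close>; it is determined up to null sets.\<close>
definition is_L2_field_sum ::
  "'w measure \<Rightarrow> (nat \<Rightarrow> 'w \<Rightarrow> real^3 \<Rightarrow> complex^3) \<Rightarrow> ('w \<Rightarrow> real^3 \<Rightarrow> complex^3) \<Rightarrow> bool" where
  "is_L2_field_sum M S X \<longleftrightarrow>
     random_tangent_L2 M X \<and> (\<lambda>N. L2_norm_field M (\<lambda>\<omega> x. X \<omega> x - S N \<omega> x)) \<longlonglongrightarrow> 0"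

text \<open>
  The series converges to \<open>X\<close> in mean square at the fixed point \<open>x\<close>. The integral is the one for
  nonnegative extended reals, so that it is infinite without square integrability.
\<close>
definition is_L2_sum_at ::
  "'w measure \<Rightarrow> (nat \<Rightarrow> 'w \<Rightarrow> real^3 \<Rightarrow> complex^3) \<Rightarrow> ('w \<Rightarrow> real^3 \<Rightarrow> complex^3) \<Rightarrow> real^3 \<Rightarrow> bool"
  where
  "is_L2_sum_at M S X x \<longleftrightarrow>
     (\<lambda>N. \<integral>\<^sup>+\<omega>. ennreal ((norm (X \<omega> x - S N \<omega> x))\<^sup>2) \<partial>M) \<longlonglongrightarrow> 0"

end

theory Submission
  imports Defs
begin

text \<open>
  The coefficients of \<open>X\<close> with respect to the vector spherical harmonics are pairwise uncorrelated, and
  by the addition theorem the sums over \<open>m\<close> of \<open>\<bar>y\<^sub>l\<^sub>m x\<bar>\<^sup>2\<close> and of \<open>\<bar>z\<^sub>l\<^sub>m x\<bar>\<^sup>2\<close> equal \<open>2 l + 1\<close> divided by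
  the area of the sphere, for every \<open>x\<close>. Hence the second moment of \<open>X - S L\<close> at \<open>x\<close> is bounded by the tail
  of \<open>(2 l + 1) D l\<close> uniformly in \<open>x\<close>; integration over the sphere gives the norm estimates, Markov's
  inequality the probability estimate.

  The variance of a coefficient is controlled by two facts. The Mittag-Leffler functions satisfy
  \<open>0 \<le> E\<^sub>b\<^sub>,\<^sub>1 (- z) \<le> 1\<close> and \<open>0 \<le> E\<^sub>b\<^sub>,\<^sub>b (- z) \<le> 1 / Gamma b\<close>, being limits of renewal sequences. So the kernel
  of the stochastic integral is at most a constant times \<open>(t - s) powr (\<beta> - 1)\<close>; as disjoint increments
  of the noise are nonnegatively correlated, splitting \<open>[0, t]\<close> into dyadic blocks bounds the variance of the
  integral by a multiple of \<open>A\<close> when \<open>\<beta> + H > 1\<close>. When \<open>\<beta> + H \<le> 1\<close> the same blocks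
  show that the integral exists only if \<open>A = 0\<close>. In both cases \<open>A l * c l powr \<tau> = A l\<close> for \<open>l \<ge> 1\<close>.
\<close>

section \<open>Mittag-Leffler functions on the negative half-line\<close>

text \<open>The stochastic integrals enter only as limits in probability, so neither their moments
  nor their covariances are given. Grid sums converging almost surely are extracted, Fatou's lemma
  bounds the second moment, and orthogonality reaches the limit by truncation. Since
  Riemann-Stieltjes integrals are available only over \<open>{0..u}\<close> with
  \<open>u < t\<close>, the cut has to be fixed before the mesh is refined.

  The threshold \<open>\<beta> + H = 1\<close> comes from counting powers: over a block near
  \<open>t\<close>, of length and distance to \<open>t\<close> about \<open>r\<close>, the sum has
  variance of order \<open>A * r powr (2 * (\<beta> - 1) + 2 * H)\<close>. For
  \<open>r = t / 2 ^ j\<close> this is geometric in \<open>j\<close>, with ratio below 1 precisely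
  when \<open>\<beta> + H > 1\<close>. The upper bound is free of \<open>c l\<close>, so one
  constant serves all degrees.

  The basis \<open>Y\<close> is arbitrary and known only on the sphere; the addition theorem is
  therefore derived from the rotation invariance of the harmonics of one degree, and polynomial
  extensions supply the derivatives. \<open>X\<close> is known only as a limit in \<open>L2\<close>;
  single points are reached by Fatou's lemma along the truncations.\<close>

definition rising_coeff :: "real \<Rightarrow> nat \<Rightarrow> real" where
  "rising_coeff x n = pochhammer x n / fact n"

lemma rising_coeff_0 [simp]: "rising_coeff x 0 = 1"
  by (simp add: rising_coeff_def)

lemma rising_coeff_Suc: "rising_coeff x (Suc n) = rising_coeff x n * (x + real n) / real (Suc n)"
  by (simp add: rising_coeff_def pochhammer_Suc field_simps)

lemma rising_coeff_one: "rising_coeff 1 n = 1"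
  by (simp add: rising_coeff_def pochhammer_fact [symmetric])

lemma rising_coeff_nonneg: "0 \<le> x \<Longrightarrow> 0 \<le> rising_coeff x n"
  by (induction n) (auto simp: rising_coeff_Suc)

text \<open>The first factor \<open>- b\<close> fixes the sign, and all later factors
  \<open>real n - b\<close> with \<open>n \<ge> 1\<close> are nonnegative because
  \<open>b \<le> 1\<close>. These are the coefficients of \<open>(1 - X) powr b\<close>; their sign
  is the origin of the positivity of the Mittag-Leffler functions below.\<close>

lemma rising_coeff_uminus_nonpos:
  assumes "0 \<le> b" "b \<le> 1" shows "rising_coeff (- b) (Suc n) \<le> 0"
proof (induction n)
  case 0
  then show ?case using assms by (simp add: rising_coeff_Suc)
next
  case (Suc n)
  then show ?case
    using assms by (subst rising_coeff_Suc) (auto intro!: divide_nonpos_nonneg mult_nonpos_nonneg)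
qed

text \<open>Vandermonde's identity for rising factorials: it compares coefficients in the product of
  \<open>(1 - X) powr (- x)\<close> and \<open>(1 - X) powr (- y)\<close>. As \<open>x\<close> and
  \<open>y\<close> are arbitrary reals, negative parameters are covered too.\<close>

lemma rising_coeff_add:
  "rising_coeff (x + y) n = (\<Sum>i\<le>n. rising_coeff x i * rising_coeff y (n - i))"
proof -
  have *: "real (n choose i) * pochhammer x i * pochhammer y (n - i) / fact n
      = rising_coeff x i * rising_coeff y (n - i)" if "i \<le> n" for i
    using binomial_fact [OF that, where ?'a = real] by (simp add: rising_coeff_def)
  then show ?thesis
    by (simp add: rising_coeff_def pochhammer_binomial_sum [of x y n] sum_divide_distrib *)
qed

lemma rising_coeff_sums:
  assumes "0 \<le> y" "y < 1"
  shows "(\<lambda>n. rising_coeff x n * y ^ n) sums (1 - y) powr (- x)"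
proof -
  have "(\<lambda>n. ((- x) gchoose n) * (- y) ^ n) sums (1 + - y) powr (- x)"
    using assms by (intro gen_binomial_real) auto
  moreover have "((- x) gchoose n) * (- y) ^ n = rising_coeff x n * y ^ n" for n
  proof -
    have "(- 1 :: real) ^ n * (- 1) ^ n = 1" by (simp flip: power_mult_distrib)
    moreover have "(- y) ^ n = (- 1) ^ n * y ^ n" by (rule power_minus)
    moreover have "((- x) gchoose n) = (- 1) ^ n * rising_coeff x n"
      by (simp add: gbinomial_pochhammer rising_coeff_def)
    ultimately show ?thesis by (metis (no_types, lifting) mult.assoc mult.commute mult_1)
  qed
  ultimately show ?thesis by simp
qed

lemma sum_rising_coeff_le:
  assumes "0 \<le> y" "y < 1" "0 \<le> x" "finite N"
  shows "(\<Sum>n\<in>N. rising_coeff x n * y ^ n) \<le> (1 - y) powr (- x)"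
proof -
  note s = rising_coeff_sums [OF assms(1,2), of x]
  have "(\<Sum>n\<in>N. rising_coeff x n * y ^ n) \<le> (\<Sum>n. rising_coeff x n * y ^ n)"
    using assms by (intro sum_le_suminf sums_summable [OF s] mult_nonneg_nonneg rising_coeff_nonneg) auto
  then show ?thesis using sums_unique [OF s] by simp
qed

text \<open>Cauchy's estimate with radius \<open>y\<close>. At a fixed \<open>n\<close> it grows
  exponentially in \<open>x\<close>, which is enough to sum the expansions in
  \<open>renewal\<close>; for \<open>n\<close> tending to infinity the sharper
  \<open>rising_coeff_bound\<close> takes over.\<close>

lemma rising_coeff_le_powr:
  assumes "0 < y" "y < 1" "0 \<le> x"
  shows "rising_coeff x n \<le> (1 - y) powr (- x) / y ^ n"
  using sum_rising_coeff_le [of y x "{n}"] assms by (simp add: field_simps)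

lemma rising_coeff_mono:
  assumes "1 \<le> x" "m \<le> n" shows "rising_coeff x m \<le> rising_coeff x n"
  using assms(2)
proof (induction rule: dec_induct)
  case (step n)
  have "rising_coeff x n * 1 \<le> rising_coeff x n * ((x + real n) / real (Suc n))"
    using assms(1) by (intro mult_left_mono rising_coeff_nonneg) auto
  then show ?case using step by (simp add: rising_coeff_Suc)
qed simp

lemma rising_coeff_shift: "n > 0 \<Longrightarrow> rising_coeff x n = x / real n * rising_coeff (x + 1) (n - 1)"
  by (cases n) (simp_all add: rising_coeff_def pochhammer_rec field_simps)

text \<open>Estimating one coefficient by the whole power series loses a factor \<open>n\<close>;
  monotonicity of the coefficients recovers it.\<close>
lemma rising_coeff_bound:
  assumes "0 < x" "0 < K" "2 * K \<le> real n"
  shows "real n powr (1 - x) * rising_coeff x n \<le> x * exp (4 * K) * K powr (- x - 1)"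
proof -
  have n: "real n > 0" "n > 0" using assms by (linarith, auto intro: gr0I)
  \<comment> \<open>The radius tends to 1 at the rate \<open>K / n\<close>: then
    \<open>y ^ (2 * n)\<close> stays above \<open>exp (- 4 * K)\<close>, while
    \<open>(1 - y) powr (- x - 1)\<close> supplies the required power of \<open>n\<close>.\<close>
  define y where "y = 1 - K / real n"
  have y: "0 < y" "y < 1" "1 - y = K / real n"
    using assms n by (auto simp: y_def field_simps)
  have "exp (- 2 * (K / real n)) \<le> y"
  proof -
    have "- (K / n) - 2 * (K / n)\<^sup>2 \<le> ln (1 - K / n)"
      using assms n by (intro ln_one_minus_pos_lower_bound) (auto simp: field_simps)
    moreover have "2 * (K / n)\<^sup>2 \<le> K / n"
      using assms n by (simp add: field_simps power2_eq_square)
    ultimately have "- 2 * (K / n) \<le> ln y" by (simp add: y_def)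
    then show ?thesis using y(1) by (simp add: ln_ge_iff)
  qed
  then have "exp (- 2 * (K / real n)) ^ (2 * n) \<le> y ^ (2 * n)"
    by (intro power_mono) auto
  moreover have "exp (- 2 * (K / real n)) ^ (2 * n) = exp (- 4 * K)"
    using n by (simp flip: exp_of_nat_mult)
  ultimately have yb: "exp (- 4 * K) \<le> y ^ (2 * n)" by simp
  have "real n * (rising_coeff (x + 1) n * y ^ (2 * n))
      \<le> (\<Sum>m\<in>{n..2*n}. rising_coeff (x + 1) n * y ^ (2 * n))"
    using assms y by (auto intro!: mult_nonneg_nonneg rising_coeff_nonneg simp: algebra_simps)
  also have "\<dots> \<le> (\<Sum>m\<in>{n..2*n}. rising_coeff (x + 1) m * y ^ m)"
    using assms y by (intro sum_mono mult_mono rising_coeff_mono power_decreasing rising_coeff_nonneg) auto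
  also have "\<dots> \<le> (1 - y) powr (- (x + 1))"
    using assms y by (intro sum_rising_coeff_le) auto
  finally have *: "real n * (rising_coeff (x + 1) n * y ^ (2 * n)) \<le> (K / n) powr (- (x + 1))"
    using y by simp
  have "real n * (rising_coeff (x + 1) n * exp (- 4 * K)) \<le> real n * (rising_coeff (x + 1) n * y ^ (2 * n))"
    using yb assms by (intro mult_left_mono rising_coeff_nonneg) auto
  also note *
  finally have "real n * rising_coeff (x + 1) n \<le> exp (4 * K) * (K / n) powr (- (x + 1))"
    by (simp add: exp_minus field_simps)
  also have "(K / n) powr (- (x + 1)) = K powr (- x - 1) * real n powr (x + 1)"
    using assms n by (simp add: powr_divide powr_minus powr_add powr_diff field_simps)
  finally have b: "real n * rising_coeff (x + 1) n \<le> exp (4 * K) * (K powr (- x - 1) * real n powr (x + 1))" .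
  \<comment> \<open>Monotonicity needs a parameter at least 1, so \<open>x\<close> is shifted to
    \<open>x + 1\<close>; the shift costs the factor \<open>x / n\<close> and lowers the index by
    one, which monotonicity undoes.\<close>
  have "real n powr (1 - x) * rising_coeff x n
      \<le> real n powr (1 - x) * (x / n * rising_coeff (x + 1) n)"
    using rising_coeff_shift [OF n(2), of x] rising_coeff_mono [of "x + 1" "n - 1" n] assms n
    by (intro mult_left_mono) (auto intro!: divide_right_mono mult_left_mono)
  also have "\<dots> = real n powr (1 - x) * (x / (n * n)) * (real n * rising_coeff (x + 1) n)"
    using n by (simp add: field_simps)
  also have "\<dots> \<le> real n powr (1 - x) * (x / (n * n)) * (exp (4 * K) * (K powr (- x - 1) * real n powr (x + 1)))"
    using b assms n by (intro mult_left_mono) auto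
  also have "\<dots> = x * exp (4 * K) * K powr (- x - 1)"
    using n by (simp add: powr_diff powr_add field_simps power2_eq_square)
  finally show ?thesis .
qed

text \<open>Euler's limit formula for the reciprocal Gamma function. \<open>rGamma_series\<close>
  uses the rising factorial with one more factor \<open>x + n\<close>, hence the correction
  \<open>n / (x + n)\<close>, which tends to 1.\<close>

lemma rising_coeff_tendsto:
  assumes "0 < x"
  shows "(\<lambda>n. real n powr (1 - x) * rising_coeff x n) \<longlonglongrightarrow> 1 / Gamma x"
proof -
  have "(\<lambda>n. real n / (x + real n)) \<longlonglongrightarrow> 1"
    using assms by real_asymp
  then have "(\<lambda>n. rGamma_series x n * (real n / (x + real n))) \<longlonglongrightarrow> rGamma x * 1"
    by (intro tendsto_mult rGamma_series_LIMSEQ)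
  moreover have "\<forall>\<^sub>F n in sequentially. rGamma_series x n * (real n / (x + real n))
      = real n powr (1 - x) * rising_coeff x n"
    using eventually_gt_at_top [of 0]
  proof eventually_elim
    case (elim n)
    have "exp (x * ln (real n)) = real n powr x"
      using elim by (simp add: powr_def)
    moreover have "p * s / (f * q) * (m / s) = m / q * (p / f)" if "s \<noteq> 0" for p s f q m :: real
      using that by (simp add: mult.commute)
    ultimately show ?case using elim assms
      by (simp add: rGamma_series_def rising_coeff_def pochhammer_Suc powr_diff mult.commute)
  qed
  ultimately show ?thesis
    using tendsto_cong by (force simp: rGamma_inverse_Gamma inverse_eq_divide)
qed

section \<open>Renewal sequences as discrete Mittag-Leffler functions\<close>

locale renewal =
  fixes a b y :: real
  assumes a: "0 \<le> a" and b: "0 < b" "b \<le> 1" and y: "0 < y" "y < 1"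
    and small: "a * (1 - y) powr (- b) < 1"
begin

text \<open>The coefficient of \<open>X ^ n\<close> in
  \<open>(1 - X) powr (- s) / (1 + a * (1 - X) powr (- b))\<close>, expanded as a geometric series
  in \<open>a\<close>. With \<open>a = z / n powr b\<close> and rescaled by a power of
  \<open>n\<close> it tends to the Mittag-Leffler series at \<open>- z\<close>. The radius
  \<open>y\<close> of the locale witnesses that the geometric series converges.\<close>

definition series :: "real \<Rightarrow> nat \<Rightarrow> real" where
  "series s n = (\<Sum>j. (- a) ^ j * rising_coeff (b * real j + s) n)"

lemma summable_series:
  assumes "0 \<le> s" shows "summable (\<lambda>j. (- a) ^ j * rising_coeff (b * real j + s) n)"
proof (rule summable_comparison_test')
  show "summable (\<lambda>j. (1 - y) powr (- s) / y ^ n * (a * (1 - y) powr (- b)) ^ j)"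
    using a small by (intro summable_mult summable_geometric) auto
  fix j :: nat
  have "norm ((- a) ^ j * rising_coeff (b * real j + s) n) = a ^ j * rising_coeff (b * real j + s) n"
    using a b assms by (simp add: abs_mult power_abs rising_coeff_nonneg)
  also have "\<dots> \<le> a ^ j * ((1 - y) powr (- (b * real j + s)) / y ^ n)"
    using a b y assms by (intro mult_left_mono rising_coeff_le_powr) auto
  also have "(1 - y) powr (- (b * real j + s)) = (1 - y) powr (- s) * ((1 - y) powr (- b)) ^ j"
    using y by (simp add: powr_realpow [symmetric] powr_powr powr_add [symmetric] algebra_simps)
  finally show "norm ((- a) ^ j * rising_coeff (b * real j + s) n)
      \<le> (1 - y) powr (- s) / y ^ n * (a * (1 - y) powr (- b)) ^ j"
    by (simp add: power_mult_distrib mult_ac)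
qed

text \<open>Splitting off the term \<open>j = 0\<close> gives
  \<open>G s = (1 - X) powr (- s) - a * G (s + b)\<close> for the generating functions.\<close>

lemma series_rec:
  assumes "0 \<le> s" shows "series s n = rising_coeff s n - a * series (s + b) n"
proof -
  have "series s n = rising_coeff s n + (\<Sum>j. (- a) ^ Suc j * rising_coeff (b * real (Suc j) + s) n)"
    using suminf_split_head [OF summable_series [OF assms, of n]] by (simp add: series_def)
  also have "(\<Sum>j. (- a) ^ Suc j * rising_coeff (b * real (Suc j) + s) n)
      = (\<Sum>j. (- a) * ((- a) ^ j * rising_coeff (b * real j + (s + b)) n))"
    by (simp add: algebra_simps)
  also have "\<dots> = (- a) * series (s + b) n"
    unfolding series_def using b assms by (intro suminf_mult summable_series) auto
  finally show ?thesis by simp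
qed

lemma series_add:
  assumes "0 \<le> s"
  shows "series (s + x) n = (\<Sum>i\<le>n. rising_coeff x i * series s (n - i))"
proof -
  have "(\<Sum>i\<le>n. rising_coeff x i * series s (n - i))
      = (\<Sum>i\<le>n. \<Sum>j. rising_coeff x i * ((- a) ^ j * rising_coeff (b * real j + s) (n - i)))"
    unfolding series_def by (intro sum.cong refl suminf_mult [symmetric] summable_series assms)
  also have "\<dots> = (\<Sum>j. \<Sum>i\<le>n. rising_coeff x i * ((- a) ^ j * rising_coeff (b * real j + s) (n - i)))"
    by (intro suminf_sum [symmetric] summable_mult summable_series assms)
  also have "\<dots> = series (s + x) n"
    unfolding series_def
  proof (intro suminf_cong)
    fix j
    have "(\<Sum>i\<le>n. rising_coeff x i * ((- a) ^ j * rising_coeff (b * real j + s) (n - i)))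
        = (- a) ^ j * (\<Sum>i\<le>n. rising_coeff x i * rising_coeff (b * real j + s) (n - i))"
      by (simp add: sum_distrib_left mult_ac)
    then show "(\<Sum>i\<le>n. rising_coeff x i * ((- a) ^ j * rising_coeff (b * real j + s) (n - i)))
        = (- a) ^ j * rising_coeff (b * real j + (s + x)) n"
      by (simp add: rising_coeff_add [symmetric] algebra_simps)
  qed
  finally show ?thesis ..
qed

text \<open>The generating function of \<open>series b\<close> is \<open>1 / ((1 - X) powr b + a)\<close>, and apart from its
  constant term \<open>1\<close>, \<open>(1 - X) powr b\<close> has only nonpositive coefficients.\<close>
lemma series_b_nonneg: "0 \<le> series b n"
proof (induction n rule: less_induct)
  case (less n)
  have "series 0 n = (\<Sum>i\<le>n. rising_coeff (- b) i * series b (n - i))"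
    using series_add [of b "- b" n] b by simp
  moreover have "series 0 n = rising_coeff 0 n - a * series b n"
    using series_rec [of 0 n] by simp
  moreover have "(\<Sum>i\<le>n. rising_coeff (- b) i * series b (n - i))
      = series b n + (\<Sum>i\<in>{1..n}. rising_coeff (- b) i * series b (n - i))"
    by (simp add: atMost_atLeast0 sum.atLeast_Suc_atMost)
  moreover have "(\<Sum>i\<in>{1..n}. rising_coeff (- b) i * series b (n - i)) \<le> 0"
  proof (intro sum_nonpos mult_nonpos_nonneg)
    fix i assume i: "i \<in> {1..n}"
    then obtain k where "i = Suc k" by (cases i) auto
    then show "rising_coeff (- b) i \<le> 0" using rising_coeff_uminus_nonpos b by simp
    show "0 \<le> series b (n - i)" using i by (intro less) auto
  qed
  moreover have "0 \<le> rising_coeff 0 n" by (simp add: rising_coeff_nonneg)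
  \<comment> \<open>Equating the two expressions of \<open>series 0 n\<close> reads off the
    coefficient of \<open>X ^ n\<close> in \<open>((1 - X) powr b + a) * G = 1\<close>; the term
    with index 0 of the convolution contributes the 1 in \<open>1 + a\<close>.\<close>
  ultimately have "0 \<le> (1 + a) * series b n" by (simp add: algebra_simps)
  then show ?case using a by (simp add: zero_le_mult_iff)
qed

lemma series_b_add_nonneg: "0 \<le> x \<Longrightarrow> 0 \<le> series (b + x) n"
  using b by (subst series_add) (auto intro!: sum_nonneg mult_nonneg_nonneg rising_coeff_nonneg series_b_nonneg)

lemma series_b_le: "series b n \<le> rising_coeff b n"
  using series_rec [of b n] series_b_add_nonneg [of b n] a b by simp

text \<open>The first two terms of the expansion in \<open>a\<close> are a lower bound: the
  remainder \<open>series (b + b)\<close> is a convolution of \<open>rising_coeff b\<close> with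
  \<open>series b\<close>, and the latter is at most \<open>rising_coeff b\<close>.\<close>

lemma series_b_ge: "rising_coeff b n - a * rising_coeff (2 * b) n \<le> series b n"
proof -
  have "series (b + b) n \<le> (\<Sum>i\<le>n. rising_coeff b i * rising_coeff b (n - i))"
    using b by (subst series_add) (auto intro!: sum_mono mult_left_mono rising_coeff_nonneg series_b_le)
  then have "series (b + b) n \<le> rising_coeff (b + b) n" by (simp only: rising_coeff_add)
  then show ?thesis using series_rec [of b n] a b by (simp add: mult_left_mono)
qed

lemma series_1_nonneg: "0 \<le> series 1 n"
  using series_b_add_nonneg [of "1 - b"] b by simp

lemma series_1_le: "series 1 n \<le> 1"
  using series_rec [of 1 n] series_b_add_nonneg [of 1 n] a by (simp add: rising_coeff_one add.commute)

end

text \<open>With \<open>a = z / n powr b\<close> the \<open>j\<close>-th term of the rescaled series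
  converges to \<open>(- z) ^ j / Gamma (b * j + s)\<close> by \<open>rising_coeff_tendsto\<close>;
  Tannery's theorem permits the summation over \<open>j\<close> in the limit.\<close>

lemma mittag_leffler_tendsto:
  assumes "0 < b" "b \<le> 1" "0 < s" "s \<le> 1" "0 \<le> z"
  shows "(\<lambda>n. real n powr (1 - s) * renewal.series (z / real n powr b) b s n) \<longlonglongrightarrow> mittag_leffler b s (- z)"
    and "\<forall>\<^sub>F n in sequentially. \<exists>y. renewal (z / real n powr b) b y"
proof -
  \<comment> \<open>\<open>K powr b = 4 * z + 1\<close> is chosen so that the majorant below has
    ratio \<open>2 * z / (4 * z + 1) \<le> 1/2\<close>; the factor 2 in the numerator absorbs the
    linear factor \<open>x \<le> j + 1 \<le> 2 ^ j\<close> from \<open>rising_coeff_bound\<close>.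
    The same \<open>K\<close> gives the radius \<open>1 - K / n\<close> for
    \<open>renewal\<close>.\<close>
  define K where "K = (4 * z + 1) powr (1 / b)"
  have K: "K \<ge> 1" "K powr b = 4 * z + 1"
    using assms by (auto simp: K_def powr_powr intro!: ge_one_powr_ge_zero)
  have ren: "renewal (z / real n powr b) b (1 - K / real n)" if "2 * K \<le> real n" for n
  proof -
    have "z / real n powr b * (K / real n) powr - b = z / K powr b"
      using that K by (simp add: powr_divide powr_minus field_simps)
    also have "\<dots> < 1" using K assms by (simp add: field_simps)
    finally show ?thesis
      using that K assms by unfold_locales (auto simp: field_simps)
  qed
  have ev: "\<forall>\<^sub>F n in sequentially. 2 * K \<le> real n" by real_asymp
  show "\<forall>\<^sub>F n in sequentially. \<exists>y. renewal (z / real n powr b) b y"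
    using ev by eventually_elim (use ren in blast)
  define T where "T = (\<lambda>j n. (- z) ^ j * (real n powr (1 - (b * real j + s)) * rising_coeff (b * real j + s) n))"
  have "(\<lambda>n. \<Sum>j. T j n) \<longlonglongrightarrow> (\<Sum>j. (- z) ^ j * (1 / Gamma (b * real j + s)))"
  proof (rule tannerys_theorem [THEN conjunct2, THEN conjunct2])
    show "(\<lambda>n. T j n) \<longlonglongrightarrow> (- z) ^ j * (1 / Gamma (b * real j + s))" for j
      unfolding T_def using assms
      by (intro tendsto_mult_left rising_coeff_tendsto add_nonneg_pos) auto
    show "summable (\<lambda>j. exp (4 * K) * (1 / 2) ^ j :: real)"
      by (intro summable_mult summable_geometric) auto
    have bd: "norm (T j n) \<le> exp (4 * K) * (1 / 2) ^ j" if "2 * K \<le> real n" for j n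
    proof -
      define x where "x = b * real j + s"
      have x: "0 < x" "x \<le> real j + 1" "b * real j \<le> x"
        using assms mult_right_mono[of b 1 "real j"] by (auto simp: x_def intro!: add_nonneg_pos)
      have "norm (T j n) = z ^ j * (real n powr (1 - x) * rising_coeff x n)"
        using assms x by (simp add: T_def x_def [symmetric] abs_mult power_abs rising_coeff_nonneg)
      also have "\<dots> \<le> z ^ j * (x * exp (4 * K) * K powr (- x - 1))"
        using that x K assms by (intro mult_left_mono rising_coeff_bound) auto
      also have "\<dots> \<le> z ^ j * (2 ^ j * exp (4 * K) * K powr (- (b * real j)))"
      proof -
        have "j + 1 \<le> 2 ^ j" by (induction j) auto
        then have "real (j + 1) \<le> real (2 ^ j)" by (simp only: of_nat_le_iff)
        then have "x \<le> 2 ^ j" using x by simp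
        then show ?thesis
          using K x assms by (intro mult_left_mono mult_mono powr_mono) auto
      qed
      also have "K powr (- (b * real j)) = 1 / (4 * z + 1) ^ j"
        unfolding K(2) [symmetric] using K(1) by (simp add: powr_minus powr_powr [symmetric] powr_realpow divide_inverse)
      also have "z ^ j * (2 ^ j * exp (4 * K) * (1 / (4 * z + 1) ^ j)) = exp (4 * K) * (2 * z / (4 * z + 1)) ^ j"
        by (simp add: power_mult_distrib power_divide)
      also have "\<dots> \<le> exp (4 * K) * (1 / 2) ^ j"
        using assms by (intro mult_left_mono power_mono) (auto simp: field_simps)
      finally show ?thesis .
    qed
    show "\<forall>\<^sub>F (j, n) in at_top \<times>\<^sub>F sequentially. norm (T j n) \<le> exp (4 * K) * (1 / 2) ^ j"
      using eventually_prodI [OF eventually_ge_at_top [of 0] ev]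
      by (rule eventually_mono) (use bd in auto)
  qed auto
  then have lim: "(\<lambda>n. \<Sum>j. T j n) \<longlonglongrightarrow> mittag_leffler b s (- z)"
    by (simp add: mittag_leffler_def)
  have "\<forall>\<^sub>F n in sequentially. (\<Sum>j. T j n) = real n powr (1 - s) * renewal.series (z / real n powr b) b s n"
    using ev
  proof eventually_elim
    case (elim n)
    then interpret renewal "z / real n powr b" b "1 - K / real n" by (rule ren)
    have "T j n = real n powr (1 - s) * ((- (z / real n powr b)) ^ j * rising_coeff (b * real j + s) n)" for j
    proof -
      have "real n > 0" using elim K by linarith
      then have "real n powr (1 - (b * real j + s)) = real n powr (1 - s) / (real n powr b) ^ j"
        by (simp add: powr_realpow [symmetric] powr_powr powr_diff [symmetric] algebra_simps)
      then show ?thesis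
        unfolding T_def minus_divide_left power_divide by (simp add: mult_ac)
    qed
    then show ?case
      unfolding series_def using assms by (simp only:) (intro suminf_mult summable_series, auto)
  qed
  then show "(\<lambda>n. real n powr (1 - s) * renewal.series (z / real n powr b) b s n) \<longlonglongrightarrow> mittag_leffler b s (- z)"
    using lim by (rule Lim_transform_eventually [rotated])
qed

text \<open>Each inequality holds for the renewal sequences at every large \<open>n\<close> and
  survives the limit. The last one keeps \<open>mittag_leffler b b\<close> away from 0 for small
  \<open>z\<close>, which bounds the kernel of the noise from below close to
  \<open>t\<close>.\<close>

lemma
  assumes "0 < b" "b \<le> 1" "0 \<le> z"
  shows mittag_leffler_1_nonneg: "0 \<le> mittag_leffler b 1 (- z)"
    and mittag_leffler_1_le: "mittag_leffler b 1 (- z) \<le> 1"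
    and mittag_leffler_diag_nonneg: "0 \<le> mittag_leffler b b (- z)"
    and mittag_leffler_diag_le: "mittag_leffler b b (- z) \<le> 1 / Gamma b"
    and mittag_leffler_diag_ge: "1 / Gamma b - z / Gamma (2 * b) \<le> mittag_leffler b b (- z)"
proof -
  note lim1 = mittag_leffler_tendsto(1) [OF assms(1,2) zero_less_one order_refl assms(3)]
  note limb = mittag_leffler_tendsto(1) [OF assms(1,2) assms(1,2) assms(3)]
  note ev = eventually_conj [OF eventually_gt_at_top [of 0] mittag_leffler_tendsto(2) [OF assms(1,2) assms(1,2) assms(3)]]
  show "0 \<le> mittag_leffler b 1 (- z)"
    using ev by (intro tendsto_lowerbound [OF lim1]) (auto elim!: eventually_mono simp: renewal.series_1_nonneg)
  show "mittag_leffler b 1 (- z) \<le> 1"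
    using ev by (intro tendsto_upperbound [OF lim1]) (auto elim!: eventually_mono simp: renewal.series_1_le)
  show "0 \<le> mittag_leffler b b (- z)"
    using ev by (intro tendsto_lowerbound [OF limb]) (auto elim!: eventually_mono simp: renewal.series_b_nonneg)
  show "mittag_leffler b b (- z) \<le> 1 / Gamma b"
    using ev assms by (intro tendsto_le [OF _ rising_coeff_tendsto limb])
      (auto elim!: eventually_mono intro!: mult_left_mono simp: renewal.series_b_le)
  have "(\<lambda>n. real n powr (1 - b) * rising_coeff b n - z * (real n powr (1 - 2 * b) * rising_coeff (2 * b) n))
      \<longlonglongrightarrow> 1 / Gamma b - z * (1 / Gamma (2 * b))"
    using assms by (intro tendsto_diff tendsto_mult_left rising_coeff_tendsto) auto
  moreover have "\<forall>\<^sub>F n in sequentially. real n powr (1 - b) * rising_coeff b n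
        - z * (real n powr (1 - 2 * b) * rising_coeff (2 * b) n)
      \<le> real n powr (1 - b) * renewal.series (z / real n powr b) b b n"
    using ev
  proof eventually_elim
    case (elim n)
    then obtain y where "renewal (z / real n powr b) b y" by auto
    from renewal.series_b_ge [OF this, of n]
    have "real n powr (1 - b) * (rising_coeff b n - z / real n powr b * rising_coeff (2 * b) n)
        \<le> real n powr (1 - b) * renewal.series (z / real n powr b) b b n"
      by (intro mult_left_mono) auto
    moreover have "real n powr (1 - 2 * b) = real n powr (1 - b) / real n powr b"
      using elim by (simp add: powr_diff [symmetric])
    ultimately show ?case by (simp add: right_diff_distrib mult_ac)
  qed
  ultimately show "1 / Gamma b - z / Gamma (2 * b) \<le> mittag_leffler b b (- z)"
    using limb by (auto intro: tendsto_le [rotated 2])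
qed

section \<open>Polynomials on three-dimensional space\<close>

text \<open>An inductive description of the complex polynomials: \<open>partial_deriv\<close> rests
  on a choice operator, and its rules become accessible by induction on the construction of the
  polynomial.\<close>

inductive cpoly :: "(real^3 \<Rightarrow> complex) \<Rightarrow> bool" where
  cpoly_const: "cpoly (\<lambda>x. c)"
| cpoly_coord: "cpoly (\<lambda>x. complex_of_real (x $ i))"
| cpoly_add: "cpoly f \<Longrightarrow> cpoly g \<Longrightarrow> cpoly (\<lambda>x. f x + g x)"
| cpoly_mult: "cpoly f \<Longrightarrow> cpoly g \<Longrightarrow> cpoly (\<lambda>x. f x * g x)"

lemma cpoly_uminus: "cpoly f \<Longrightarrow> cpoly (\<lambda>x. - f x)"
  using cpoly_mult [OF cpoly_const [of "-1"]] by simp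

lemma cpoly_diff: "cpoly f \<Longrightarrow> cpoly g \<Longrightarrow> cpoly (\<lambda>x. f x - g x)"
  using cpoly_add [OF _ cpoly_uminus] by simp

lemma cpoly_sum: "(\<And>i. i \<in> I \<Longrightarrow> cpoly (f i)) \<Longrightarrow> cpoly (\<lambda>x. \<Sum>i\<in>I. f i x)"
  by (induction I rule: infinite_finite_induct) (auto intro: cpoly_const cpoly_add)

lemma cpoly_cnj: "cpoly f \<Longrightarrow> cpoly (\<lambda>x. cnj (f x))"
  by (induction rule: cpoly.induct) (auto intro: cpoly.intros)

lemmas cpoly_intros = cpoly.intros cpoly_diff cpoly_uminus cpoly_sum cpoly_cnj

lemma real3_eq_sum_axis: "(x :: real^3) = (\<Sum>i\<in>UNIV. x $ i *\<^sub>R axis i 1)"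
  by (simp add: vec_eq_iff axis_def sum_3 forall_3)

lemma cpoly_real_linear:
  assumes "linear (f :: real^3 \<Rightarrow> real)" shows "cpoly (\<lambda>x. complex_of_real (f x))"
proof -
  have "f x = (\<Sum>i\<in>UNIV. x $ i * f (axis i 1))" for x
  proof -
    have "f x = f (\<Sum>i\<in>UNIV. x $ i *\<^sub>R axis i 1)"
      by (rule arg_cong [OF real3_eq_sum_axis])
    also have "\<dots> = (\<Sum>i\<in>UNIV. f (x $ i *\<^sub>R axis i 1))"
      by (rule linear_sum [OF assms])
    finally show ?thesis by (simp add: linear_cmul [OF assms])
  qed
  then have "(\<lambda>x. complex_of_real (f x)) = (\<lambda>x. complex_of_real (\<Sum>i\<in>UNIV. x $ i * f (axis i 1)))"
    by metis
  also have "\<dots> = (\<lambda>x. \<Sum>i\<in>UNIV. complex_of_real (x $ i) * complex_of_real (f (axis i 1)))"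
    by simp
  finally show ?thesis
    by (simp only:) (rule cpoly_sum, rule cpoly_mult, rule cpoly_coord, rule cpoly_const)
qed

lemma cpoly_real_polynomial:
  "real_polynomial_function f \<Longrightarrow> cpoly (\<lambda>x. complex_of_real (f x))"
  by (induction rule: real_polynomial_function.induct)
    (simp_all add: cpoly.intros cpoly_real_linear bounded_linear.linear)

lemma cpoly_polynomial_function:
  assumes "polynomial_function (p :: real^3 \<Rightarrow> complex)" shows "cpoly p"
proof -
  have "real_polynomial_function (\<lambda>x. Re (p x))" "real_polynomial_function (\<lambda>x. Im (p x))"
    using assms by (auto simp: polynomial_function_def o_def bounded_linear_Re bounded_linear_Im)
  then have "cpoly (\<lambda>x. complex_of_real (Re (p x)) + \<i> * complex_of_real (Im (p x)))"
    by (intro cpoly_intros cpoly_real_polynomial)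
  then show ?thesis by (simp flip: complex_eq)
qed

lemma cpoly_linear_compose:
  assumes "cpoly f" "linear (R :: real^3 \<Rightarrow> real^3)" shows "cpoly (\<lambda>x. f (R x))"
  using assms(1)
proof (induction rule: cpoly.induct)
  case (cpoly_coord i)
  have "linear (\<lambda>x. R x $ i)"
    using assms(2) by (simp add: linear_iff)
  then show ?case by (rule cpoly_real_linear)
qed (auto intro: cpoly_intros)

text \<open>The coefficients \<open>D i\<close> are existential here: \<open>partial_deriv\<close>
  can be evaluated once a total derivative is known, so the identification comes afterwards through
  \<open>partial_deriv_eqI\<close>.\<close>

lemma cpoly_has_derivative_ex:
  "cpoly f \<Longrightarrow> \<exists>D. (\<forall>i. cpoly (D i)) \<and>
     (\<forall>x. (f has_derivative (\<lambda>h. \<Sum>i\<in>UNIV. complex_of_real (h $ i) * D i x)) (at x))"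
proof (induction rule: cpoly.induct)
  case (cpoly_const c)
  show ?case by (rule exI [of _ "\<lambda>i x. 0"]) (auto intro: cpoly_intros)
next
  case (cpoly_coord j)
  have "((\<lambda>x. complex_of_real (x $ j)) has_derivative (\<lambda>h. complex_of_real (h $ j))) (at x)" for x :: "real^3"
    by (intro bounded_linear_imp_has_derivative bounded_linear_compose [OF bounded_linear_of_real] bounded_linear_vec_nth)
  moreover have "(\<Sum>i\<in>UNIV. complex_of_real (h $ i) * (if i = j then 1 else 0)) = complex_of_real (h $ j)" for h :: "real^3"
    by (simp add: if_distrib cong: if_cong)
  ultimately show ?case
    by (intro exI [of _ "\<lambda>i x. if i = j then 1 else 0"]) (auto intro: cpoly_intros)
next
  case (cpoly_add f g)
  then obtain D E where D: "\<forall>i. cpoly (D i)" "\<forall>x. (f has_derivative (\<lambda>h. \<Sum>i\<in>UNIV. complex_of_real (h $ i) * D i x)) (at x)"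
    and E: "\<forall>i. cpoly (E i)" "\<forall>x. (g has_derivative (\<lambda>h. \<Sum>i\<in>UNIV. complex_of_real (h $ i) * E i x)) (at x)"
    by blast
  show ?case
    using D E has_derivative_add [OF D(2)[rule_format] E(2)[rule_format]]
    by (intro exI [of _ "\<lambda>i x. D i x + E i x"]) (auto intro: cpoly_intros simp: algebra_simps sum.distrib)
next
  case (cpoly_mult f g)
  then obtain D E where D: "\<forall>i. cpoly (D i)" "\<forall>x. (f has_derivative (\<lambda>h. \<Sum>i\<in>UNIV. complex_of_real (h $ i) * D i x)) (at x)"
    and E: "\<forall>i. cpoly (E i)" "\<forall>x. (g has_derivative (\<lambda>h. \<Sum>i\<in>UNIV. complex_of_real (h $ i) * E i x)) (at x)"
    by blast
  show ?case
    using D E has_derivative_mult [OF D(2)[rule_format] E(2)[rule_format]] cpoly_mult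
    by (intro exI [of _ "\<lambda>i x. D i x * g x + f x * E i x"])
       (auto intro!: cpoly_intros simp: algebra_simps sum.distrib sum_distrib_left sum_distrib_right)
qed

lemma partial_deriv_eqI:
  assumes "(f has_derivative (\<lambda>h. \<Sum>i\<in>UNIV. complex_of_real (h $ i) * D i)) (at x)"
  shows "partial_deriv j f x = D j"
proof -
  have "((\<lambda>h. x + h *\<^sub>R axis j 1) has_derivative (\<lambda>h. h *\<^sub>R axis j 1)) (at 0)"
    by (auto intro!: derivative_eq_intros)
  from has_derivative_compose [OF this] assms
  have "((\<lambda>h. f (x + h *\<^sub>R axis j 1)) has_derivative
      (\<lambda>h. \<Sum>i\<in>UNIV. complex_of_real ((h *\<^sub>R axis j 1 :: real^3) $ i) * D i)) (at 0)"
    by fastforce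
  moreover have "(\<Sum>i\<in>UNIV. complex_of_real ((h *\<^sub>R axis j 1 :: real^3) $ i) * D i) = h *\<^sub>R D j" for h
  proof -
    have "complex_of_real ((h *\<^sub>R axis j 1 :: real^3) $ i) * D i = (if i = j then h *\<^sub>R D j else 0)" for i
      by (simp add: axis_def scaleR_conv_of_real [where 'a = complex])
    then show ?thesis by simp
  qed
  ultimately show ?thesis
    unfolding partial_deriv_def by (intro vector_derivative_at) (simp add: has_vector_derivative_def)
qed

lemma cpoly_partial_deriv: "cpoly f \<Longrightarrow> cpoly (partial_deriv i f)"
  and cpoly_has_derivative:
    "cpoly f \<Longrightarrow> (f has_derivative (\<lambda>h. \<Sum>i\<in>UNIV. complex_of_real (h $ i) * partial_deriv i f x)) (at x)"
proof -
  assume "cpoly f"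
  from cpoly_has_derivative_ex [OF this] obtain D where D: "\<And>i. cpoly (D i)"
    "\<And>x. (f has_derivative (\<lambda>h. \<Sum>i\<in>UNIV. complex_of_real (h $ i) * D i x)) (at x)"
    by blast
  have "partial_deriv i f = D i" for i
    by (intro ext partial_deriv_eqI D)
  with D show "cpoly (partial_deriv i f)"
    "(f has_derivative (\<lambda>h. \<Sum>i\<in>UNIV. complex_of_real (h $ i) * partial_deriv i f x)) (at x)"
    by auto
qed

lemma cpoly_continuous_on: "cpoly f \<Longrightarrow> continuous_on S f"
  by (meson cpoly_has_derivative has_derivative_continuous continuous_at_imp_continuous_on)

section \<open>Rules for partial derivatives of polynomials\<close>

lemma partial_deriv_const [simp]: "partial_deriv i (\<lambda>x. c) = (\<lambda>x. 0)"
  by (simp add: partial_deriv_def fun_eq_iff)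

lemma partial_deriv_coord [simp]:
  "partial_deriv i (\<lambda>x. complex_of_real (x $ j)) = (\<lambda>x. if i = j then 1 else 0)"
proof
  fix x :: "real^3"
  have "((\<lambda>x. complex_of_real (x $ j)) has_derivative (\<lambda>h. complex_of_real (h $ j))) (at x)"
    by (intro bounded_linear_imp_has_derivative bounded_linear_compose [OF bounded_linear_of_real] bounded_linear_vec_nth)
  moreover have "(\<Sum>i\<in>UNIV. complex_of_real (h $ i) * (if i = j then 1 else 0)) = complex_of_real (h $ j)" for h :: "real^3"
    by (simp add: if_distrib cong: if_cong)
  ultimately show "partial_deriv i (\<lambda>x. complex_of_real (x $ j)) x = (if i = j then 1 else 0)"
    by (intro partial_deriv_eqI [where D = "\<lambda>i. if i = j then 1 else 0"]) simp
qed

lemma partial_deriv_add: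
  assumes "cpoly f" "cpoly g"
  shows "partial_deriv i (\<lambda>x. f x + g x) = (\<lambda>x. partial_deriv i f x + partial_deriv i g x)"
proof
  fix x
  show "partial_deriv i (\<lambda>x. f x + g x) x = partial_deriv i f x + partial_deriv i g x"
    using has_derivative_add [OF assms [THEN cpoly_has_derivative]]
    by (intro partial_deriv_eqI [where D = "\<lambda>i. partial_deriv i f x + partial_deriv i g x"])
      (simp add: algebra_simps sum.distrib)
qed

lemma partial_deriv_mult:
  assumes "cpoly f" "cpoly g"
  shows "partial_deriv i (\<lambda>x. f x * g x) = (\<lambda>x. partial_deriv i f x * g x + f x * partial_deriv i g x)"
proof
  fix x
  show "partial_deriv i (\<lambda>x. f x * g x) x = partial_deriv i f x * g x + f x * partial_deriv i g x"
    using has_derivative_mult [OF assms [THEN cpoly_has_derivative]]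
    by (intro partial_deriv_eqI [where D = "\<lambda>i. partial_deriv i f x * g x + f x * partial_deriv i g x"])
      (simp add: algebra_simps sum.distrib sum_distrib_left sum_distrib_right)
qed

lemma partial_deriv_cmult:
  "cpoly f \<Longrightarrow> partial_deriv i (\<lambda>x. c * f x) = (\<lambda>x. c * partial_deriv i f x)"
  using partial_deriv_mult [OF cpoly_const] by simp

lemma partial_deriv_uminus:
  "cpoly f \<Longrightarrow> partial_deriv i (\<lambda>x. - f x) = (\<lambda>x. - partial_deriv i f x)"
  using partial_deriv_cmult [of f i "-1"] by simp

lemma partial_deriv_diff:
  "cpoly f \<Longrightarrow> cpoly g \<Longrightarrow> partial_deriv i (\<lambda>x. f x - g x) = (\<lambda>x. partial_deriv i f x - partial_deriv i g x)"
  using partial_deriv_add [OF _ cpoly_uminus] by (simp add: partial_deriv_uminus)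

lemma partial_deriv_sum:
  assumes "\<And>k. k \<in> I \<Longrightarrow> cpoly (f k)"
  shows "partial_deriv i (\<lambda>x. \<Sum>k\<in>I. f k x) = (\<lambda>x. \<Sum>k\<in>I. partial_deriv i (f k) x)"
  using assms
  by (induction I rule: infinite_finite_induct) (simp_all add: partial_deriv_add cpoly_sum)

lemma partial_deriv_cnj:
  assumes "cpoly f" shows "partial_deriv i (\<lambda>x. cnj (f x)) = (\<lambda>x. cnj (partial_deriv i f x))"
  using assms
proof (induction rule: cpoly.induct)
  case (cpoly_coord j)
  have "(\<lambda>x::real^3. cnj (complex_of_real (x $ j))) = (\<lambda>x. complex_of_real (x $ j))" by simp
  then show ?case by (simp add: fun_eq_iff)
qed (simp_all add: partial_deriv_add partial_deriv_mult cpoly_cnj fun_eq_iff)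

text \<open>In the twofold product rule the two mixed terms change places when \<open>k\<close> and
  \<open>l\<close> do, so the induction closes.\<close>

lemma partial_deriv_commute:
  assumes "cpoly f"
  shows "partial_deriv i (partial_deriv j f) = partial_deriv j (partial_deriv i f)"
  using assms
proof (induction rule: cpoly.induct)
  case (cpoly_coord k)
  have "partial_deriv i (\<lambda>x. if j = k then 1 else 0) = (\<lambda>x. 0)" for i j k by (cases "j = k") auto
  then show ?case by simp
next
  case (cpoly_add f g)
  then show ?case by (simp add: partial_deriv_add cpoly_partial_deriv)
next
  case (cpoly_mult f g)
  note c = cpoly_mult.hyps
  have "partial_deriv k (partial_deriv l (\<lambda>x. f x * g x)) = (\<lambda>x. partial_deriv k (partial_deriv l f) x * g x
      + partial_deriv l f x * partial_deriv k g x + (partial_deriv k f x * partial_deriv l g x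
      + f x * partial_deriv k (partial_deriv l g) x))" for k l
    by (simp only: partial_deriv_mult [OF c] c cpoly_partial_deriv cpoly.cpoly_mult partial_deriv_add partial_deriv_mult)
  then show ?case using cpoly_mult.IH by (simp add: fun_eq_iff)
qed simp

lemma partial_deriv_linear_compose:
  assumes "cpoly f" "linear (R :: real^3 \<Rightarrow> real^3)"
  shows "partial_deriv i (\<lambda>x. f (R x)) = (\<lambda>x. \<Sum>j\<in>UNIV. complex_of_real (R (axis i 1) $ j) * partial_deriv j f (R x))"
proof
  fix x
  have "(R has_derivative R) (at x)"
    using assms(2) by (intro bounded_linear_imp_has_derivative linear_conv_bounded_linear [THEN iffD1])
  from has_derivative_compose [OF this cpoly_has_derivative [OF assms(1)]]
  have deriv: "((\<lambda>x. f (R x)) has_derivative (\<lambda>h. \<Sum>j\<in>UNIV. complex_of_real (R h $ j) * partial_deriv j f (R x))) (at x)" .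
  have comp: "R h $ j = (\<Sum>i\<in>UNIV. h $ i * R (axis i 1) $ j)" for h j
  proof -
    have "R h = R (\<Sum>i\<in>UNIV. h $ i *\<^sub>R axis i 1)"
      by (rule arg_cong [OF real3_eq_sum_axis])
    also have "\<dots> = (\<Sum>i\<in>UNIV. R (h $ i *\<^sub>R axis i 1))"
      by (rule linear_sum [OF assms(2)])
    finally show ?thesis by (simp add: linear_cmul [OF assms(2)])
  qed
  have "(\<Sum>j\<in>UNIV. complex_of_real (R h $ j) * partial_deriv j f (R x))
      = (\<Sum>i\<in>UNIV. complex_of_real (h $ i) * (\<Sum>j\<in>UNIV. complex_of_real (R (axis i 1) $ j) * partial_deriv j f (R x)))" for h
    by (simp only: comp [of h]) (simp add: sum_3 algebra_simps)
  then have eq: "(\<lambda>h. \<Sum>j\<in>UNIV. complex_of_real (R h $ j) * partial_deriv j f (R x))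
      = (\<lambda>h. \<Sum>i\<in>UNIV. complex_of_real (h $ i) * (\<Sum>j\<in>UNIV. complex_of_real (R (axis i 1) $ j) * partial_deriv j f (R x)))"
    by (rule ext)
  have "((\<lambda>x. f (R x)) has_derivative (\<lambda>h. \<Sum>i\<in>UNIV. complex_of_real (h $ i)
      * (\<Sum>j\<in>UNIV. complex_of_real (R (axis i 1) $ j) * partial_deriv j f (R x)))) (at x)"
    by (rule deriv [unfolded eq])
  then show "partial_deriv i (\<lambda>x. f (R x)) x = (\<Sum>j\<in>UNIV. complex_of_real (R (axis i 1) $ j) * partial_deriv j f (R x))"
    by (rule partial_deriv_eqI)
qed

text \<open>The chain rule applied twice yields the entries of the matrix of \<open>R\<close> times
  its transpose as coefficients of the second derivatives, and that product is the identity.\<close>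

lemma laplacian_orthogonal_compose:
  assumes "cpoly f" "orthogonal_transformation (R :: real^3 \<Rightarrow> real^3)"
  shows "laplacian (\<lambda>x. f (R x)) x = laplacian f (R x)"
proof -
  have lin: "linear R" using assms(2) orthogonal_transformation_linear by blast
  have "orthogonal_matrix (matrix R)"
    using assms(2) by (simp add: orthogonal_transformation_matrix)
  then have "(matrix R ** transpose (matrix R)) $ j $ k = mat 1 $ j $ k" for j k
    by (simp add: orthogonal_matrix_def)
  then have orth: "(\<Sum>i\<in>UNIV. R (axis i 1) $ j * R (axis i 1) $ k) = (if j = k then 1 else 0)" for j k
    by (simp add: matrix_matrix_mult_def matrix_def transpose_def mat_def)
  define c where "c i j = complex_of_real (R (axis i 1) $ j)" for i j
  have orth': "(\<Sum>i\<in>UNIV. c i j * c i k) = (if j = k then 1 else 0)" for j k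
  proof -
    have "(\<Sum>i\<in>UNIV. c i j * c i k) = complex_of_real (\<Sum>i\<in>UNIV. R (axis i 1) $ j * R (axis i 1) $ k)"
      by (simp add: c_def)
    then show ?thesis by (simp add: orth)
  qed
  have "partial_deriv i (partial_deriv i (\<lambda>x. f (R x))) x
      = (\<Sum>j\<in>UNIV. c i j * (\<Sum>k\<in>UNIV. c i k * partial_deriv k (partial_deriv j f) (R x)))" for i
  proof -
    have cp: "cpoly (\<lambda>x. partial_deriv j f (R x))" for j
      by (rule cpoly_linear_compose [OF cpoly_partial_deriv [OF assms(1)] lin])
    have "partial_deriv i (partial_deriv i (\<lambda>x. f (R x)))
        = partial_deriv i (\<lambda>x. \<Sum>j\<in>UNIV. c i j * partial_deriv j f (R x))"
      unfolding c_def by (simp only: partial_deriv_linear_compose [OF assms(1) lin])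
    also have "\<dots> = (\<lambda>x. \<Sum>j\<in>UNIV. c i j * partial_deriv i (\<lambda>x. partial_deriv j f (R x)) x)"
      by (simp only: partial_deriv_sum [of UNIV "\<lambda>j x. c i j * partial_deriv j f (R x)", OF cpoly_mult [OF cpoly_const cp]]
          partial_deriv_cmult [OF cp])
    also have "\<dots> = (\<lambda>x. \<Sum>j\<in>UNIV. c i j * (\<Sum>k\<in>UNIV. c i k * partial_deriv k (partial_deriv j f) (R x)))"
      unfolding c_def by (simp only: partial_deriv_linear_compose [OF cpoly_partial_deriv [OF assms(1)] lin])
    finally show ?thesis by simp
  qed
  then have "laplacian (\<lambda>x. f (R x)) x
      = (\<Sum>i\<in>UNIV. \<Sum>j\<in>UNIV. c i j * (\<Sum>k\<in>UNIV. c i k * partial_deriv k (partial_deriv j f) (R x)))"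
    by (simp only: laplacian_def)
  also have "\<dots> = (\<Sum>j\<in>UNIV. \<Sum>k\<in>UNIV. (\<Sum>i\<in>UNIV. c i j * c i k) * partial_deriv k (partial_deriv j f) (R x))"
    unfolding sum_3 by (simp only: algebra_simps)
  also have "\<dots> = (\<Sum>j\<in>UNIV. \<Sum>k\<in>UNIV. (if j = k then 1 else 0) * partial_deriv k (partial_deriv j f) (R x))"
    by (simp only: orth')
  also have "\<dots> = laplacian f (R x)"
    unfolding laplacian_def sum_3 by simp
  finally show ?thesis .
qed

section \<open>Surface measure\<close>

text \<open>The preimage of a box is its image under the inverse of \<open>R\<close>, which is again
  orthogonal and preserves Lebesgue measure; boxes determine \<open>lborel\<close>.\<close>

lemma lborel_distr_orthogonal:
  fixes R :: "real^3 \<Rightarrow> real^3"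
  assumes R: "orthogonal_transformation R" shows "distr lborel borel R = lborel"
proof (rule lborel_eqI [symmetric])
  have [measurable]: "R \<in> borel_measurable borel"
    using R by (intro borel_measurable_continuous_onI linear_continuous_on)
      (simp add: orthogonal_transformation_linear linear_conv_bounded_linear [symmetric])
  define R' where "R' = inv R"
  have R': "orthogonal_transformation R'" "R -` A = R' ` A" for A
    using R by (auto simp: R'_def orthogonal_transformation_inv orthogonal_transformation_bij bij_vimage_eq_inv_image)
  fix l u :: "real^3" assume lu: "\<And>b. b \<in> Basis \<Longrightarrow> l \<bullet> b \<le> u \<bullet> b"
  have "emeasure (distr lborel borel R) (box l u) = emeasure lebesgue (R' ` box l u)"
    using measurable_sets_borel [of R borel "box l u"]
    by (subst emeasure_distr) (auto simp: R'(2) [symmetric])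
  also have "\<dots> = ennreal (measure lebesgue (R' ` box l u))"
    using measurable_orthogonal_image [OF R'(1) lmeasurable_box] by (rule emeasure_eq_measure2)
  also have "\<dots> = ennreal (measure lebesgue (box l u))"
    using measure_orthogonal_image [OF R'(1), of "box l u"] by simp
  finally show "emeasure (distr lborel borel R) (box l u) = ennreal (\<Prod>b\<in>Basis. (u - l) \<bullet> b)"
    using lu by (simp add: measure_lborel_box_eq prod_nonneg inner_diff_left box_ne_empty)
qed simp

lemma sets_sphere_measure: "sets sphere_measure = sets (restrict_space borel (sphere 0 1))"
  and space_sphere_measure [simp]: "space sphere_measure = sphere 0 1"
  by (simp_all add: sphere_measure_def space_restrict_space)

lemma continuous_on_normalize: "continuous_on (ball 0 1 - {0}) (\<lambda>x::real^3. x /\<^sub>R norm x)"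
  by (auto intro!: continuous_intros)

lemma normalize_image: "(\<lambda>x::real^3. x /\<^sub>R norm x) ` (ball 0 1 - {0}) \<subseteq> sphere 0 1"
proof (rule image_subsetI)
  fix x :: "real^3" assume "x \<in> ball 0 1 - {0}"
  then show "x /\<^sub>R norm x \<in> sphere 0 1" by simp
qed

lemma normalize_measurable [measurable]:
  "(\<lambda>x::real^3. x /\<^sub>R norm x) \<in> measurable (restrict_space lborel (ball 0 1 - {0})) (restrict_space borel (sphere 0 1))"
proof (rule measurable_restrict_space2)
  show "(\<lambda>x::real^3. x /\<^sub>R norm x) \<in> borel_measurable (restrict_space lborel (ball 0 1 - {0}))"
    using borel_measurable_continuous_on_restrict [OF continuous_on_normalize]
    by (simp add: measurable_def space_restrict_space sets_restrict_space)
qed (auto simp: space_restrict_space)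

lemma integral_sphere_measure:
  fixes f :: "real^3 \<Rightarrow> complex"
  assumes f: "f \<in> borel_measurable sphere_measure"
  shows "(LINT x|sphere_measure. f x) = (LINT x|lborel. indicator (ball 0 1 - {0}) x *\<^sub>R (3 *\<^sub>R f (x /\<^sub>R norm x)))"
proof -
  have f': "f \<in> borel_measurable (restrict_space borel (sphere 0 1))"
    using f by (simp add: measurable_def sets_sphere_measure space_restrict_space)
  have m: "(\<lambda>x. f (x /\<^sub>R norm x)) \<in> borel_measurable (restrict_space lborel (ball 0 1 - {0}))"
    by (rule measurable_compose [OF normalize_measurable f'])
  have "(LINT x|sphere_measure. f x)
      = (LINT x|density (restrict_space lborel (ball 0 1 - {0})) (\<lambda>_. ennreal 3). f (x /\<^sub>R norm x))"
    unfolding sphere_measure_def using f' by (subst integral_distr) auto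
  also have "\<dots> = (LINT x|restrict_space lborel (ball 0 1 - {0}). 3 *\<^sub>R f (x /\<^sub>R norm x))"
    by (subst integral_density) (use m in auto)
  also have "\<dots> = (LINT x|lborel. indicator (ball 0 1 - {0}) x *\<^sub>R (3 *\<^sub>R f (x /\<^sub>R norm x)))"
    by (rule integral_restrict_space) simp
  finally show ?thesis .
qed

lemma emeasure_sphere_measure:
  "emeasure sphere_measure (space sphere_measure) = 3 * emeasure lborel (ball (0::real^3) 1 - {0})"
proof -
  have "emeasure sphere_measure (space sphere_measure)
      = emeasure (density (restrict_space lborel (ball (0::real^3) 1 - {0})) (\<lambda>_. 3)) (space (restrict_space lborel (ball (0::real^3) 1 - {0})))"
    unfolding sphere_measure_def
    by (subst emeasure_distr) (auto simp: space_restrict_space sets_restrict_space intro!: arg_cong2 [of _ _ _ _ emeasure])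
  also have "\<dots> = 3 * emeasure lborel (ball (0::real^3) 1 - {0})"
    by (subst emeasure_density_const) (auto simp: space_restrict_space emeasure_restrict_space sets_restrict_space)
  finally show ?thesis .
qed

lemma finite_measure_sphere: "finite_measure sphere_measure"
proof (rule finite_measureI)
  have "emeasure lborel (ball (0::real^3) 1 - {0}) \<le> emeasure lborel (ball (0::real^3) 1)"
    by (intro emeasure_mono) auto
  also have "\<dots> < \<infinity>" using emeasure_bounded_finite [OF bounded_ball] by simp
  finally show "emeasure sphere_measure (space sphere_measure) \<noteq> \<infinity>"
    unfolding emeasure_sphere_measure by (auto simp: ennreal_mult_eq_top_iff)
qed

interpretation sphere: finite_measure sphere_measure by (rule finite_measure_sphere)

abbreviation sphere_area :: real where
  "sphere_area \<equiv> measure sphere_measure (sphere 0 1)"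

lemma null_open_lborel_empty:
  assumes "open (U :: 'a::euclidean_space set)" "U \<in> null_sets lborel" shows "U = {}"
proof -
  have "negligible U" using assms(2) by (simp add: negligible_iff_null_sets null_sets_completionI)
  then show ?thesis using assms(1) open_not_negligible by auto
qed

lemma sphere_area_pos: "0 < sphere_area"
proof (rule ccontr)
  assume "\<not> 0 < sphere_area"
  then have "measure sphere_measure (space sphere_measure) = 0"
    using measure_nonneg [of sphere_measure "sphere 0 1"] by simp
  then have "emeasure sphere_measure (space sphere_measure) = 0"
    by (simp add: sphere.emeasure_eq_measure)
  then have "ball (0::real^3) 1 - {0} \<in> null_sets lborel"
    unfolding emeasure_sphere_measure by (auto simp: null_sets_def)
  then have "ball (0::real^3) 1 - {0} = {}"
    by (intro null_open_lborel_empty) auto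
  moreover have "(1/2) *\<^sub>R axis 1 1 \<in> ball (0::real^3) 1 - {0}"
    by (simp add: axis_eq_0_iff)
  ultimately show False by blast
qed

lemma continuous_measurable_sphere [measurable]:
  fixes f :: "real^3 \<Rightarrow> 'b::topological_space"
  assumes "continuous_on (sphere 0 1) f" shows "f \<in> borel_measurable sphere_measure"
  using borel_measurable_continuous_on_restrict [OF assms]
  by (simp add: measurable_def sets_sphere_measure space_restrict_space)

lemma continuous_integrable_sphere:
  fixes f :: "real^3 \<Rightarrow> 'b::{banach, second_countable_topology}"
  assumes f: "continuous_on (sphere 0 1) f" shows "integrable sphere_measure f"
proof -
  have "compact (f ` sphere 0 1)" using f by (intro compact_continuous_image) auto
  then obtain B where "\<forall>y\<in>f ` sphere 0 1. norm y \<le> B"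
    using compact_imp_bounded bounded_iff by blast
  then show ?thesis
    using f by (intro sphere.integrable_const_bound [of _ B] AE_I2 continuous_measurable_sphere) auto
qed

lemma cpoly_integrable_sphere: "cpoly f \<Longrightarrow> integrable sphere_measure f"
  by (intro continuous_integrable_sphere cpoly_continuous_on)

text \<open>An orthogonal map commutes with \<open>x /\<^sub>R norm x\<close> and preserves the
  punctured ball, so the invariance of \<open>lborel\<close> descends through the cone construction
  of \<open>sphere_measure\<close>.\<close>

lemma integral_sphere_orthogonal:
  fixes f :: "real^3 \<Rightarrow> complex"
  assumes R: "orthogonal_transformation R" and f: "continuous_on (sphere 0 1) f"
  shows "(LINT x|sphere_measure. f (R x)) = (LINT x|sphere_measure. f x)"
proof -
  have lin: "linear R" and nrm: "norm (R x) = norm x" for x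
    using R by (auto simp: orthogonal_transformation)
  have R0: "R x = 0 \<longleftrightarrow> x = 0" for x
    by (metis nrm norm_eq_zero)
  have contR: "continuous_on A R" for A
    using lin by (simp add: linear_continuous_on linear_conv_bounded_linear)
  have fR: "continuous_on (sphere 0 1) (\<lambda>x. f (R x))"
    using nrm by (intro continuous_on_compose2 [OF f contR]) auto
  define g where "g x = indicator (ball 0 1 - {0}) x *\<^sub>R (3 *\<^sub>R f (x /\<^sub>R norm x))" for x
  have g [measurable]: "g \<in> borel_measurable borel"
  proof -
    have "continuous_on (ball 0 1 - {0}) (\<lambda>x. 3 *\<^sub>R f (x /\<^sub>R norm x))"
      by (intro continuous_on_scaleR continuous_on_const continuous_on_compose2 [OF f continuous_on_normalize normalize_image])
    from borel_measurable_continuous_on_indicator [OF _ this] show ?thesis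
      unfolding g_def by simp
  qed
  have [measurable]: "R \<in> borel_measurable borel"
    by (intro borel_measurable_continuous_onI contR)
  have "(LINT x|sphere_measure. f (R x)) = (LINT x|lborel. g (R x))"
    unfolding integral_sphere_measure [OF continuous_measurable_sphere [OF fR]] g_def
    by (intro Bochner_Integration.integral_cong refl) (simp add: indicator_def linear_cmul [OF lin] nrm R0)
  also have "\<dots> = (LINT x|distr lborel borel R. g x)"
    by (subst integral_distr) auto
  also have "\<dots> = (LINT x|sphere_measure. f x)"
    unfolding integral_sphere_measure [OF continuous_measurable_sphere [OF f]] lborel_distr_orthogonal [OF R] g_def ..
  finally show ?thesis .
qed

text \<open>The set where \<open>h\<close> does not vanish, extended along rays, is an open subset
  of the punctured ball; it is null for \<open>lborel\<close>, hence empty.\<close>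

lemma continuous_norm_integral_zero_sphere:
  fixes h :: "real^3 \<Rightarrow> complex"
  assumes h: "continuous_on (sphere 0 1) h" and 0: "(LINT x|sphere_measure. (cmod (h x))\<^sup>2) = 0"
    and x: "x \<in> sphere 0 1"
  shows "h x = 0"
proof -
  have "AE x in sphere_measure. (cmod (h x))\<^sup>2 = 0"
    using 0 by (subst (asm) integral_nonneg_eq_0_iff_AE)
      (use h in \<open>auto intro!: continuous_integrable_sphere continuous_on_power continuous_on_norm\<close>)
  then have "AE x in sphere_measure. h x = 0" by simp
  moreover have "{x \<in> space (restrict_space borel (sphere 0 1)). h x = 0} \<in> sets (restrict_space borel (sphere 0 1))"
  proof -
    have "h -` {0} \<inter> space sphere_measure \<in> sets sphere_measure"
      by (rule measurable_sets [OF continuous_measurable_sphere [OF h]]) simp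
    moreover have "h -` {0} \<inter> space sphere_measure = {x \<in> space (restrict_space borel (sphere 0 1)). h x = 0}"
      by (auto simp: space_restrict_space)
    ultimately show ?thesis by (simp only: sets_sphere_measure)
  qed
  ultimately have "AE x in density (restrict_space lborel (ball 0 1 - {0})) (\<lambda>_. 3). h (x /\<^sub>R norm x) = 0"
    unfolding sphere_measure_def by (subst (asm) AE_distr_iff) simp_all
  then have ae: "AE x in lborel. x \<in> ball 0 1 - {0} \<longrightarrow> h (x /\<^sub>R norm x) = 0"
    by (simp add: AE_density AE_restrict_space_iff)
  define U where "U = (ball 0 1 - {0}) \<inter> (\<lambda>x. h (x /\<^sub>R norm x)) -` (- {0})"
  have hn: "continuous_on (ball 0 1 - {0}) (\<lambda>x. h (x /\<^sub>R norm x))"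
    by (rule continuous_on_compose2 [OF h continuous_on_normalize normalize_image])
  have "open U"
    unfolding U_def by (rule continuous_open_preimage [OF hn]) auto
  moreover have "U \<in> null_sets lborel"
  proof -
    have "{x \<in> space lborel. \<not> (x \<in> ball 0 1 - {0} \<longrightarrow> h (x /\<^sub>R norm x) = 0)} = U"
      by (auto simp: U_def)
    moreover have "U \<in> sets lborel" using \<open>open U\<close> by simp
    ultimately show ?thesis using ae AE_iff_null [of lborel "\<lambda>x. x \<in> ball 0 1 - {0} \<longrightarrow> h (x /\<^sub>R norm x) = 0"] by simp
  qed
  ultimately have "U = {}" by (rule null_open_lborel_empty)
  moreover have "(1/2) *\<^sub>R x \<in> U" if "h x \<noteq> 0"
  proof -
    have "((1/2) *\<^sub>R x) /\<^sub>R norm ((1/2) *\<^sub>R x) = x" using x by simp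
    then have "h (((1/2) *\<^sub>R x) /\<^sub>R norm ((1/2) *\<^sub>R x)) \<noteq> 0" using that by simp
    moreover have "(1/2) *\<^sub>R x \<in> ball 0 1 - {0}" using x by auto
    ultimately show ?thesis unfolding U_def by blast
  qed
  ultimately show ?thesis by blast
qed

section \<open>Rotations\<close>

text \<open>The generator of rotations in the plane of the coordinates \<open>a\<close> and
  \<open>b\<close>, an angular momentum operator up to a factor. Being tangent to all spheres, it
  can be integrated by parts over the unit sphere.\<close>

definition rot_deriv :: "3 \<Rightarrow> 3 \<Rightarrow> (real^3 \<Rightarrow> complex) \<Rightarrow> real^3 \<Rightarrow> complex" where
  "rot_deriv a b f x = complex_of_real (x $ a) * partial_deriv b f x - complex_of_real (x $ b) * partial_deriv a f x"

definition plane_rot :: "3 \<Rightarrow> 3 \<Rightarrow> real \<Rightarrow> real^3 \<Rightarrow> real^3" where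
  "plane_rot a b \<theta> x = (\<chi> i. if i = a then cos \<theta> * x $ a - sin \<theta> * x $ b
     else if i = b then sin \<theta> * x $ a + cos \<theta> * x $ b else x $ i)"

lemma cpoly_rot_deriv: "cpoly f \<Longrightarrow> cpoly (rot_deriv a b f)"
  unfolding rot_deriv_def [abs_def] by (intro cpoly_diff cpoly_mult cpoly_coord cpoly_partial_deriv)

lemma rot_deriv_mult:
  "cpoly f \<Longrightarrow> cpoly g \<Longrightarrow> rot_deriv a b (\<lambda>x. f x * g x) = (\<lambda>x. rot_deriv a b f x * g x + f x * rot_deriv a b g x)"
  by (simp add: rot_deriv_def fun_eq_iff partial_deriv_mult algebra_simps)

lemma rot_deriv_add:
  "cpoly f \<Longrightarrow> cpoly g \<Longrightarrow> rot_deriv a b (\<lambda>x. f x + g x) = (\<lambda>x. rot_deriv a b f x + rot_deriv a b g x)"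
  by (simp add: rot_deriv_def fun_eq_iff partial_deriv_add algebra_simps)

lemma rot_deriv_cnj: "cpoly f \<Longrightarrow> rot_deriv a b (\<lambda>x. cnj (f x)) = (\<lambda>x. cnj (rot_deriv a b f x))"
  by (simp add: rot_deriv_def fun_eq_iff partial_deriv_cnj)

lemma rot_deriv_sum:
  "(\<And>k. k \<in> I \<Longrightarrow> cpoly (f k)) \<Longrightarrow> rot_deriv a b (\<lambda>x. \<Sum>k\<in>I. f k x) = (\<lambda>x. \<Sum>k\<in>I. rot_deriv a b (f k) x)"
  by (simp add: rot_deriv_def fun_eq_iff partial_deriv_sum sum_distrib_left sum_subtractf)

lemma rotation_square_sum:
  "(cos \<theta> * y - sin \<theta> * z)\<^sup>2 + (sin \<theta> * y + cos \<theta> * z)\<^sup>2 = y\<^sup>2 + (z :: real)\<^sup>2"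
proof -
  have "(c * y - s * z)\<^sup>2 + (s * y + c * z)\<^sup>2 = (c\<^sup>2 + s\<^sup>2) * (y\<^sup>2 + z\<^sup>2)" for s c :: real
    by (simp add: power2_eq_square algebra_simps)
  from this [of "cos \<theta>" "sin \<theta>"] show ?thesis by simp
qed

lemma plane_rot_orthogonal:
  assumes "a \<noteq> b" shows "orthogonal_transformation (plane_rot a b \<theta>)"
  unfolding orthogonal_transformation
proof
  show "linear (plane_rot a b \<theta>)"
    by (rule linearI) (auto simp: plane_rot_def vec_eq_iff algebra_simps)
  have "(norm (plane_rot a b \<theta> x))\<^sup>2 = (norm x)\<^sup>2" for x
  proof -
    let ?f = "\<lambda>y :: real^3. \<lambda>i. (y $ i)\<^sup>2"
    have n2: "(norm y)\<^sup>2 = ?f y a + (?f y b + sum (?f y) (UNIV - {a, b}))" for y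
    proof -
      have "(norm y)\<^sup>2 = sum (?f y) UNIV"
        by (simp add: norm_vec_def L2_set_def sum_nonneg)
      also have "\<dots> = ?f y a + sum (?f y) (UNIV - {a})"
        by (simp add: sum.remove)
      also have "sum (?f y) (UNIV - {a}) = ?f y b + sum (?f y) (UNIV - {a} - {b})"
        using assms by (intro sum.remove) auto
      also have "UNIV - {a} - {b} = UNIV - {a, b}" by auto
      finally show ?thesis .
    qed
    have "sum (?f (plane_rot a b \<theta> x)) (UNIV - {a, b}) = sum (?f x) (UNIV - {a, b})"
      by (intro sum.cong refl) (simp add: plane_rot_def)
    moreover have "?f (plane_rot a b \<theta> x) a + ?f (plane_rot a b \<theta> x) b = ?f x a + ?f x b"
      using rotation_square_sum [of \<theta> "x $ a" "x $ b"] assms by (simp add: plane_rot_def)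
    ultimately show ?thesis unfolding n2 by linarith
  qed
  then show "\<forall>x. norm (plane_rot a b \<theta> x) = norm x" by (metis norm_ge_zero power2_eq_imp_eq)
qed

lemma plane_rot_0 [simp]: "plane_rot a b 0 x = x"
proof -
  have "plane_rot a b 0 x $ i = x $ i" for i
    by (cases "i = a"; cases "i = b") (simp_all add: plane_rot_def)
  then show ?thesis by (simp add: vec_eq_iff)
qed

lemma plane_rot_deriv:
  assumes f: "cpoly f" and ab: "a \<noteq> b"
  shows "((\<lambda>\<theta>. f (plane_rot a b \<theta> x)) has_vector_derivative rot_deriv a b f (plane_rot a b \<theta> x)) (at \<theta>)"
proof -
  define v where "v \<theta> = (\<chi> i. if i = a then - sin \<theta> * x $ a - cos \<theta> * x $ b
     else if i = b then cos \<theta> * x $ a - sin \<theta> * x $ b else 0)" for \<theta>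
  have "((\<lambda>\<theta>. plane_rot a b \<theta> x) has_derivative (\<lambda>h. h *\<^sub>R v \<theta>)) (at \<theta>)"
  proof (rule has_derivative_componentwise_within [THEN iffD2], rule)
    fix e :: "real^3" assume "e \<in> Basis"
    then obtain i where e: "e = axis i 1" by (auto simp: Basis_vec_def)
    have "((\<lambda>\<theta>. plane_rot a b \<theta> x $ i) has_real_derivative v \<theta> $ i) (at \<theta>)"
      by (auto simp: plane_rot_def v_def intro!: derivative_eq_intros)
    then show "((\<lambda>\<theta>. plane_rot a b \<theta> x \<bullet> e) has_derivative (\<lambda>h. h *\<^sub>R v \<theta> \<bullet> e)) (at \<theta>)"
      by (simp add: e inner_axis has_field_derivative_def mult_commute_abs)
  qed
  from has_derivative_compose [OF this cpoly_has_derivative [OF f]]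
  have "((\<lambda>\<theta>. f (plane_rot a b \<theta> x)) has_derivative
     (\<lambda>h. \<Sum>i\<in>UNIV. complex_of_real ((h *\<^sub>R v \<theta>) $ i) * partial_deriv i f (plane_rot a b \<theta> x))) (at \<theta>)" .
  moreover have "(\<Sum>i\<in>UNIV. complex_of_real ((h *\<^sub>R v \<theta>) $ i) * partial_deriv i f (plane_rot a b \<theta> x))
      = h *\<^sub>R rot_deriv a b f (plane_rot a b \<theta> x)" for h
  proof -
    have "complex_of_real ((h *\<^sub>R v \<theta>) $ i) * D i = h *\<^sub>R (v \<theta> $ i *\<^sub>R D i)" for i and D :: "3 \<Rightarrow> complex"
      by (simp add: scaleR_conv_of_real [where 'a = complex])
    then have "(\<Sum>i\<in>UNIV. complex_of_real ((h *\<^sub>R v \<theta>) $ i) * D i) = h *\<^sub>R (\<Sum>i\<in>UNIV. v \<theta> $ i *\<^sub>R D i)" for D :: "3 \<Rightarrow> complex"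
      by (simp add: scaleR_sum_right)
    moreover have "(\<Sum>i\<in>UNIV. v \<theta> $ i *\<^sub>R partial_deriv i f (plane_rot a b \<theta> x)) = rot_deriv a b f (plane_rot a b \<theta> x)"
      using ab exhaust_3 [of a] exhaust_3 [of b]
      by (auto simp: sum_3 v_def plane_rot_def rot_deriv_def scaleR_conv_of_real [where 'a = complex] algebra_simps)
    ultimately show ?thesis by simp
  qed
  ultimately show ?thesis by (simp add: has_vector_derivative_def)
qed

text \<open>The integral of \<open>f\<close> over the sphere does not change when \<open>f\<close>
  is composed with \<open>plane_rot a b \<theta>\<close>; the claim is the derivative of this
  identity at \<open>\<theta> = 0\<close>.\<close>

lemma integral_rot_deriv:
  assumes f: "cpoly f" and ab: "a \<noteq> b"
  shows "(LINT x|sphere_measure. rot_deriv a b f x) = 0"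
proof -
  let ?R = "plane_rot a b"
  have nrm: "norm (?R \<theta> x) = norm x" for \<theta> x
    using plane_rot_orthogonal [OF ab] by (simp add: orthogonal_transformation)
  have "compact (rot_deriv a b f ` sphere 0 1)"
    by (intro compact_continuous_image cpoly_continuous_on cpoly_rot_deriv f compact_sphere)
  then have "bounded (rot_deriv a b f ` sphere 0 1)" by (rule compact_imp_bounded)
  then obtain B where B: "\<And>x. x \<in> sphere 0 1 \<Longrightarrow> cmod (rot_deriv a b f x) \<le> B"
    unfolding bounded_iff by blast
  \<comment> \<open>The derivative along the rotation orbit of \<open>x\<close> is
    \<open>rot_deriv a b f\<close>, bounded by \<open>B\<close> on the sphere; this makes
    \<open>B\<close> a dominating function for the difference quotients \<open>s n\<close>.\<close>
  have lip: "cmod (f (?R \<theta> x) - f x) \<le> B * \<bar>\<theta>\<bar>" if "x \<in> sphere 0 1" for x \<theta>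
  proof -
    have "norm (f (?R \<theta> x) - f (?R 0 x)) \<le> B * norm (\<theta> - 0)"
    proof (rule differentiable_bound [of UNIV _ "\<lambda>\<phi> h. h *\<^sub>R rot_deriv a b f (?R \<phi> x)"])
      show "((\<lambda>\<theta>. f (?R \<theta> x)) has_derivative (\<lambda>h. h *\<^sub>R rot_deriv a b f (?R \<phi> x))) (at \<phi> within UNIV)" for \<phi>
        using plane_rot_deriv [OF f ab, of x \<phi>] by (simp add: has_vector_derivative_def)
      show "onorm (\<lambda>h. h *\<^sub>R rot_deriv a b f (?R \<phi> x)) \<le> B" for \<phi>
        using B [of "?R \<phi> x"] that nrm [of \<phi> x]
        by (intro onorm_le) (simp, metis abs_ge_zero mult.commute mult_right_mono)
    qed auto
    then show ?thesis by simp
  qed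
  define s where "s n x = (f (?R (inverse (real (Suc n))) x) - f x) /\<^sub>R inverse (real (Suc n))" for n x
  have "(\<lambda>n. LINT x|sphere_measure. s n x) \<longlonglongrightarrow> (LINT x|sphere_measure. rot_deriv a b f x)"
  proof (rule integral_dominated_convergence [where w = "\<lambda>_. B"])
    show "rot_deriv a b f \<in> borel_measurable sphere_measure"
      by (intro continuous_measurable_sphere cpoly_continuous_on cpoly_rot_deriv f)
    have cR: "cpoly (\<lambda>x. f (?R \<theta> x))" for \<theta>
      by (rule cpoly_linear_compose [OF f]) (use plane_rot_orthogonal [OF ab] in \<open>simp add: orthogonal_transformation\<close>)
    show "s n \<in> borel_measurable sphere_measure" for n
      unfolding s_def by (intro continuous_measurable_sphere continuous_on_scaleR continuous_on_const
        continuous_on_diff cpoly_continuous_on cR f)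
    show "AE x in sphere_measure. norm (s n x) \<le> B" for n
    proof (rule AE_I2)
      fix x assume "x \<in> space sphere_measure"
      then have "cmod (f (?R (inverse (real (Suc n))) x) - f x) \<le> B * inverse (real (Suc n))"
        using lip [of x "inverse (real (Suc n))"] by simp
      moreover have "norm (s n x) = cmod (f (?R (inverse (real (Suc n))) x) - f x) * real (Suc n)"
        by (simp add: s_def mult.commute del: of_nat_Suc)
      ultimately have "norm (s n x) \<le> B * inverse (real (Suc n)) * real (Suc n)"
        by (simp only: mult_right_mono of_nat_0_le_iff)
      then show "norm (s n x) \<le> B" by (simp add: mult.assoc del: of_nat_Suc)
    qed
    show "AE x in sphere_measure. (\<lambda>n. s n x) \<longlonglongrightarrow> rot_deriv a b f x"
    proof (rule AE_I2)
      fix x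
      let ?g = "\<lambda>\<theta>. f (?R \<theta> x)" and ?D = "rot_deriv a b f x"
      have "(?g has_derivative (\<lambda>h. h *\<^sub>R ?D)) (at 0)"
        using plane_rot_deriv [OF f ab, of x 0] by (simp add: has_vector_derivative_def)
      then have "(\<lambda>h. norm (?g (0 + h) - ?g 0 - h *\<^sub>R ?D) / norm h) \<midarrow>0\<rightarrow> 0"
        by (simp only: has_derivative_at)
      moreover have "norm (?g (0 + h) - ?g 0 - h *\<^sub>R ?D) / norm h = norm ((f (?R h x) - f x) /\<^sub>R h - ?D)" if "h \<noteq> 0" for h
      proof -
        have "(f (?R h x) - f x) /\<^sub>R h - ?D = (?g (0 + h) - ?g 0 - h *\<^sub>R ?D) /\<^sub>R h"
          using that by (simp add: scaleR_diff_right)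
        then show ?thesis by (simp add: divide_inverse mult.commute)
      qed
      ultimately have "(\<lambda>h. norm ((f (?R h x) - f x) /\<^sub>R h - ?D)) \<midarrow>0\<rightarrow> 0"
        using LIM_equal [of 0 "\<lambda>h. norm (?g (0 + h) - ?g 0 - h *\<^sub>R ?D) / norm h"
            "\<lambda>h. norm ((f (?R h x) - f x) /\<^sub>R h - ?D)" 0] by blast
      then have "((\<lambda>h. (f (?R h x) - f x) /\<^sub>R h) \<longlongrightarrow> ?D) (at 0)"
        by (intro LIM_zero_cancel [where l = ?D]) (rule tendsto_norm_zero_cancel)
      moreover have "filterlim (\<lambda>n. inverse (real (Suc n))) (at 0) sequentially"
        using LIMSEQ_inverse_real_of_nat by (simp add: filterlim_at del: of_nat_Suc)
      ultimately show "(\<lambda>n. s n x) \<longlonglongrightarrow> ?D"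
        unfolding s_def by (rule filterlim_compose)
    qed
  qed auto
  moreover have "(LINT x|sphere_measure. s n x) = 0" for n
  proof -
    let ?g = "\<lambda>x. f (?R (inverse (real (Suc n))) x)"
    have "cpoly ?g"
      by (rule cpoly_linear_compose [OF f]) (use plane_rot_orthogonal [OF ab] in \<open>simp add: orthogonal_transformation\<close>)
    then have "(LINT x|sphere_measure. s n x)
        = ((LINT x|sphere_measure. ?g x) - (LINT x|sphere_measure. f x)) /\<^sub>R inverse (real (Suc n))"
      unfolding s_def by (simp only: integral_scaleR_right Bochner_Integration.integral_diff cpoly_integrable_sphere f)
    also have "(LINT x|sphere_measure. ?g x) = (LINT x|sphere_measure. f x)"
      by (rule integral_sphere_orthogonal [OF plane_rot_orthogonal [OF ab] cpoly_continuous_on [OF f]])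
    finally show ?thesis by simp
  qed
  ultimately show ?thesis by (simp add: LIMSEQ_const_iff)
qed

section \<open>Solid harmonics\<close>

definition solid_harmonic :: "nat \<Rightarrow> (real^3 \<Rightarrow> complex) \<Rightarrow> bool" where
  "solid_harmonic l p \<longleftrightarrow> cpoly p \<and> (\<forall>r x. p (r *\<^sub>R x) = r ^ l *\<^sub>R p x) \<and> (\<forall>x. laplacian p x = 0)"

lemma solid_harmonicD:
  assumes "solid_harmonic l p"
  shows "cpoly p" "p (r *\<^sub>R x) = r ^ l *\<^sub>R p x" "laplacian p x = 0"
  using assms by (auto simp: solid_harmonic_def)

lemma spherical_harmonic_solid:
  assumes "spherical_harmonic l f" obtains p where "solid_harmonic l p" "\<And>x. x \<in> sphere 0 1 \<Longrightarrow> f x = p x"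
  using assms cpoly_polynomial_function unfolding spherical_harmonic_def solid_harmonic_def by metis

lemma solid_harmonic_cmult: "solid_harmonic l p \<Longrightarrow> solid_harmonic l (\<lambda>x. c * p x)"
  unfolding solid_harmonic_def laplacian_def
  by (simp add: cpoly_mult cpoly_const partial_deriv_cmult cpoly_partial_deriv flip: sum_distrib_left)

lemma solid_harmonic_sum:
  assumes "\<And>k. k \<in> I \<Longrightarrow> solid_harmonic l (p k)" shows "solid_harmonic l (\<lambda>x. \<Sum>k\<in>I. p k x)"
proof -
  have c: "cpoly (p k)" "cpoly (partial_deriv i (p k))" if "k \<in> I" for i k
    using assms [OF that] by (auto simp: solid_harmonic_def cpoly_partial_deriv)
  have "laplacian (\<lambda>x. \<Sum>k\<in>I. p k x) x = (\<Sum>k\<in>I. laplacian (p k) x)" for x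
    unfolding laplacian_def using c by (subst sum.swap) (simp add: partial_deriv_sum)
  then show ?thesis
    using assms unfolding solid_harmonic_def by (simp add: cpoly_sum scaleR_sum_right)
qed

lemma solid_harmonic_cnj: "solid_harmonic l p \<Longrightarrow> solid_harmonic l (\<lambda>x. cnj (p x))"
  unfolding solid_harmonic_def laplacian_def
  by (simp add: cpoly_cnj partial_deriv_cnj cpoly_partial_deriv flip: cnj_sum)

lemma solid_harmonic_orthogonal_compose:
  assumes "solid_harmonic l p" "orthogonal_transformation R" shows "solid_harmonic l (\<lambda>x. p (R x))"
proof -
  have "linear R" using assms(2) by (rule orthogonal_transformation_linear)
  then show ?thesis
    using assms unfolding solid_harmonic_def
    by (auto simp: laplacian_orthogonal_compose linear_cmul intro: cpoly_linear_compose)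
qed

text \<open>Both sides are the derivative of \<open>p (r *\<^sub>R x)\<close> with respect to
  \<open>r\<close> at \<open>r = 1\<close>.\<close>

lemma solid_harmonic_euler:
  assumes "solid_harmonic l p"
  shows "(\<Sum>i\<in>UNIV. complex_of_real (x $ i) * partial_deriv i p x) = of_nat l * p x"
proof -
  note p = solid_harmonicD [OF assms]
  have "((\<lambda>r. r *\<^sub>R x) has_derivative (\<lambda>h. h *\<^sub>R x)) (at 1)"
    by (auto intro!: derivative_eq_intros)
  from has_derivative_compose [OF this cpoly_has_derivative [OF p(1)]]
  have "((\<lambda>r. p (r *\<^sub>R x)) has_derivative
      (\<lambda>h. \<Sum>i\<in>UNIV. complex_of_real ((h *\<^sub>R x) $ i) * partial_deriv i p (1 *\<^sub>R x))) (at 1)" .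
  moreover have "(\<Sum>i\<in>UNIV. complex_of_real ((h *\<^sub>R x) $ i) * partial_deriv i p (1 *\<^sub>R x))
      = h *\<^sub>R (\<Sum>i\<in>UNIV. complex_of_real (x $ i) * partial_deriv i p x)" for h
    by (simp add: sum_3 algebra_simps scaleR_conv_of_real [where 'a = complex])
  ultimately have "((\<lambda>r. p (r *\<^sub>R x)) has_vector_derivative (\<Sum>i\<in>UNIV. complex_of_real (x $ i) * partial_deriv i p x)) (at 1)"
    by (simp add: has_vector_derivative_def)
  moreover have "((\<lambda>r. p (r *\<^sub>R x)) has_vector_derivative real l *\<^sub>R p x) (at 1)"
    unfolding p(2) has_vector_derivative_def by (auto intro!: derivative_eq_intros)
  ultimately have "(\<Sum>i\<in>UNIV. complex_of_real (x $ i) * partial_deriv i p x) = real l *\<^sub>R p x"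
    by (rule vector_derivative_unique_at)
  then show ?thesis by (simp add: scaleR_conv_of_real)
qed

lemma partial_deriv_rot_deriv:
  assumes "cpoly f"
  shows "partial_deriv i (rot_deriv a b f) x =
    (if i = a then 1 else 0) * partial_deriv b f x + complex_of_real (x $ a) * partial_deriv i (partial_deriv b f) x
    - ((if i = b then 1 else 0) * partial_deriv a f x + complex_of_real (x $ b) * partial_deriv i (partial_deriv a f) x)"
proof -
  note c = cpoly_partial_deriv [OF assms]
  have "rot_deriv a b f = (\<lambda>x. complex_of_real (x $ a) * partial_deriv b f x - complex_of_real (x $ b) * partial_deriv a f x)"
    by (simp add: rot_deriv_def fun_eq_iff)
  then show ?thesis
    by (simp only: partial_deriv_diff [OF cpoly_mult [OF cpoly_coord c] cpoly_mult [OF cpoly_coord c]]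
      partial_deriv_mult [OF cpoly_coord c] partial_deriv_coord)
qed

text \<open>The sum of the squared rotation generators, which acts on the unit sphere as the
  Laplace-Beltrami operator; unlike \<open>laplacian\<close> it differentiates along spheres
  only.\<close>

definition rot_laplacian :: "(real^3 \<Rightarrow> complex) \<Rightarrow> real^3 \<Rightarrow> complex" where
  "rot_laplacian f x = rot_deriv 2 3 (rot_deriv 2 3 f) x + rot_deriv 3 1 (rot_deriv 3 1 f) x
     + rot_deriv 1 2 (rot_deriv 1 2 f) x"

text \<open>With the Euler operator \<open>E\<close> the sum of squares is the squared norm of
  \<open>x\<close> times the Laplacian, minus \<open>E * E + E\<close>; on a harmonic
  \<open>p\<close>, homogeneous of degree \<open>l\<close>, this leaves
  \<open>- (l * l + l)\<close>.\<close>

lemma rot_laplacian_solid_harmonic: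
  assumes "solid_harmonic l p"
  shows "rot_laplacian p x = - (complex_of_real (eigval l) * p x)"
proof -
  note p = solid_harmonicD [OF assms]
  define X where "X i = complex_of_real (x $ i)" for i
  define D where "D i = partial_deriv i p x" for i
  define DD where "DD i j = partial_deriv i (partial_deriv j p) x" for i j
  have sym: "DD 2 1 = DD 1 2" "DD 3 1 = DD 1 3" "DD 3 2 = DD 2 3"
    unfolding DD_def using partial_deriv_commute [OF p(1)] by metis+
  have e1: "X 1 * D 1 + X 2 * D 2 + X 3 * D 3 = of_nat l * p x"
    using solid_harmonic_euler [OF assms, of x] by (simp add: sum_3 X_def D_def)
  have "partial_deriv j (\<lambda>x. \<Sum>i\<in>UNIV. complex_of_real (x $ i) * partial_deriv i p x) x
      = partial_deriv j (\<lambda>x. of_nat l * p x) x" for j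
    by (simp only: solid_harmonic_euler [OF assms])
  moreover have "partial_deriv j (\<lambda>x. of_nat l * p x) x = of_nat l * D j" for j
    by (simp only: partial_deriv_cmult [OF p(1)] D_def)
  moreover have "partial_deriv j (\<lambda>x. \<Sum>i\<in>UNIV. complex_of_real (x $ i) * partial_deriv i p x) x
      = (\<Sum>i\<in>UNIV. (if j = i then 1 else 0) * D i + X i * DD j i)" for j
    unfolding X_def D_def DD_def
    by (simp only: partial_deriv_sum [of UNIV, OF cpoly_mult [OF cpoly_coord cpoly_partial_deriv [OF p(1)]]]
      partial_deriv_mult [OF cpoly_coord cpoly_partial_deriv [OF p(1)]] partial_deriv_coord)
  \<comment> \<open>Euler's identity differentiated in direction \<open>j\<close>; it trades second
    derivatives for first ones.\<close>
  ultimately have e2: "(\<Sum>i\<in>UNIV. (if j = i then 1 else 0) * D i + X i * DD j i) = of_nat l * D j" for j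
    by metis
  have e3: "D 1 + (X 1 * DD 1 1 + X 2 * DD 1 2 + X 3 * DD 1 3) = of_nat l * D 1"
    "D 2 + (X 1 * DD 1 2 + X 2 * DD 2 2 + X 3 * DD 2 3) = of_nat l * D 2"
    "D 3 + (X 1 * DD 1 3 + X 2 * DD 2 3 + X 3 * DD 3 3) = of_nat l * D 3"
    using e2 [of 1] e2 [of 2] e2 [of 3] by (simp_all add: sum_3 sym algebra_simps)
  have lap: "DD 1 1 + DD 2 2 + DD 3 3 = 0"
    using p(3) [of x] by (simp add: laplacian_def sum_3 DD_def)
  have rr: "rot_deriv a b (rot_deriv a b p) x = X a * (X a * DD b b - (D a + X b * DD b a))
      - X b * (D b + X a * DD a b - X b * DD a a)" if "a \<noteq> b" for a b
    using that
    by (simp add: rot_deriv_def [of a b "rot_deriv a b p"] partial_deriv_rot_deriv [OF p(1)] X_def D_def DD_def)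
  have "rot_laplacian p x = (X 1 ^ 2 + X 2 ^ 2 + X 3 ^ 2) * (DD 1 1 + DD 2 2 + DD 3 3)
      - (X 1 * (D 1 + (X 1 * DD 1 1 + X 2 * DD 1 2 + X 3 * DD 1 3))
        + X 2 * (D 2 + (X 1 * DD 1 2 + X 2 * DD 2 2 + X 3 * DD 2 3))
        + X 3 * (D 3 + (X 1 * DD 1 3 + X 2 * DD 2 3 + X 3 * DD 3 3)))
      - (X 1 * D 1 + X 2 * D 2 + X 3 * D 3)"
    unfolding rot_laplacian_def by (simp add: rr sym algebra_simps power2_eq_square)
  also have "\<dots> = - (of_nat l * (X 1 * D 1 + X 2 * D 2 + X 3 * D 3)) - (X 1 * D 1 + X 2 * D 2 + X 3 * D 3)"
    unfolding e3 lap by (simp add: algebra_simps)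
  also have "\<dots> = - (complex_of_real (eigval l) * p x)"
    unfolding e1 eigval_def by (simp add: algebra_simps)
  finally show ?thesis .
qed

lemma integral_rot_deriv_parts:
  assumes "cpoly f" "cpoly g" "a \<noteq> b"
  shows "(LINT x|sphere_measure. rot_deriv a b f x * g x) = - (LINT x|sphere_measure. f x * rot_deriv a b g x)"
proof -
  have "(LINT x|sphere_measure. rot_deriv a b f x * g x + f x * rot_deriv a b g x) = 0"
    using integral_rot_deriv [OF cpoly_mult [OF assms(1,2)] assms(3)] unfolding rot_deriv_mult [OF assms(1,2)] .
  then have "(LINT x|sphere_measure. rot_deriv a b f x * g x) + (LINT x|sphere_measure. f x * rot_deriv a b g x) = 0"
    by (subst (asm) Bochner_Integration.integral_add)
      (simp_all add: assms cpoly_rot_deriv cpoly_mult cpoly_integrable_sphere)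
  then show ?thesis by (simp add: eq_neg_iff_add_eq_0)
qed

text \<open>Each square takes two integrations by parts, whose signs cancel. The pairing is
  bilinear; conjugation is put into \<open>g\<close> when the lemma is applied.\<close>

lemma integral_rot_laplacian_parts:
  assumes "cpoly f" "cpoly g"
  shows "(LINT x|sphere_measure. rot_laplacian f x * g x) = (LINT x|sphere_measure. f x * rot_laplacian g x)"
proof -
  note c = assms cpoly_rot_deriv cpoly_mult cpoly_integrable_sphere
  have two: "(LINT x|sphere_measure. rot_deriv a b (rot_deriv a b f) x * g x)
      = (LINT x|sphere_measure. f x * rot_deriv a b (rot_deriv a b g) x)" if "a \<noteq> b" for a b
    using integral_rot_deriv_parts [of "rot_deriv a b f" g a b] integral_rot_deriv_parts [of f "rot_deriv a b g" a b]
      assms that by (simp add: cpoly_rot_deriv)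
  have "(LINT x|sphere_measure. rot_laplacian f x * g x)
      = (LINT x|sphere_measure. rot_deriv 2 3 (rot_deriv 2 3 f) x * g x)
      + (LINT x|sphere_measure. rot_deriv 3 1 (rot_deriv 3 1 f) x * g x)
      + (LINT x|sphere_measure. rot_deriv 1 2 (rot_deriv 1 2 f) x * g x)"
    unfolding rot_laplacian_def distrib_right by (simp add: c)
  also have "\<dots> = (LINT x|sphere_measure. f x * rot_deriv 2 3 (rot_deriv 2 3 g) x)
      + (LINT x|sphere_measure. f x * rot_deriv 3 1 (rot_deriv 3 1 g) x)
      + (LINT x|sphere_measure. f x * rot_deriv 1 2 (rot_deriv 1 2 g) x)"
    by (simp add: two)
  also have "\<dots> = (LINT x|sphere_measure. f x * rot_laplacian g x)"
    unfolding rot_laplacian_def distrib_left by (simp add: c)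
  finally show ?thesis .
qed

lemma eigval_inj: "eigval l = eigval l' \<Longrightarrow> l = l'"
proof -
  assume "eigval l = eigval l'"
  then have "(real l - real l') * (real l + real l' + 1) = 0"
    by (simp add: eigval_def algebra_simps)
  moreover have "real l + real l' + 1 > 0" by linarith
  ultimately show ?thesis by simp
qed

text \<open>Eigenfunctions of a symmetric operator with distinct eigenvalues. The statement concerns
  arbitrary harmonics, such as rotated ones, whereas the basis provides relations only among its own
  members.\<close>

lemma solid_harmonic_orthogonal:
  assumes "solid_harmonic l p" "solid_harmonic l' q" "l \<noteq> l'"
  shows "scalar_inner p q = 0"
proof -
  note q = solid_harmonic_cnj [OF assms(2)]
  let ?I = "LINT x|sphere_measure. p x * cnj (q x)"
  have "(LINT x|sphere_measure. rot_laplacian p x * cnj (q x)) = (LINT x|sphere_measure. p x * rot_laplacian (\<lambda>x. cnj (q x)) x)"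
    by (rule integral_rot_laplacian_parts [OF solid_harmonicD(1) [OF assms(1)] solid_harmonicD(1) [OF q]])
  moreover have "(LINT x|sphere_measure. rot_laplacian p x * cnj (q x)) = - complex_of_real (eigval l) * ?I"
    by (simp add: rot_laplacian_solid_harmonic [OF assms(1)] mult.assoc)
  moreover have "(LINT x|sphere_measure. p x * rot_laplacian (\<lambda>x. cnj (q x)) x) = - complex_of_real (eigval l') * ?I"
  proof -
    have "p x * rot_laplacian (\<lambda>x. cnj (q x)) x = - complex_of_real (eigval l') * (p x * cnj (q x))" for x
      by (simp add: rot_laplacian_solid_harmonic [OF q])
    then show ?thesis by (simp only: integral_mult_right_zero)
  qed
  ultimately have "- complex_of_real (eigval l) * ?I = - complex_of_real (eigval l') * ?I"
    by (simp only:)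
  moreover have "complex_of_real (eigval l) \<noteq> complex_of_real (eigval l')" using eigval_inj assms(3) by auto
  moreover have "I = 0" if "- u * I = - v * I" "u \<noteq> v" for u v I :: complex
    using that by simp
  ultimately have "?I = 0" by blast
  then show ?thesis by (simp add: scalar_inner_def)
qed

section \<open>Addition theorems\<close>

lemma scalar_inner_cong:
  "(\<And>x. x \<in> sphere 0 1 \<Longrightarrow> f x = f' x) \<Longrightarrow> (\<And>x. x \<in> sphere 0 1 \<Longrightarrow> g x = g' x) \<Longrightarrow> scalar_inner f g = scalar_inner f' g'"
  unfolding scalar_inner_def by (intro Bochner_Integration.integral_cong) auto

lemma integral_cmod2: "complex_of_real (LINT x|sphere_measure. (cmod (f x))\<^sup>2) = scalar_inner f f"
  unfolding scalar_inner_def complex_norm_square [symmetric] by (simp only: integral_complex_of_real)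

text \<open>\<open>Y\<close> prescribes values on the sphere only; \<open>P\<close> fixes polynomial
  extensions, on which \<open>partial_deriv\<close> and \<open>rot_deriv\<close> can act.\<close>

locale harmonic_basis =
  fixes Y :: "nat \<Rightarrow> int \<Rightarrow> real^3 \<Rightarrow> complex" and P :: "nat \<Rightarrow> int \<Rightarrow> real^3 \<Rightarrow> complex"
  assumes basis: "spherical_harmonic_basis Y"
    and P: "\<bar>m\<bar> \<le> int l \<Longrightarrow> solid_harmonic l (P l m)"
    and PY: "\<bar>m\<bar> \<le> int l \<Longrightarrow> x \<in> sphere 0 1 \<Longrightarrow> Y l m x = P l m x"
begin

lemma P_cpoly: "\<bar>m\<bar> \<le> int l \<Longrightarrow> cpoly (P l m)"
  using P by (simp add: solid_harmonic_def)

lemma P_orthonormal: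
  assumes "\<bar>m\<bar> \<le> int l" "\<bar>m'\<bar> \<le> int l'"
  shows "scalar_inner (P l m) (P l' m') = (if l = l' \<and> m = m' then 1 else 0)"
proof -
  have "scalar_inner (P l m) (P l' m') = scalar_inner (Y l m) (Y l' m')"
    using PY assms by (intro scalar_inner_cong) auto
  then show ?thesis using basis assms by (simp add: spherical_harmonic_basis_def)
qed

lemma parseval:
  "(LINT x|sphere_measure. (cmod (\<Sum>m=- int l..int l. a m * P l m x))\<^sup>2) = (\<Sum>m=- int l..int l. (cmod (a m))\<^sup>2)"
proof -
  let ?M = "{- int l..int l}"
  have "complex_of_real (LINT x|sphere_measure. (cmod (\<Sum>m\<in>?M. a m * P l m x))\<^sup>2)
      = (LINT x|sphere_measure. (\<Sum>m\<in>?M. \<Sum>k\<in>?M. a m * cnj (a k) * (P l m x * cnj (P l k x))))"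
    unfolding integral_cmod2 scalar_inner_def cnj_sum sum_product complex_cnj_mult by (simp only: mult_ac)
  also have "\<dots> = (\<Sum>m\<in>?M. \<Sum>k\<in>?M. a m * cnj (a k) * scalar_inner (P l m) (P l k))"
  proof -
    have i: "integrable sphere_measure (\<lambda>x. a m * cnj (a k) * (P l m x * cnj (P l k x)))" if "m \<in> ?M" "k \<in> ?M" for m k
      using that by (intro integrable_mult_right cpoly_integrable_sphere cpoly_mult cpoly_cnj P_cpoly) auto
    have "(LINT x|sphere_measure. (\<Sum>m\<in>?M. \<Sum>k\<in>?M. a m * cnj (a k) * (P l m x * cnj (P l k x))))
        = (\<Sum>m\<in>?M. LINT x|sphere_measure. (\<Sum>k\<in>?M. a m * cnj (a k) * (P l m x * cnj (P l k x))))"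
      by (rule Bochner_Integration.integral_sum) (rule Bochner_Integration.integrable_sum, rule i)
    also have "\<dots> = (\<Sum>m\<in>?M. \<Sum>k\<in>?M. LINT x|sphere_measure. a m * cnj (a k) * (P l m x * cnj (P l k x)))"
      by (intro sum.cong refl Bochner_Integration.integral_sum i)
    also have "\<dots> = (\<Sum>m\<in>?M. \<Sum>k\<in>?M. a m * cnj (a k) * scalar_inner (P l m) (P l k))"
      unfolding scalar_inner_def by (simp only: integral_mult_right_zero)
    finally show ?thesis .
  qed
  also have "\<dots> = (\<Sum>m\<in>?M. \<Sum>k\<in>?M. if m = k then a m * cnj (a m) else 0)"
    by (intro sum.cong refl) (auto simp: P_orthonormal)
  also have "\<dots> = (\<Sum>m\<in>?M. a m * cnj (a m))"
    by (intro sum.cong refl) (simp add: sum.delta)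
  also have "\<dots> = complex_of_real (\<Sum>m\<in>?M. (cmod (a m))\<^sup>2)"
    by (simp add: complex_norm_square del: of_real_power)
  finally show ?thesis by (simp only: of_real_eq_iff)
qed

text \<open>Orthogonality removes all degrees other than \<open>l\<close>, so the partial sums of
  the Fourier series are constant from \<open>N = l\<close> on. Completeness makes the difference to
  \<open>f\<close> null in \<open>L2\<close>, and continuity makes it vanish at every point.\<close>

lemma expansion:
  assumes f: "solid_harmonic l f" and x: "x \<in> sphere 0 1"
  shows "f x = (\<Sum>m=- int l..int l. scalar_inner f (Y l m) * P l m x)"
proof -
  let ?s = "\<lambda>x. \<Sum>m=- int l..int l. scalar_inner f (Y l m) * P l m x"
  note fc = solid_harmonicD(1) [OF f]
  have z: "scalar_inner f (Y l' m) = 0" if "\<bar>m\<bar> \<le> int l'" "l' \<noteq> l" for l' m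
  proof -
    have "scalar_inner f (Y l' m) = scalar_inner f (P l' m)"
      using PY that by (intro scalar_inner_cong) auto
    then show ?thesis using solid_harmonic_orthogonal [OF f P] that by simp
  qed
  let ?c = "\<lambda>N. LINT x|sphere_measure.
      (cmod (f x - (\<Sum>l\<le>N. \<Sum>m=- int l..int l. scalar_inner f (Y l m) * Y l m x)))\<^sup>2"
  have "?c \<longlonglongrightarrow> 0"
  proof -
    have "f \<in> borel_measurable sphere_measure"
      by (intro continuous_measurable_sphere cpoly_continuous_on fc)
    moreover have "integrable sphere_measure (\<lambda>x. (cmod (f x))\<^sup>2)"
      by (intro continuous_integrable_sphere continuous_on_power continuous_on_norm cpoly_continuous_on fc)
    ultimately show ?thesis using basis unfolding spherical_harmonic_basis_def by blast
  qed
  moreover have "?c N = (LINT x|sphere_measure. (cmod (f x - ?s x))\<^sup>2)" if "l \<le> N" for N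
  proof (rule Bochner_Integration.integral_cong [OF refl])
    fix x assume "x \<in> space sphere_measure"
    have "(\<Sum>l'\<le>N. \<Sum>m=- int l'..int l'. scalar_inner f (Y l' m) * Y l' m x)
        = (\<Sum>l'\<le>N. if l' = l then ?s x else 0)"
    proof (intro sum.cong refl)
      fix l'
      show "(\<Sum>m=- int l'..int l'. scalar_inner f (Y l' m) * Y l' m x) = (if l' = l then ?s x else 0)"
        using z PY \<open>x \<in> space sphere_measure\<close> by (cases "l' = l") (auto intro!: sum.cong sum.neutral)
    qed
    also have "\<dots> = ?s x" using that by (simp add: sum.delta)
    finally show "(cmod (f x - (\<Sum>l\<le>N. \<Sum>m=- int l..int l. scalar_inner f (Y l m) * Y l m x)))\<^sup>2 = (cmod (f x - ?s x))\<^sup>2"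
      by simp
  qed
  then have "\<forall>\<^sub>F N in sequentially. ?c N = (LINT x|sphere_measure. (cmod (f x - ?s x))\<^sup>2)"
    unfolding eventually_sequentially by blast
  ultimately have "(\<lambda>N::nat. LINT x|sphere_measure. (cmod (f x - ?s x))\<^sup>2) \<longlonglongrightarrow> 0"
    by (rule Lim_transform_eventually)
  then have "(LINT x|sphere_measure. (cmod (f x - ?s x))\<^sup>2) = 0"
    by (simp add: LIMSEQ_const_iff)
  moreover have "cpoly ?s"
    by (rule cpoly_sum, rule cpoly_mult, rule cpoly_const, rule P_cpoly) auto
  ultimately have "f x - ?s x = 0"
    by (intro continuous_norm_integral_zero_sphere [OF _ _ x] continuous_on_diff cpoly_continuous_on fc)
  then show ?thesis by simp
qed

definition kernel :: "nat \<Rightarrow> real^3 \<Rightarrow> real" where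
  "kernel l x = (\<Sum>m=- int l..int l. (cmod (P l m x))\<^sup>2)"

lemma kernel_nonneg: "0 \<le> kernel l x"
  by (simp add: kernel_def sum_nonneg)

text \<open>\<open>kernel l x\<close> is the maximum of \<open>\<bar>f x\<bar>\<^sup>2\<close> over the unit ball of the space of harmonics of
  degree \<open>l\<close>, which is rotation invariant.\<close>
lemma kernel_mono:
  assumes x: "x \<in> sphere 0 1" and y: "y \<in> sphere 0 1"
  shows "kernel l y \<le> kernel l x"
proof -
  let ?M = "{- int l..int l}"
  obtain R where R: "orthogonal_transformation R" "R x = y"
    using orthogonal_transformation_exists_1 [of x y] x y by auto
  \<comment> \<open>\<open>f\<close> is the reproducing element at \<open>y\<close>, moved by
    \<open>R\<close>: its value at \<open>x\<close> and the square of its norm both equal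
    \<open>kernel l y\<close>, so Cauchy-Schwarz in the coefficients of \<open>f\<close> bounds the
    square of \<open>kernel l y\<close> by \<open>kernel l y * kernel l x\<close>.\<close>
  define f where "f z = (\<Sum>m\<in>?M. cnj (P l m y) * P l m (R z))" for z
  have f: "solid_harmonic l f"
    unfolding f_def
    by (rule solid_harmonic_sum, rule solid_harmonic_cmult, rule solid_harmonic_orthogonal_compose [OF P R(1)]) auto
  have fx: "f x = complex_of_real (kernel l y)"
    by (simp add: f_def R(2) kernel_def complex_norm_square mult.commute del: of_real_power)
  define a where "a m = scalar_inner f (Y l m)" for m
  have fa: "f z = (\<Sum>m\<in>?M. a m * P l m z)" if "z \<in> sphere 0 1" for z
    using expansion [OF f that] by (simp add: a_def)
  let ?g = "\<lambda>z. \<Sum>m\<in>?M. cnj (P l m y) * P l m z"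
  have "(\<Sum>m\<in>?M. (cmod (a m))\<^sup>2) = (LINT z|sphere_measure. (cmod (f z))\<^sup>2)"
    unfolding parseval [symmetric] using fa by (intro Bochner_Integration.integral_cong) auto
  also have "\<dots> = (LINT z|sphere_measure. (cmod (?g z))\<^sup>2)"
  proof -
    have "cpoly ?g" by (rule cpoly_sum, rule cpoly_mult, rule cpoly_const, rule P_cpoly) auto
    then have "continuous_on (sphere 0 1) (\<lambda>z. complex_of_real ((cmod (?g z))\<^sup>2))"
      by (intro continuous_on_of_real continuous_on_power continuous_on_norm cpoly_continuous_on)
    from integral_sphere_orthogonal [OF R(1) this] show ?thesis
      unfolding f_def by (simp only: integral_complex_of_real of_real_eq_iff)
  qed
  also have "\<dots> = kernel l y"
    unfolding parseval by (simp add: kernel_def)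
  finally have norm_a: "(\<Sum>m\<in>?M. (cmod (a m))\<^sup>2) = kernel l y" .
  have "kernel l y = cmod (f x)"
    unfolding fx using kernel_nonneg by simp
  also have "\<dots> \<le> (\<Sum>m\<in>?M. cmod (a m) * cmod (P l m x))"
    unfolding fa [OF x] by (rule order_trans [OF norm_sum]) (simp add: norm_mult)
  finally have "(kernel l y)\<^sup>2 \<le> (\<Sum>m\<in>?M. cmod (a m) * cmod (P l m x))\<^sup>2"
    using kernel_nonneg by (intro power_mono) auto
  also have "\<dots> \<le> (\<Sum>m\<in>?M. (cmod (a m))\<^sup>2) * (\<Sum>m\<in>?M. (cmod (P l m x))\<^sup>2)"
    by (rule Cauchy_Schwarz_ineq_sum)
  finally have "kernel l y * kernel l y \<le> kernel l y * kernel l x"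
    unfolding norm_a by (simp add: kernel_def power2_eq_square)
  then show ?thesis
    using kernel_nonneg [of l x] kernel_nonneg [of l y] by (cases "kernel l y = 0") (simp_all add: mult_le_cancel_left)
qed

text \<open>By \<open>kernel_mono\<close> in both directions the kernel is constant on the sphere;
  its integral is \<open>2 * l + 1\<close>, one for each orthonormal function.\<close>

lemma kernel_eq:
  assumes x: "x \<in> sphere 0 1" shows "kernel l x = (2 * real l + 1) / sphere_area"
proof -
  let ?M = "{- int l..int l}"
  have i: "integrable sphere_measure (\<lambda>x. (cmod (P l m x))\<^sup>2)" if "m \<in> ?M" for m
    using that by (intro continuous_integrable_sphere continuous_on_power continuous_on_norm cpoly_continuous_on P_cpoly) auto
  have "(LINT z|sphere_measure. kernel l z) = (LINT z|sphere_measure. kernel l x)"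
    using kernel_mono x by (intro Bochner_Integration.integral_cong) (auto intro: antisym)
  also have "\<dots> = kernel l x * sphere_area" by simp
  finally have "(LINT z|sphere_measure. kernel l z) = kernel l x * sphere_area" .
  moreover have "(LINT z|sphere_measure. kernel l z) = (\<Sum>m\<in>?M. LINT z|sphere_measure. (cmod (P l m z))\<^sup>2)"
    unfolding kernel_def by (rule Bochner_Integration.integral_sum) (rule i)
  moreover have "(LINT z|sphere_measure. (cmod (P l m z))\<^sup>2) = 1" if "m \<in> ?M" for m
  proof -
    have "complex_of_real (LINT z|sphere_measure. (cmod (P l m z))\<^sup>2) = 1"
      unfolding integral_cmod2 using that by (subst P_orthonormal) auto
    then show ?thesis by (simp only: of_real_eq_1_iff)
  qed
  ultimately have "kernel l x * sphere_area = 2 * real l + 1" by simp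
  then show ?thesis using sphere_area_pos by (simp add: field_simps)
qed

text \<open>The squared length of the cross product of \<open>x\<close> with the gradient of
  \<open>f\<close>; at a unit vector it is the common squared length of the surface gradient and the
  surface curl.\<close>

definition rot_norm2 :: "(real^3 \<Rightarrow> complex) \<Rightarrow> real^3 \<Rightarrow> real" where
  "rot_norm2 f x = (cmod (rot_deriv 2 3 f x))\<^sup>2 + (cmod (rot_deriv 3 1 f x))\<^sup>2 + (cmod (rot_deriv 1 2 f x))\<^sup>2"

text \<open>Apply the rotational Laplacian to \<open>kernel l\<close>, which is constant on spheres.\<close>
lemma sum_rot_norm2:
  assumes x: "x \<in> sphere 0 1"
  shows "(\<Sum>m=- int l..int l. rot_norm2 (P l m) x) = eigval l * (2 * real l + 1) / sphere_area"
proof -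
  let ?M = "{- int l..int l}"
  define G where "G z = (\<Sum>m\<in>?M. P l m z * cnj (P l m z))" for z
  have c: "cpoly (P l m)" if "m \<in> ?M" for m using that by (intro P_cpoly) auto
  have Gc: "cpoly G" unfolding G_def by (intro cpoly_sum cpoly_mult [OF c cpoly_cnj [OF c]])
  have Gk: "G z = complex_of_real (kernel l z)" for z
    by (simp add: G_def kernel_def complex_norm_square del: of_real_power)
  have kh: "kernel l (r *\<^sub>R z) = (r ^ l)\<^sup>2 * kernel l z" for r z
  proof -
    have "(cmod (P l m (r *\<^sub>R z)))\<^sup>2 = (r ^ l)\<^sup>2 * (cmod (P l m z))\<^sup>2" if "m \<in> ?M" for m
      using solid_harmonicD(2) [OF P [of m l], of r z] that by (auto simp: power_mult_distrib)
    then show ?thesis by (simp add: kernel_def sum_distrib_left)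
  qed
  \<comment> \<open>\<open>rot_deriv\<close> differentiates in space, so constancy on the unit
    sphere is extended by homogeneity to every sphere about the origin.\<close>
  have inv: "G (R z) = G z" if "orthogonal_transformation R" for R z
  proof (cases "z = 0")
    case True
    then show ?thesis using that by (simp add: linear_0 orthogonal_transformation_linear)
  next
    case False
    have n: "norm (R z) = norm z" using that by (simp add: orthogonal_transformation)
    have "kernel l w = (norm w ^ l)\<^sup>2 * ((2 * real l + 1) / sphere_area)" if "w \<noteq> 0" for w
      using kh [of "norm w" "w /\<^sub>R norm w"] kernel_eq [of "w /\<^sub>R norm w" l] that by simp
    moreover have "R z \<noteq> 0" using n False by auto
    ultimately show ?thesis using False n by (simp add: Gk)
  qed
  have rot0: "rot_deriv a b G = (\<lambda>z. 0)" if "a \<noteq> b" for a b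
  proof
    fix z
    have "((\<lambda>\<theta>. G (plane_rot a b \<theta> z)) has_vector_derivative rot_deriv a b G (plane_rot a b 0 z)) (at 0)"
      by (rule plane_rot_deriv [OF Gc that])
    moreover have "((\<lambda>\<theta>. G (plane_rot a b \<theta> z)) has_vector_derivative 0) (at 0)"
      unfolding inv [OF plane_rot_orthogonal [OF that]] by (rule has_vector_derivative_const)
    ultimately show "rot_deriv a b G z = 0"
      using vector_derivative_unique_at by fastforce
  qed
  have r1: "rot_deriv a b G = (\<lambda>z. \<Sum>m\<in>?M. rot_deriv a b (P l m) z * cnj (P l m z) + P l m z * cnj (rot_deriv a b (P l m) z))" for a b
  proof -
    have "rot_deriv a b G = (\<lambda>z. \<Sum>m\<in>?M. rot_deriv a b (\<lambda>z. P l m z * cnj (P l m z)) z)"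
      unfolding G_def [abs_def] by (rule rot_deriv_sum) (rule cpoly_mult [OF c cpoly_cnj [OF c]])
    then show ?thesis
      by (simp only: rot_deriv_mult [OF c cpoly_cnj [OF c]] rot_deriv_cnj [OF c] cong: sum.cong)
  qed
  have "rot_deriv a b (rot_deriv a b G) = (\<lambda>z. \<Sum>m\<in>?M.
       rot_deriv a b (rot_deriv a b (P l m)) z * cnj (P l m z) + P l m z * cnj (rot_deriv a b (rot_deriv a b (P l m)) z)
       + 2 * complex_of_real ((cmod (rot_deriv a b (P l m) z))\<^sup>2))" for a b
  proof -
    have r2: "rot_deriv a b (\<lambda>z. rot_deriv a b (P l m) z * cnj (P l m z) + P l m z * cnj (rot_deriv a b (P l m) z)) z =
       rot_deriv a b (rot_deriv a b (P l m)) z * cnj (P l m z) + P l m z * cnj (rot_deriv a b (rot_deriv a b (P l m)) z)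
       + 2 * complex_of_real ((cmod (rot_deriv a b (P l m) z))\<^sup>2)" if m: "m \<in> ?M" for m z
    proof -
      note d = cpoly_rot_deriv [OF c [OF m]]
      show ?thesis
        unfolding rot_deriv_add [OF cpoly_mult [OF d cpoly_cnj [OF c [OF m]]] cpoly_mult [OF c [OF m] cpoly_cnj [OF d]]]
          rot_deriv_mult [OF d cpoly_cnj [OF c [OF m]]] rot_deriv_mult [OF c [OF m] cpoly_cnj [OF d]]
          rot_deriv_cnj [OF c [OF m]] rot_deriv_cnj [OF d] complex_norm_square
        by (simp add: algebra_simps)
    qed
    have "rot_deriv a b (rot_deriv a b G)
        = (\<lambda>z. \<Sum>m\<in>?M. rot_deriv a b (\<lambda>z. rot_deriv a b (P l m) z * cnj (P l m z) + P l m z * cnj (rot_deriv a b (P l m) z)) z)"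
      unfolding r1 by (rule rot_deriv_sum) (rule cpoly_add [OF cpoly_mult [OF cpoly_rot_deriv [OF c] cpoly_cnj [OF c]]
        cpoly_mult [OF c cpoly_cnj [OF cpoly_rot_deriv [OF c]]]])
    then show ?thesis by (simp only: r2 cong: sum.cong)
  qed
  moreover have "rot_deriv a b (rot_deriv a b G) x = 0" if "a \<noteq> b" for a b
    unfolding rot0 [OF that] by (simp add: rot_deriv_def)
  ultimately have s0: "(\<Sum>m\<in>?M.
       rot_deriv a b (rot_deriv a b (P l m)) x * cnj (P l m x) + P l m x * cnj (rot_deriv a b (rot_deriv a b (P l m)) x)
       + 2 * complex_of_real ((cmod (rot_deriv a b (P l m) x))\<^sup>2)) = 0" if "a \<noteq> b" for a b
    using that by metis
  \<comment> \<open>Product rule of second order: the cross terms of the three planes add up to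
    \<open>2 * rot_norm2\<close>, and the left-hand side is the rotational Laplacian of the rotation
    invariant \<open>G\<close>.\<close>
  have "0 = (\<Sum>m\<in>?M. rot_laplacian (P l m) x * cnj (P l m x) + P l m x * cnj (rot_laplacian (P l m) x)
      + 2 * complex_of_real (rot_norm2 (P l m) x))"
  proof -
    define E where "E a b m = rot_deriv a b (rot_deriv a b (P l m)) x * cnj (P l m x)
       + P l m x * cnj (rot_deriv a b (rot_deriv a b (P l m)) x)
       + 2 * complex_of_real ((cmod (rot_deriv a b (P l m) x))\<^sup>2)" for a b m
    have "rot_laplacian (P l m) x * cnj (P l m x) + P l m x * cnj (rot_laplacian (P l m) x)
      + 2 * complex_of_real (rot_norm2 (P l m) x) = E 2 3 m + E 3 1 m + E 1 2 m" for m
      unfolding E_def rot_laplacian_def rot_norm2_def by (simp add: algebra_simps)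
    moreover have "(\<Sum>m\<in>?M. E a b m) = 0" if "a \<noteq> b" for a b
      unfolding E_def by (rule s0 [OF that])
    ultimately show ?thesis by (simp add: sum.distrib)
  qed
  also have "\<dots> = (\<Sum>m\<in>?M. 2 * complex_of_real (rot_norm2 (P l m) x - eigval l * (cmod (P l m x))\<^sup>2))"
  proof (intro sum.cong refl)
    fix m assume "m \<in> ?M"
    then have "rot_laplacian (P l m) x = - (complex_of_real (eigval l) * P l m x)"
      by (intro rot_laplacian_solid_harmonic P) auto
    then show "rot_laplacian (P l m) x * cnj (P l m x) + P l m x * cnj (rot_laplacian (P l m) x)
      + 2 * complex_of_real (rot_norm2 (P l m) x)
      = 2 * complex_of_real (rot_norm2 (P l m) x - eigval l * (cmod (P l m x))\<^sup>2)"
      by (simp add: complex_norm_square algebra_simps del: of_real_power)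
  qed
  also have "\<dots> = complex_of_real (2 * ((\<Sum>m\<in>?M. rot_norm2 (P l m) x) - eigval l * kernel l x))"
    by (simp add: kernel_def sum_subtractf right_diff_distrib sum_distrib_left)
  finally have "complex_of_real (2 * ((\<Sum>m\<in>?M. rot_norm2 (P l m) x) - eigval l * kernel l x)) = 0"
    by (rule sym)
  then have "(\<Sum>m\<in>?M. rot_norm2 (P l m) x) = eigval l * kernel l x"
    by (simp only: of_real_eq_0_iff) simp
  then show ?thesis using kernel_eq [OF x, of l] by simp
qed

text \<open>At a unit vector \<open>x\<close> the derivative of \<open>y /\<^sub>R norm y\<close> is
  the orthogonal projection \<open>h - (x \<bullet> h) *\<^sub>R x\<close>, so composing with it
  removes the radial part of the gradient of \<open>P l m\<close>.\<close>

lemma gradient_radial_ext: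
  assumes x: "x \<in> sphere 0 1" and m: "\<bar>m\<bar> \<le> int l"
  shows "gradient (radial_ext (Y l m)) x $ i
    = partial_deriv i (P l m) x - complex_of_real (x $ i) * (\<Sum>j\<in>UNIV. complex_of_real (x $ j) * partial_deriv j (P l m) x)"
proof -
  let ?p = "P l m"
  have x1: "norm x = 1" using x by simp
  have x0: "x \<noteq> 0" using x1 by auto
  have "((\<lambda>y. y /\<^sub>R norm y) has_derivative (\<lambda>h. h - (x \<bullet> h) *\<^sub>R x)) (at x)"
  proof -
    have "(norm has_derivative (\<lambda>h. h \<bullet> x)) (at x)"
      using has_derivative_norm [OF x0] x1 by (simp add: sgn_div_norm inner_commute)
    from has_derivative_scaleR [OF Deriv.has_derivative_inverse [OF _ this] has_derivative_ident]
    show ?thesis using x1 by (simp add: inner_commute algebra_simps)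
  qed
  from has_derivative_compose [OF this cpoly_has_derivative [OF P_cpoly [OF m]]]
  have "((\<lambda>y. ?p (y /\<^sub>R norm y)) has_derivative
      (\<lambda>h. \<Sum>j\<in>UNIV. complex_of_real ((h - (x \<bullet> h) *\<^sub>R x) $ j) * partial_deriv j ?p x)) (at x)"
    by (simp add: x1)
  moreover have "(\<Sum>j\<in>UNIV. complex_of_real ((h - (x \<bullet> h) *\<^sub>R x) $ j) * partial_deriv j ?p x)
      = (\<Sum>i\<in>UNIV. complex_of_real (h $ i) * (partial_deriv i ?p x
           - complex_of_real (x $ i) * (\<Sum>j\<in>UNIV. complex_of_real (x $ j) * partial_deriv j ?p x)))" for h
    by (simp add: sum_3 inner_vec_def algebra_simps)
  ultimately have d: "((\<lambda>y. ?p (y /\<^sub>R norm y)) has_derivative (\<lambda>h. \<Sum>i\<in>UNIV. complex_of_real (h $ i) * (partial_deriv i ?p x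
           - complex_of_real (x $ i) * (\<Sum>j\<in>UNIV. complex_of_real (x $ j) * partial_deriv j ?p x)))) (at x)"
    by (simp only:)
  have "(radial_ext (Y l m) has_derivative (\<lambda>h. \<Sum>i\<in>UNIV. complex_of_real (h $ i) * (partial_deriv i ?p x
           - complex_of_real (x $ i) * (\<Sum>j\<in>UNIV. complex_of_real (x $ j) * partial_deriv j ?p x)))) (at x)"
  \<comment> \<open>\<open>Y\<close> and \<open>P\<close> agree on the sphere, and
    \<open>radial_ext\<close> evaluates there at every nonzero point, hence throughout a
    neighbourhood of \<open>x\<close>.\<close>
  proof (rule has_derivative_transform_within_open [OF d, of "- {0}"])
    fix y :: "real^3" assume "y \<in> - {0}"
    then have "y /\<^sub>R norm y \<in> sphere 0 1" by simp
    then show "?p (y /\<^sub>R norm y) = radial_ext (Y l m) y"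
      using PY [OF m] by (simp only: radial_ext_def)
  qed (use x0 in auto)
  from partial_deriv_eqI [OF this] show ?thesis by (simp add: gradient_def)
qed

lemma norm2_complex3: "(norm v)\<^sup>2 = (cmod (v $ 1))\<^sup>2 + (cmod (v $ 2))\<^sup>2 + (cmod (v $ 3))\<^sup>2"
  for v :: "complex^3"
  by (simp add: norm_vec_def L2_set_def sum_3)

text \<open>The cross product with \<open>x\<close> annihilates the radial part subtracted in
  \<open>gradient_radial_ext\<close>, so the components are exactly the three rotation derivatives
  of \<open>P l m\<close>.\<close>

lemma norm2_surface_curl:
  assumes x: "x \<in> sphere 0 1" and m: "\<bar>m\<bar> \<le> int l"
  shows "(norm (surface_curl (Y l m) x))\<^sup>2 = rot_norm2 (P l m) x"
proof -
  note g = gradient_radial_ext [OF x m]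
  have "surface_curl (Y l m) x $ 1 = rot_deriv 2 3 (P l m) x"
    "surface_curl (Y l m) x $ 2 = rot_deriv 3 1 (P l m) x"
    "surface_curl (Y l m) x $ 3 = rot_deriv 1 2 (P l m) x"
    unfolding surface_curl_def matrix_vector_mult_def
    by (simp_all only: vec_lambda_beta g sum_3 [of "\<lambda>j. cross_matrix x $ _ $ j * _ j"])
      (simp_all add: cross_matrix_def rot_deriv_def algebra_simps)
  then show ?thesis by (simp add: norm2_complex3 rot_norm2_def)
qed

text \<open>The gradient of the radial extension is tangential already, so
  \<open>tangential_proj\<close> fixes it. Lagrange's identity for \<open>x\<close> and the gradient
  of \<open>P l m\<close> then turns its squared length into that of their cross product.\<close>

lemma norm2_surface_gradient:
  assumes x: "x \<in> sphere 0 1" and m: "\<bar>m\<bar> \<le> int l"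
  shows "(norm (surface_gradient (Y l m) x))\<^sup>2 = rot_norm2 (P l m) x"
proof -
  define X where "X i = complex_of_real (x $ i)" for i
  define D where "D i = partial_deriv i (P l m) x" for i
  define E where "E = X 1 * D 1 + X 2 * D 2 + X 3 * D 3"
  define G where "G i = D i - X i * E" for i
  have g: "gradient (radial_ext (Y l m)) x $ i = G i" for i
    unfolding gradient_radial_ext [OF x m] G_def E_def X_def D_def by (simp add: sum_3)
  have "(norm x)\<^sup>2 = (x $ 1)\<^sup>2 + (x $ 2)\<^sup>2 + (x $ 3)\<^sup>2"
    by (simp add: norm_vec_def L2_set_def sum_3)
  then have "(x $ 1)\<^sup>2 + (x $ 2)\<^sup>2 + (x $ 3)\<^sup>2 = 1" using x by simp
  then have q: "X 1 * X 1 + X 2 * X 2 + X 3 * X 3 = 1"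
    unfolding X_def of_real_mult [symmetric] of_real_add [symmetric] by (simp add: power2_eq_square)
  have "X 1 * G 1 + X 2 * G 2 + X 3 * G 3 = E - (X 1 * X 1 + X 2 * X 2 + X 3 * X 3) * E"
    by (simp add: G_def E_def algebra_simps)
  then have XG: "X 1 * G 1 + X 2 * G 2 + X 3 * G 3 = 0" by (simp add: q)
  have "surface_gradient (Y l m) x $ i = G i - X i * (X 1 * G 1 + X 2 * G 2 + X 3 * G 3)" for i
    unfolding surface_gradient_def matrix_vector_mult_def tangential_proj_def
    using exhaust_3 [of i] by (auto simp: g sum_3 mat_def X_def algebra_simps)
  then have sg: "surface_gradient (Y l m) x $ i = G i" for i by (simp add: XG)
  have cX: "cnj (X i) = X i" for i by (simp add: X_def)
  define F where "F i = cnj (D i)" for i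
  define E' where "E' = X 1 * F 1 + X 2 * F 2 + X 3 * F 3"
  have cE: "cnj E = E'" by (simp add: E_def E'_def F_def cX)
  have cG: "cnj (G i) = F i - X i * E'" for i by (simp add: G_def F_def cX cE)
  have "complex_of_real ((norm (surface_gradient (Y l m) x))\<^sup>2)
      = G 1 * cnj (G 1) + G 2 * cnj (G 2) + G 3 * cnj (G 3)"
    by (simp add: norm2_complex3 sg complex_norm_square del: of_real_power)
  also have "\<dots> = (D 1 * F 1 + D 2 * F 2 + D 3 * F 3) - 2 * E * E' + (X 1 * X 1 + X 2 * X 2 + X 3 * X 3) * E * E'"
  proof -
    have "G 1 * cnj (G 1) + G 2 * cnj (G 2) + G 3 * cnj (G 3)
        = (D 1 * F 1 + D 2 * F 2 + D 3 * F 3) - (X 1 * D 1 + X 2 * D 2 + X 3 * D 3) * E'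
          - E * (X 1 * F 1 + X 2 * F 2 + X 3 * F 3) + (X 1 * X 1 + X 2 * X 2 + X 3 * X 3) * E * E'"
      unfolding cG by (simp add: G_def algebra_simps)
    then show ?thesis by (simp add: E_def [symmetric] E'_def [symmetric] del: cG)
  qed
  \<comment> \<open>The factor equal to 1 is put in front to make the expression homogeneous, as
    Lagrange's identity in the next step requires.\<close>
  also have "\<dots> = (X 1 * X 1 + X 2 * X 2 + X 3 * X 3) * (D 1 * F 1 + D 2 * F 2 + D 3 * F 3) - E * E'"
    by (simp add: q)
  also have "\<dots> = (X 2 * D 3 - X 3 * D 2) * cnj (X 2 * D 3 - X 3 * D 2) + (X 3 * D 1 - X 1 * D 3) * cnj (X 3 * D 1 - X 1 * D 3)
      + (X 1 * D 2 - X 2 * D 1) * cnj (X 1 * D 2 - X 2 * D 1)"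
    unfolding complex_cnj_diff complex_cnj_mult cX F_def [symmetric] E_def E'_def by (simp add: algebra_simps)
  also have "\<dots> = complex_of_real (rot_norm2 (P l m) x)"
    by (simp add: rot_norm2_def rot_deriv_def X_def D_def complex_norm_square del: of_real_power complex_cnj_diff complex_cnj_mult)
  finally show ?thesis by (simp only: of_real_eq_iff)
qed

text \<open>Both fields have squared length \<open>rot_norm2 / eigval l\<close>, and the factor
  \<open>eigval l\<close> of \<open>sum_rot_norm2\<close> cancels; \<open>1 \<le> l\<close> keeps it
  positive.\<close>

lemma vector_addition_theorem:
  assumes x: "x \<in> sphere 0 1" and l: "1 \<le> l"
  shows "(\<Sum>m=- int l..int l. (norm (vsh_y Y l m x))\<^sup>2) = (2 * real l + 1) / sphere_area"
    and "(\<Sum>m=- int l..int l. (norm (vsh_z Y l m x))\<^sup>2) = (2 * real l + 1) / sphere_area"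
proof -
  have ev: "0 < eigval l" using l by (simp add: eigval_def)
  have *: "(\<Sum>m=- int l..int l. (norm (f m /\<^sub>R sqrt (eigval l)))\<^sup>2) = (2 * real l + 1) / sphere_area"
    if "\<And>m. \<bar>m\<bar> \<le> int l \<Longrightarrow> (norm (f m))\<^sup>2 = rot_norm2 (P l m) x" for f :: "int \<Rightarrow> complex^3"
  proof -
    have "(norm (f m /\<^sub>R sqrt (eigval l)))\<^sup>2 = rot_norm2 (P l m) x / eigval l" if "m \<in> {- int l..int l}" for m
      using ev that \<open>\<And>m. \<bar>m\<bar> \<le> int l \<Longrightarrow> (norm (f m))\<^sup>2 = rot_norm2 (P l m) x\<close> [of m]
      by (simp add: abs_le_iff power_mult_distrib power_inverse divide_inverse mult.commute)
    then show ?thesis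
      using sum_rot_norm2 [OF x, of l] ev by (simp add: sum_divide_distrib [symmetric])
  qed
  show "(\<Sum>m=- int l..int l. (norm (vsh_y Y l m x))\<^sup>2) = (2 * real l + 1) / sphere_area"
    unfolding vsh_y_def by (rule *) (rule norm2_surface_curl [OF x])
  show "(\<Sum>m=- int l..int l. (norm (vsh_z Y l m x))\<^sup>2) = (2 * real l + 1) / sphere_area"
    unfolding vsh_z_def by (rule *) (rule norm2_surface_gradient [OF x])
qed

lemma continuous_on_vsh:
  assumes m: "\<bar>m\<bar> \<le> int l"
  shows "continuous_on (sphere 0 1) (vsh_y Y l m)" "continuous_on (sphere 0 1) (vsh_z Y l m)"
proof -
  note p = P_cpoly [OF m]
  let ?g = "\<lambda>i x. partial_deriv i (P l m) x - complex_of_real (x $ i) * (\<Sum>j\<in>UNIV. complex_of_real (x $ j) * partial_deriv j (P l m) x)"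
  have "cpoly (?g i)" for i
    by (rule cpoly_diff [OF cpoly_partial_deriv [OF p] cpoly_mult [OF cpoly_coord
      cpoly_sum [OF cpoly_mult [OF cpoly_coord cpoly_partial_deriv [OF p]]]]])
  then have "continuous_on (sphere 0 1) (?g i)" for i by (rule cpoly_continuous_on)
  then have g: "continuous_on (sphere 0 1) (\<lambda>x. gradient (radial_ext (Y l m)) x $ i)" for i
    by (rule continuous_on_eq) (simp only: gradient_radial_ext [OF _ m])
  have c: "continuous_on (sphere 0 1) (\<lambda>x::real^3. cross_matrix x $ i $ j)" for i j
    using exhaust_3 [of i] exhaust_3 [of j]
    by (elim disjE) (simp_all add: cross_matrix_def continuous_on_minus continuous_on_of_real continuous_on_component)
  have t: "continuous_on (sphere 0 1) (\<lambda>x::real^3. tangential_proj x $ i $ j)" for i j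
    unfolding tangential_proj_def vector_minus_component vec_lambda_beta
    by (intro continuous_on_diff continuous_on_const continuous_on_of_real continuous_on_mult continuous_on_component continuous_on_id)
  have mv: "continuous_on (sphere 0 1) (\<lambda>x. (A x *v gradient (radial_ext (Y l m)) x) /\<^sub>R s)"
    if "\<And>i j. continuous_on (sphere 0 1) (\<lambda>x. A x $ i $ j)" for A :: "real^3 \<Rightarrow> complex^3^3" and s
    unfolding matrix_vector_mult_def
    by (intro continuous_on_scaleR continuous_on_const continuous_on_vec_lambda continuous_on_sum continuous_on_mult that g)
  show "continuous_on (sphere 0 1) (vsh_y Y l m)" "continuous_on (sphere 0 1) (vsh_z Y l m)"
    unfolding vsh_y_def [abs_def] vsh_z_def [abs_def] surface_curl_def surface_gradient_def by (rule mv, rule c, rule mv, rule t)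
qed

end

lemma harmonic_basis_exists:
  assumes "spherical_harmonic_basis Y" obtains P where "harmonic_basis Y P"
proof -
  have "\<forall>l m. \<bar>m\<bar> \<le> int l \<longrightarrow> (\<exists>p. solid_harmonic l p \<and> (\<forall>x\<in>sphere 0 1. Y l m x = p x))"
    using assms spherical_harmonic_solid unfolding spherical_harmonic_basis_def by metis
  then obtain P where "\<forall>l m. \<bar>m\<bar> \<le> int l \<longrightarrow> solid_harmonic l (P l m) \<and> (\<forall>x\<in>sphere 0 1. Y l m x = P l m x)"
    by metis
  then have "harmonic_basis Y P"
    using assms by unfold_locales auto
  then show thesis by (rule that)
qed

section \<open>Square-integrable random variables\<close>

definition square_integrable :: "'a measure \<Rightarrow> ('a \<Rightarrow> 'b::{real_normed_field, second_countable_topology, banach}) \<Rightarrow> bool" where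
  "square_integrable M f \<longleftrightarrow> f \<in> borel_measurable M \<and> integrable M (\<lambda>\<omega>. (norm (f \<omega>))\<^sup>2)"

lemma square_integrableD [dest]:
  "square_integrable M f \<Longrightarrow> f \<in> borel_measurable M"
  "square_integrable M f \<Longrightarrow> integrable M (\<lambda>\<omega>. (norm (f \<omega>))\<^sup>2)"
  by (auto simp: square_integrable_def)

lemma norm_add_square_le: "(norm (a + b))\<^sup>2 \<le> 2 * (norm a)\<^sup>2 + 2 * (norm b)\<^sup>2"
proof -
  have "(norm (a + b))\<^sup>2 \<le> (norm a + norm b)\<^sup>2" by (intro power_mono norm_triangle_ineq) auto
  also have "\<dots> \<le> 2 * (norm a)\<^sup>2 + 2 * (norm b)\<^sup>2"
    using zero_le_power2 [of "norm a - norm b"] by (simp add: power2_eq_square algebra_simps)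
  finally show ?thesis .
qed

lemma square_integrable_add:
  assumes f: "square_integrable M f" and g: "square_integrable M g" shows "square_integrable M (\<lambda>\<omega>. f \<omega> + g \<omega>)"
  unfolding square_integrable_def
proof
  note [measurable] = square_integrableD(1) [OF f] square_integrableD(1) [OF g]
  show "(\<lambda>\<omega>. f \<omega> + g \<omega>) \<in> borel_measurable M" by simp
  show "integrable M (\<lambda>\<omega>. (norm (f \<omega> + g \<omega>))\<^sup>2)"
  proof (rule Bochner_Integration.integrable_bound)
    show "integrable M (\<lambda>\<omega>. 2 * (norm (f \<omega>))\<^sup>2 + 2 * (norm (g \<omega>))\<^sup>2)"
      by (intro Bochner_Integration.integrable_add integrable_mult_right square_integrableD(2) f g)
    show "AE \<omega> in M. norm ((norm (f \<omega> + g \<omega>))\<^sup>2) \<le> norm (2 * (norm (f \<omega>))\<^sup>2 + 2 * (norm (g \<omega>))\<^sup>2)"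
      using norm_add_square_le [of "f _" "g _"] by (intro AE_I2) simp
  qed simp
qed

lemma square_integrable_cmult:
  assumes "square_integrable M f" shows "square_integrable M (\<lambda>\<omega>. c * f \<omega>)"
  unfolding square_integrable_def norm_mult power_mult_distrib
  by (intro conjI borel_measurable_times borel_measurable_const integrable_mult_right square_integrableD [OF assms])

lemma square_integrable_diff:
  assumes "square_integrable M f" "square_integrable M g" shows "square_integrable M (\<lambda>\<omega>. f \<omega> - g \<omega>)"
  using square_integrable_add [OF assms(1) square_integrable_cmult [OF assms(2), of "-1"]] by simp

lemma square_integrable_sum:
  assumes "\<And>i. i \<in> I \<Longrightarrow> square_integrable M (f i)" shows "square_integrable M (\<lambda>\<omega>. \<Sum>i\<in>I. f i \<omega>)"
  using assms
proof (induction I rule: infinite_finite_induct)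
  case (insert i I)
  then show ?case by (simp add: square_integrable_add)
qed (simp_all add: square_integrable_def)

lemma square_integrable_mult:
  assumes f: "square_integrable M f" and g: "square_integrable M g" shows "integrable M (\<lambda>\<omega>. f \<omega> * g \<omega>)"
proof (rule Bochner_Integration.integrable_bound)
  note [measurable] = square_integrableD(1) [OF f] square_integrableD(1) [OF g]
  show "(\<lambda>\<omega>. f \<omega> * g \<omega>) \<in> borel_measurable M" by simp
  show "integrable M (\<lambda>\<omega>. (norm (f \<omega>))\<^sup>2 + (norm (g \<omega>))\<^sup>2)"
    using f g by (intro Bochner_Integration.integrable_add) auto
  have "norm a * norm b \<le> (norm a)\<^sup>2 + (norm b)\<^sup>2" for a b :: 'b
  proof -
    have "0 \<le> (norm a - norm b)\<^sup>2 + (norm a)\<^sup>2 + (norm b)\<^sup>2" by simp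
    then show ?thesis by (simp add: power2_eq_square algebra_simps)
  qed
  then show "AE \<omega> in M. norm (f \<omega> * g \<omega>) \<le> norm ((norm (f \<omega>))\<^sup>2 + (norm (g \<omega>))\<^sup>2)"
    by (intro AE_I2) (simp add: norm_mult abs_of_nonneg)
qed

lemma square_integrable_cnj: "square_integrable M f \<Longrightarrow> square_integrable M (\<lambda>\<omega>. cnj (f \<omega>))"
  unfolding square_integrable_def by (auto intro: borel_measurable_continuous_on [OF _ , of cnj, unfolded comp_def] continuous_on_cnj)

lemma square_integrable_of_real:
  "square_integrable M f \<Longrightarrow> square_integrable M (\<lambda>\<omega>. complex_of_real (f \<omega>))"
  unfolding square_integrable_def by auto

lemma (in prob_space) square_integrable_integrable:
  assumes "square_integrable M f" shows "integrable M f"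
  using square_integrable_mult [OF assms, of "\<lambda>_. 1"] by (simp add: square_integrable_def)

section \<open>Normal variables and second moments of almost sure limits\<close>

context prob_space
begin

lemma centred_normal_square_integrable:
  assumes "centred_normal M Z" shows "square_integrable M Z" "expectation Z = 0"
proof -
  have Z [measurable]: "Z \<in> borel_measurable M" using assms by (simp add: centred_normal_def)
  consider "AE \<omega> in M. Z \<omega> = 0" | s where "s > 0" "distributed M lborel Z (normal_density 0 s)"
    using assms by (auto simp: centred_normal_def)
  then have "integrable M (\<lambda>\<omega>. (Z \<omega>)\<^sup>2) \<and> expectation Z = 0"
  proof cases
    case 1
    then have "integrable M (\<lambda>\<omega>. (Z \<omega>)\<^sup>2) \<longleftrightarrow> integrable M (\<lambda>\<omega>. 0 :: real)"
      by (intro integrable_cong_AE) auto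
    moreover have "expectation Z = expectation (\<lambda>\<omega>. 0)"
      using 1 by (intro integral_cong_AE) auto
    ultimately show ?thesis by simp
  next
    case 2
    have "integrable lborel (\<lambda>x. normal_density 0 s x * x\<^sup>2)"
      using integrable_normal_moment [OF 2(1), of 0 2] by simp
    then have "integrable M (\<lambda>\<omega>. (Z \<omega>)\<^sup>2)"
      by (subst (asm) distributed_integrable [OF 2(2)]) auto
    then show ?thesis using normal_distributed_expectation [OF 2] by simp
  qed
  then show "square_integrable M Z" "expectation Z = 0" by (simp_all add: square_integrable_def)
qed

text \<open>The density is at most the reciprocal of the standard deviation. Hence centred normal
  variables with variances tending to infinity cannot stay bounded in probability, which is how
  divergence of the grid sums is detected.\<close>

lemma centred_normal_small_ball:
  assumes Z: "centred_normal M Z" and v: "0 < expectation (\<lambda>\<omega>. (Z \<omega>)\<^sup>2)" and K: "0 \<le> K"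
  shows "prob {\<omega> \<in> space M. \<bar>Z \<omega>\<bar> \<le> K} \<le> 2 * K / sqrt (expectation (\<lambda>\<omega>. (Z \<omega>)\<^sup>2))"
proof -
  have [measurable]: "Z \<in> borel_measurable M" using Z by (simp add: centred_normal_def)
  have "\<not> (AE \<omega> in M. Z \<omega> = 0)"
  proof
    assume "AE \<omega> in M. Z \<omega> = 0"
    then have "expectation (\<lambda>\<omega>. (Z \<omega>)\<^sup>2) = expectation (\<lambda>\<omega>. 0)" by (intro integral_cong_AE) auto
    then show False using v by simp
  qed
  then obtain s where s: "s > 0" and d: "distributed M lborel Z (normal_density 0 s)"
    using Z by (auto simp: centred_normal_def)
  have "variance Z = s\<^sup>2" by (rule normal_distributed_variance [OF s d])
  then have v2: "expectation (\<lambda>\<omega>. (Z \<omega>)\<^sup>2) = s\<^sup>2"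
    using normal_distributed_expectation [OF s d] by simp
  have "emeasure M {\<omega> \<in> space M. \<bar>Z \<omega>\<bar> \<le> K} = emeasure M (Z -` {-K..K} \<inter> space M)"
    by (intro arg_cong2 [where f = emeasure]) auto
  also have "\<dots> = (\<integral>\<^sup>+x. ennreal (normal_density 0 s x) * indicator {-K..K} x \<partial>lborel)"
    by (rule distributed_emeasure [OF d]) simp
  also have "\<dots> \<le> (\<integral>\<^sup>+x. ennreal (1 / s) * indicator {-K..K} x \<partial>lborel)"
  proof (intro nn_integral_mono mult_right_mono ennreal_leI)
    fix x
    have "normal_density 0 s x \<le> 1 / sqrt (2 * pi * s\<^sup>2) * 1"
      unfolding normal_density_def using s by (intro mult_left_mono) auto
    also have "\<dots> \<le> 1 / s"
    proof -
      have "1 * s\<^sup>2 \<le> 2 * pi * s\<^sup>2" using pi_gt3 by (intro mult_right_mono) auto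
      then have "sqrt (s\<^sup>2) \<le> sqrt (2 * pi * s\<^sup>2)" by (simp only: real_sqrt_le_iff)
      then have "s \<le> sqrt (2 * pi * s\<^sup>2)" using s by simp
      then show ?thesis using s by (simp only: mult_1_right) (intro divide_left_mono mult_pos_pos, auto)
    qed
    finally show "normal_density 0 s x \<le> 1 / s" .
  qed simp
  also have "\<dots> = ennreal (1 / s) * ennreal (2 * K)"
    using K by (simp add: nn_integral_cmult_indicator)
  also have "\<dots> = ennreal (2 * K / s)"
    using s K by (simp add: ennreal_mult [symmetric])
  finally show ?thesis
    using s K unfolding v2 by (simp add: emeasure_eq_measure ennreal_le_iff)
qed

lemma complex_centred_normal_square_integrable:
  assumes "complex_centred_normal M v Z"
  shows "square_integrable M Z" "expectation (\<lambda>\<omega>. (cmod (Z \<omega>))\<^sup>2) = v"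
proof -
  have n: "centred_normal M (\<lambda>\<omega>. a * Re (Z \<omega>) + b * Im (Z \<omega>))" for a b
    using assms by (simp add: complex_centred_normal_def)
  have s: "square_integrable M (\<lambda>\<omega>. Re (Z \<omega>))" "square_integrable M (\<lambda>\<omega>. Im (Z \<omega>))"
    using centred_normal_square_integrable(1) [OF n [of 1 0]] centred_normal_square_integrable(1) [OF n [of 0 1]] by simp_all
  have "square_integrable M (\<lambda>\<omega>. complex_of_real (Re (Z \<omega>)) + \<i> * complex_of_real (Im (Z \<omega>)))"
    by (intro square_integrable_add square_integrable_cmult square_integrable_of_real s)
  then show "square_integrable M Z" by (simp flip: complex_eq)
  show "expectation (\<lambda>\<omega>. (cmod (Z \<omega>))\<^sup>2) = v" using assms by (simp add: complex_centred_normal_def)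
qed

text \<open>With \<open>D = I - W q\<close>, \<open>\<bar>F\<bar> \<bar>D\<bar> \<le> max 0 (\<bar>F\<bar> \<bar>D\<bar> - e \<bar>D\<bar>\<^sup>2) + e \<bar>D\<bar>\<^sup>2\<close>, and the maximum is dominated by \<open>\<bar>F\<bar>\<^sup>2 / (4 e)\<close>.\<close>
lemma AE_limit_second_moments:
  fixes W :: "nat \<Rightarrow> 'a \<Rightarrow> complex"
  assumes W: "\<And>q. square_integrable M (W q)" and V: "\<And>q. expectation (\<lambda>\<omega>. (cmod (W q \<omega>))\<^sup>2) \<le> V"
    and lim: "AE \<omega> in M. (\<lambda>q. W q \<omega>) \<longlonglongrightarrow> I \<omega>" and I [measurable]: "I \<in> borel_measurable M"
  shows "square_integrable M I" and "expectation (\<lambda>\<omega>. (cmod (I \<omega>))\<^sup>2) \<le> V"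
    and "\<And>F. square_integrable M F \<Longrightarrow> (\<And>q. expectation (\<lambda>\<omega>. F \<omega> * cnj (W q \<omega>)) = 0) \<Longrightarrow>
      expectation (\<lambda>\<omega>. F \<omega> * cnj (I \<omega>)) = 0"
proof -
  have [measurable]: "W q \<in> borel_measurable M" for q using W by auto
  have V0: "0 \<le> V" using V [of 0] by (rule order_trans [rotated]) simp
  have "(\<integral>\<^sup>+\<omega>. ennreal ((cmod (I \<omega>))\<^sup>2) \<partial>M) = (\<integral>\<^sup>+\<omega>. liminf (\<lambda>q. ennreal ((cmod (W q \<omega>))\<^sup>2)) \<partial>M)"
  proof (intro nn_integral_cong_AE, use lim in eventually_elim)
    case (elim \<omega>)
    have "(\<lambda>q. ennreal ((cmod (W q \<omega>))\<^sup>2)) \<longlonglongrightarrow> ennreal ((cmod (I \<omega>))\<^sup>2)"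
      by (intro tendsto_ennrealI tendsto_power tendsto_norm elim)
    from lim_imp_Liminf [OF sequentially_bot this] show ?case by (rule sym)
  qed
  also have "\<dots> \<le> liminf (\<lambda>q. \<integral>\<^sup>+\<omega>. ennreal ((cmod (W q \<omega>))\<^sup>2) \<partial>M)"
    by (rule nn_integral_liminf) simp
  also have "\<dots> \<le> liminf (\<lambda>q. ennreal V)"
  proof (intro Liminf_mono always_eventually allI)
    fix q
    have "(\<integral>\<^sup>+\<omega>. ennreal ((cmod (W q \<omega>))\<^sup>2) \<partial>M) = ennreal (expectation (\<lambda>\<omega>. (cmod (W q \<omega>))\<^sup>2))"
      using W [of q] by (intro nn_integral_eq_integral) auto
    then show "(\<integral>\<^sup>+\<omega>. ennreal ((cmod (W q \<omega>))\<^sup>2) \<partial>M) \<le> ennreal V" using V by (simp add: ennreal_leI)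
  qed
  also have "\<dots> = ennreal V" by (simp add: Liminf_const)
  finally have nn: "(\<integral>\<^sup>+\<omega>. ennreal ((cmod (I \<omega>))\<^sup>2) \<partial>M) \<le> ennreal V" .
  have Ii: "integrable M (\<lambda>\<omega>. (cmod (I \<omega>))\<^sup>2)"
    using nn by (intro integrableI_bounded) (auto intro: le_less_trans)
  then show sI: "square_integrable M I" by (simp add: square_integrable_def)
  have "ennreal (expectation (\<lambda>\<omega>. (cmod (I \<omega>))\<^sup>2)) \<le> ennreal V"
    using nn Ii by (subst nn_integral_eq_integral [symmetric]) auto
  then show IV: "expectation (\<lambda>\<omega>. (cmod (I \<omega>))\<^sup>2) \<le> V" using V0 by simp
  fix F :: "'a \<Rightarrow> complex" assume F: "square_integrable M F" and 0: "\<And>q. expectation (\<lambda>\<omega>. F \<omega> * cnj (W q \<omega>)) = 0"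
  have [measurable]: "F \<in> borel_measurable M" using F by auto
  define E where "E = cmod (expectation (\<lambda>\<omega>. F \<omega> * cnj (I \<omega>)))"
  \<comment> \<open>Bounded second moments do not turn almost sure convergence into convergence in
    mean square, so \<open>e\<close> separates two parts: \<open>h q\<close> tends to 0 by dominated
    convergence, and the rest is \<open>e\<close> times the second moment of \<open>I - W q\<close>,
    at most \<open>2 * V + 2 * V\<close>.\<close>
  have bound: "E \<le> e * (4 * V)" if e: "e > 0" for e
  proof -
    define h where "h q \<omega> = max 0 (cmod (F \<omega>) * cmod (I \<omega> - W q \<omega>) - e * (cmod (I \<omega> - W q \<omega>))\<^sup>2)" for q \<omega>
    have h_le: "h q \<omega> \<le> (cmod (F \<omega>))\<^sup>2 / (4 * e)" for q \<omega>
    proof -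
      have "0 \<le> (cmod (F \<omega>) - 2 * e * cmod (I \<omega> - W q \<omega>))\<^sup>2" by simp
      then show ?thesis using e by (simp add: h_def power2_eq_square field_simps)
    qed
    have hm: "h q \<in> borel_measurable M" for q unfolding h_def by measurable
    have h0: "0 \<le> h q \<omega>" for q \<omega> by (simp add: h_def)
    have Fi: "integrable M (\<lambda>\<omega>. (cmod (F \<omega>))\<^sup>2 / (4 * e))" using F by auto
    have "(\<lambda>q. expectation (h q)) \<longlonglongrightarrow> expectation (\<lambda>\<omega>. 0)"
    proof (rule integral_dominated_convergence [OF _ _ Fi])
      show "AE \<omega> in M. (\<lambda>q. h q \<omega>) \<longlonglongrightarrow> 0"
        using lim
      proof eventually_elim
        case (elim \<omega>)
        have "(\<lambda>q. max 0 (cmod (F \<omega>) * cmod (I \<omega> - W q \<omega>) - e * (cmod (I \<omega> - W q \<omega>))\<^sup>2))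
            \<longlonglongrightarrow> max 0 (cmod (F \<omega>) * cmod (I \<omega> - I \<omega>) - e * (cmod (I \<omega> - I \<omega>))\<^sup>2)"
          by (intro tendsto_intros elim)
        then show ?case by (simp add: h_def)
      qed
      show "AE \<omega> in M. norm (h q \<omega>) \<le> (cmod (F \<omega>))\<^sup>2 / (4 * e)" for q
        using h_le h0 by (intro AE_I2) simp
      show "h q \<in> borel_measurable M" for q by (rule hm)
    qed simp
    then have "(\<lambda>q. expectation (h q) + e * (4 * V)) \<longlonglongrightarrow> 0 + e * (4 * V)"
      by (intro tendsto_add) auto
    moreover have "E \<le> expectation (h q) + e * (4 * V)" for q
    proof -
      have sD: "square_integrable M (\<lambda>\<omega>. I \<omega> - W q \<omega>)" by (rule square_integrable_diff [OF sI W])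
      have "expectation (\<lambda>\<omega>. F \<omega> * cnj (I \<omega> - W q \<omega>))
          = expectation (\<lambda>\<omega>. F \<omega> * cnj (I \<omega>)) - expectation (\<lambda>\<omega>. F \<omega> * cnj (W q \<omega>))"
        unfolding complex_cnj_diff right_diff_distrib
        by (rule Bochner_Integration.integral_diff) (intro square_integrable_mult square_integrable_cnj F sI W)+
      then have "E = cmod (expectation (\<lambda>\<omega>. F \<omega> * cnj (I \<omega> - W q \<omega>)))" by (simp add: E_def 0)
      also have "\<dots> \<le> expectation (\<lambda>\<omega>. cmod (F \<omega> * cnj (I \<omega> - W q \<omega>)))"
        by (rule integral_norm_bound)
      also have "\<dots> \<le> expectation (\<lambda>\<omega>. h q \<omega> + e * (cmod (I \<omega> - W q \<omega>))\<^sup>2)"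
      proof (rule integral_mono)
        show "integrable M (\<lambda>\<omega>. cmod (F \<omega> * cnj (I \<omega> - W q \<omega>)))"
          by (intro integrable_norm square_integrable_mult square_integrable_cnj F sD)
        have "integrable M (h q)"
          by (rule Bochner_Integration.integrable_bound [OF Fi]) (use h_le h0 e hm in \<open>auto simp: abs_of_nonneg\<close>)
        then show "integrable M (\<lambda>\<omega>. h q \<omega> + e * (cmod (I \<omega> - W q \<omega>))\<^sup>2)"
          using sD by (intro Bochner_Integration.integrable_add integrable_mult_right) auto
        show "cmod (F \<omega> * cnj (I \<omega> - W q \<omega>)) \<le> h q \<omega> + e * (cmod (I \<omega> - W q \<omega>))\<^sup>2" for \<omega>
          unfolding norm_mult complex_mod_cnj h_def by (simp add: max_def)
      qed
      also have "\<dots> = expectation (h q) + e * expectation (\<lambda>\<omega>. (cmod (I \<omega> - W q \<omega>))\<^sup>2)"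
      proof -
        have "integrable M (h q)"
          by (rule Bochner_Integration.integrable_bound [OF Fi]) (use h_le h0 e hm in \<open>auto simp: abs_of_nonneg\<close>)
        then show ?thesis using sD by (subst Bochner_Integration.integral_add) auto
      qed
      also have "expectation (\<lambda>\<omega>. (cmod (I \<omega> - W q \<omega>))\<^sup>2) \<le> 4 * V"
      proof -
        have "expectation (\<lambda>\<omega>. (cmod (I \<omega> - W q \<omega>))\<^sup>2)
            \<le> expectation (\<lambda>\<omega>. 2 * (cmod (I \<omega>))\<^sup>2 + 2 * (cmod (W q \<omega>))\<^sup>2)"
          using sD W [of q] Ii norm_add_square_le [of "I _" "- W q _"]
          by (intro integral_mono) auto
        also have "\<dots> = 2 * expectation (\<lambda>\<omega>. (cmod (I \<omega>))\<^sup>2) + 2 * expectation (\<lambda>\<omega>. (cmod (W q \<omega>))\<^sup>2)"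
          using W [of q] Ii by (subst Bochner_Integration.integral_add) auto
        finally show ?thesis using V [of q] IV by linarith
      qed
      finally show ?thesis using e by (simp add: mult_left_mono)
    qed
    ultimately have "E \<le> 0 + e * (4 * V)"
      by (intro tendsto_lowerbound) (auto intro: always_eventually)
    then show ?thesis by simp
  qed
  have "E \<le> 0"
  proof (rule field_le_epsilon)
    fix d :: real assume d: "0 < d"
    \<comment> \<open>The summand 1 guards against \<open>V = 0\<close>.\<close>
    have "E \<le> d / (4 * V + 1) * (4 * V)" using d V0 by (intro bound) simp
    also have "\<dots> \<le> d" using d V0 by (simp add: field_simps)
    finally show "E \<le> 0 + d" by simp
  qed
  then show "expectation (\<lambda>\<omega>. F \<omega> * cnj (I \<omega>)) = 0" by (simp add: E_def)
qed

end

section \<open>Increments of fractional Brownian motion\<close>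

text \<open>Convexity of the power \<open>p \<ge> 1\<close>: increments over a fixed step grow. With
  \<open>p = 2 * H\<close> this is the source of the positive correlation of the noise, and here
  \<open>H \<ge> 1/2\<close> enters.\<close>

lemma powr_increment_mono:
  fixes p x y h :: real
  assumes "1 \<le> p" "0 \<le> x" "x \<le> y" "0 \<le> h"
  shows "(x + h) powr p - x powr p \<le> (y + h) powr p - y powr p"
proof (rule DERIV_nonneg_imp_increasing_open [OF assms(3)])
  fix z assume z: "x < z" "z < y"
  then have "0 < z" "0 < z + h" using assms by auto
  then have "((\<lambda>z. (z + h) powr p - z powr p) has_real_derivative p * (z + h) powr (p - 1) - p * z powr (p - 1)) (at z)"
    by (auto intro!: derivative_eq_intros)
  moreover have "p * z powr (p - 1) \<le> p * (z + h) powr (p - 1)"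
    using assms z by (intro mult_left_mono powr_mono2) auto
  ultimately show "\<exists>d. ((\<lambda>z. (z + h) powr p - z powr p) has_real_derivative d) (at z) \<and> 0 \<le> d"
    by (intro exI conjI) auto
next
  show "continuous_on {x..y} (\<lambda>z. (z + h) powr p - z powr p)"
    using assms by (intro continuous_on_diff continuous_on_powr' continuous_on_add continuous_on_id continuous_on_const) auto
qed

text \<open>Values in a real vector space allow the same sums for the complex process and for its
  real and imaginary parts; the weights will be kernel values at left endpoints.\<close>

definition increment_sum :: "(real \<Rightarrow> 'w \<Rightarrow> 'b::real_vector) \<Rightarrow> (nat \<Rightarrow> real) \<Rightarrow> (nat \<Rightarrow> real) \<Rightarrow> nat \<Rightarrow> 'w \<Rightarrow> 'b" where
  "increment_sum B w s N \<omega> = (\<Sum>i<N. w i *\<^sub>R (B (s (Suc i)) \<omega> - B (s i) \<omega>))"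

section \<open>Second moments of weighted sums of increments\<close>

context prob_space
begin

lemma expectation_sum_square:
  fixes f :: "'i \<Rightarrow> 'a \<Rightarrow> real"
  assumes "\<And>i. i \<in> I \<Longrightarrow> square_integrable M (f i)"
  shows "expectation (\<lambda>\<omega>. (\<Sum>i\<in>I. f i \<omega>)\<^sup>2) = (\<Sum>i\<in>I. \<Sum>j\<in>I. expectation (\<lambda>\<omega>. f i \<omega> * f j \<omega>))"
  unfolding power2_eq_square sum_product
  by (simp add: Bochner_Integration.integral_sum Bochner_Integration.integrable_sum square_integrable_mult assms)

lemma expectation_cmult_mult:
  "expectation (\<lambda>\<omega>. (w i * f i \<omega>) * (w j * f j \<omega>)) = w i * w j * expectation (\<lambda>\<omega>. f i \<omega> * f j \<omega>)" for w :: "'i \<Rightarrow> real"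
proof -
  have "expectation (\<lambda>\<omega>. (w i * f i \<omega>) * (w j * f j \<omega>)) = expectation (\<lambda>\<omega>. (w i * w j) * (f i \<omega> * f j \<omega>))"
    by (simp add: mult_ac)
  then show ?thesis by simp
qed

text \<open>With nonnegative covariances the quadratic form can only grow when every weight is
  replaced by \<open>G\<close>. For increments the sum with equal weights telescopes, which takes
  the place of an isometry for the stochastic integral.\<close>

lemma weighted_sum_square_le:
  fixes f :: "'i \<Rightarrow> 'a \<Rightarrow> real"
  assumes f: "\<And>i. i \<in> I \<Longrightarrow> square_integrable M (f i)"
    and cov: "\<And>i j. i \<in> I \<Longrightarrow> j \<in> I \<Longrightarrow> 0 \<le> expectation (\<lambda>\<omega>. f i \<omega> * f j \<omega>)"
    and w: "\<And>i. i \<in> I \<Longrightarrow> \<bar>w i\<bar> \<le> G"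
  shows "expectation (\<lambda>\<omega>. (\<Sum>i\<in>I. w i * f i \<omega>)\<^sup>2) \<le> G\<^sup>2 * expectation (\<lambda>\<omega>. (\<Sum>i\<in>I. f i \<omega>)\<^sup>2)"
proof -
  have "w i * w j * expectation (\<lambda>\<omega>. f i \<omega> * f j \<omega>) \<le> G\<^sup>2 * expectation (\<lambda>\<omega>. f i \<omega> * f j \<omega>)" if "i \<in> I" "j \<in> I" for i j
  proof (rule mult_right_mono [OF _ cov [OF that]])
    have "w i * w j \<le> \<bar>w i\<bar> * \<bar>w j\<bar>" by (metis abs_ge_self abs_mult)
    also have "\<dots> \<le> G * G" using w [OF that(1)] w [OF that(2)] by (intro mult_mono) auto
    finally show "w i * w j \<le> G\<^sup>2" by (simp add: power2_eq_square)
  qed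
  then show ?thesis
    by (simp add: expectation_sum_square f square_integrable_cmult expectation_cmult_mult sum_distrib_left sum_mono)
qed

lemma weighted_sum_square_ge:
  fixes f :: "'i \<Rightarrow> 'a \<Rightarrow> real"
  assumes f: "\<And>i. i \<in> I \<Longrightarrow> square_integrable M (f i)"
    and cov: "\<And>i j. i \<in> I \<Longrightarrow> j \<in> I \<Longrightarrow> 0 \<le> expectation (\<lambda>\<omega>. f i \<omega> * f j \<omega>)"
    and w: "\<And>i. i \<in> I \<Longrightarrow> g \<le> w i" and g: "0 \<le> g"
  shows "g\<^sup>2 * expectation (\<lambda>\<omega>. (\<Sum>i\<in>I. f i \<omega>)\<^sup>2) \<le> expectation (\<lambda>\<omega>. (\<Sum>i\<in>I. w i * f i \<omega>)\<^sup>2)"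
proof -
  have "g\<^sup>2 * expectation (\<lambda>\<omega>. f i \<omega> * f j \<omega>) \<le> w i * w j * expectation (\<lambda>\<omega>. f i \<omega> * f j \<omega>)" if "i \<in> I" "j \<in> I" for i j
    unfolding power2_eq_square
    using w [OF that(1)] w [OF that(2)] g by (intro mult_right_mono [OF _ cov [OF that]] mult_mono) auto
  then show ?thesis
    by (simp add: expectation_sum_square f square_integrable_cmult expectation_cmult_mult sum_distrib_left sum_mono)
qed

text \<open>\<open>real_fbm\<close> speaks of combinations over a set of times; the family
  \<open>s\<close> may repeat times, so the weights of equal times are collected first.\<close>

lemma fbm_linear_combination:
  assumes B: "real_fbm M H A B" and J: "finite J" "\<And>j. j \<in> J \<Longrightarrow> 0 \<le> s j"
  shows "centred_normal M (\<lambda>\<omega>. \<Sum>j\<in>J. w j * B (s j) \<omega>)"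
proof -
  define c where "c r = (\<Sum>j\<in>{j\<in>J. s j = r}. w j)" for r
  have "(\<Sum>j\<in>J. w j * B (s j) \<omega>) = (\<Sum>r\<in>s ` J. c r * B r \<omega>)" for \<omega>
    unfolding sum.image_gen [OF J(1), of _ s] c_def sum_distrib_right by (intro sum.cong refl) auto
  moreover have "centred_normal M (\<lambda>\<omega>. \<Sum>r\<in>s ` J. c r * B r \<omega>)"
    using B J unfolding real_fbm_def by (auto simp: image_subset_iff)
  ultimately show ?thesis by simp
qed

lemma fbm_increment_sum_normal:
  assumes B: "real_fbm M H A B" and s: "\<And>i. 0 \<le> s i"
  shows "centred_normal M (increment_sum B w s N)"
proof -
  \<comment> \<open>The pair \<open>(i, True)\<close> stands for the right endpoint of increment
    \<open>i\<close> with weight \<open>w i\<close>, and \<open>(i, False)\<close> for the left one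
    with weight \<open>- w i\<close>.\<close>
  let ?J = "{..<N} \<times> (UNIV :: bool set)"
  let ?s = "\<lambda>(i, b). if b then s (Suc i) else s i"
  let ?w = "\<lambda>(i, b). if b then w i else - w i"
  have "increment_sum B w s N \<omega> = (\<Sum>j\<in>?J. ?w j * B (?s j) \<omega>)" for \<omega>
  proof -
    have "(\<Sum>j\<in>?J. ?w j * B (?s j) \<omega>) = (\<Sum>i<N. \<Sum>b\<in>UNIV. ?w (i, b) * B (?s (i, b)) \<omega>)"
      unfolding sum.cartesian_product by (intro sum.cong refl) auto
    then show ?thesis by (simp add: increment_sum_def UNIV_bool algebra_simps)
  qed
  moreover have "centred_normal M (\<lambda>\<omega>. \<Sum>j\<in>?J. ?w j * B (?s j) \<omega>)"
    by (rule fbm_linear_combination [OF B]) (use s in auto)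
  ultimately show ?thesis by (simp add: increment_sum_def [abs_def])
qed

lemma fbm_square_integrable: "real_fbm M H A B \<Longrightarrow> 0 \<le> s \<Longrightarrow> square_integrable M (B s)"
  using fbm_linear_combination [of H A B "{()}" "\<lambda>_. s" "\<lambda>_. 1"] centred_normal_square_integrable by simp

lemma fbm_expectation: "real_fbm M H A B \<Longrightarrow> 0 \<le> s \<Longrightarrow> expectation (B s) = 0"
  using fbm_linear_combination [of H A B "{()}" "\<lambda>_. s" "\<lambda>_. 1"] centred_normal_square_integrable by simp

lemma fbm_increment_variance:
  "real_fbm M H A B \<Longrightarrow> 0 \<le> s \<Longrightarrow> 0 \<le> t \<Longrightarrow> expectation (\<lambda>\<omega>. (B t \<omega> - B s \<omega>)\<^sup>2) = A * \<bar>t - s\<bar> powr (2 * H)"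
  by (simp add: real_fbm_def)

lemma fbm_variance_nonneg:
  assumes "real_fbm M H A B" shows "0 \<le> A"
proof -
  have "0 \<le> expectation (\<lambda>\<omega>. (B 1 \<omega> - B 0 \<omega>)\<^sup>2)" by simp
  then show ?thesis using fbm_increment_variance [OF assms, of 0 1] by simp
qed

text \<open>Polarisation expresses the covariance by the variances of four increments, and the
  convexity of \<open>\<lambda>u. u powr (2 * H)\<close> decides the sign.\<close>

lemma fbm_increment_covariance_nonneg:
  assumes B: "real_fbm M H A B" and H: "1/2 \<le> H" and ord: "0 \<le> a" "a \<le> b" "b \<le> c" "c \<le> d"
  shows "0 \<le> expectation (\<lambda>\<omega>. (B b \<omega> - B a \<omega>) * (B d \<omega> - B c \<omega>))"
proof -
  have si: "integrable M (\<lambda>\<omega>. (B v \<omega> - B u \<omega>)\<^sup>2)" if "0 \<le> u" "0 \<le> v" for u v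
    using square_integrableD(2) [OF square_integrable_diff [OF fbm_square_integrable [OF B that(2)] fbm_square_integrable [OF B that(1)]]]
    by simp
  have pol: "(B b \<omega> - B a \<omega>) * (B d \<omega> - B c \<omega>)
      = ((B d \<omega> - B a \<omega>)\<^sup>2 + (B c \<omega> - B b \<omega>)\<^sup>2 - (B c \<omega> - B a \<omega>)\<^sup>2 - (B d \<omega> - B b \<omega>)\<^sup>2) / 2" for \<omega>
    by (simp add: power2_eq_square field_simps)
  have "expectation (\<lambda>\<omega>. (B b \<omega> - B a \<omega>) * (B d \<omega> - B c \<omega>))
      = (A * (d - a) powr (2 * H) + A * (c - b) powr (2 * H) - A * (c - a) powr (2 * H) - A * (d - b) powr (2 * H)) / 2"
    unfolding pol using ord
    by (simp add: si fbm_increment_variance [OF B])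
  moreover have "((c - b) + (d - c)) powr (2 * H) - (c - b) powr (2 * H) \<le> ((c - a) + (d - c)) powr (2 * H) - (c - a) powr (2 * H)"
    using H ord by (intro powr_increment_mono) auto
  then have "A * (d - b) powr (2 * H) - A * (c - b) powr (2 * H) \<le> A * (d - a) powr (2 * H) - A * (c - a) powr (2 * H)"
    using fbm_variance_nonneg [OF B] by (simp add: mult_left_mono flip: right_diff_distrib)
  ultimately show ?thesis by simp
qed

lemma fbm_grid_covariance_nonneg:
  assumes B: "real_fbm M H A B" and H: "1/2 \<le> H" and s: "mono s" "0 \<le> s 0"
  shows "0 \<le> expectation (\<lambda>\<omega>. (B (s (Suc i)) \<omega> - B (s i) \<omega>) * (B (s (Suc j)) \<omega> - B (s j) \<omega>))" (is "0 \<le> ?c i j")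
proof -
  have s0: "0 \<le> s i" for i using s monoD [OF s(1), of 0 i] by simp
  have less: "0 \<le> ?c i j" if "i < j" for i j
    using that monoD [OF s(1)] s0 by (intro fbm_increment_covariance_nonneg [OF B H]) auto
  consider "i < j" | "j < i" | "i = j" by linarith
  then show ?thesis
  proof cases
    case 2
    then show ?thesis using less [of j i] by (simp add: mult.commute)
  qed (use less in simp_all)
qed

lemma fbm_increment_square_integrable:
  "real_fbm M H A B \<Longrightarrow> 0 \<le> s \<Longrightarrow> 0 \<le> t \<Longrightarrow> square_integrable M (\<lambda>\<omega>. B t \<omega> - B s \<omega>)"
  by (intro square_integrable_diff fbm_square_integrable)

lemma fbm_block_telescope:
  assumes B: "real_fbm M H A B" and s: "mono s" "0 \<le> s 0" and mn: "m \<le> n"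
  shows "expectation (\<lambda>\<omega>. (\<Sum>i\<in>{m..<n}. B (s (Suc i)) \<omega> - B (s i) \<omega>)\<^sup>2) = A * (s n - s m) powr (2 * H)"
proof -
  have s0: "0 \<le> s i" for i using s monoD [OF s(1), of 0 i] by simp
  have "(\<Sum>i\<in>{m..<n}. B (s (Suc i)) \<omega> - B (s i) \<omega>) = B (s n) \<omega> - B (s m) \<omega>" for \<omega>
    by (rule sum_Suc_diff' [OF mn])
  moreover have "\<bar>s n - s m\<bar> = s n - s m" using monoD [OF s(1) mn] by simp
  ultimately show ?thesis using fbm_increment_variance [OF B s0 s0, of n m] by simp
qed

lemma increment_sum_blocks:
  "increment_sum B w s (k * n) \<omega> = (\<Sum>j<k. \<Sum>i\<in>{j*n..<j*n+n}. w i * (B (s (Suc i)) \<omega> - B (s i) \<omega>))"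
  for B :: "real \<Rightarrow> 'a \<Rightarrow> real"
  unfolding increment_sum_def by (simp add: sum.nat_group [symmetric])

text \<open>Blocks may be correlated, so their variances cannot simply be added; Cauchy-Schwarz with
  the weights \<open>\<rho> ^ j\<close> leaves a geometric series in each of its two
  factors.\<close>

lemma geometric_block_sum_le:
  fixes R :: "nat \<Rightarrow> 'a \<Rightarrow> real"
  assumes R: "\<And>j. square_integrable M (R j)" and V: "\<And>j. expectation (\<lambda>\<omega>. (R j \<omega>)\<^sup>2) \<le> V * (\<rho> ^ j)\<^sup>2"
    and \<rho>: "0 < \<rho>" "\<rho> < 1" and V0: "0 \<le> V"
  shows "expectation (\<lambda>\<omega>. (\<Sum>j<k. R j \<omega>)\<^sup>2) \<le> V / (1 - \<rho>)\<^sup>2"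
proof -
  have geo: "(\<Sum>j<k. \<rho> ^ j) \<le> 1 / (1 - \<rho>)"
    using sum_le_suminf [of "\<lambda>j. \<rho> ^ j" "{..<k}"] \<rho> by (simp add: summable_geometric suminf_geometric)
  have g0: "0 \<le> (\<Sum>j<k. \<rho> ^ j)" using \<rho> by (intro sum_nonneg) auto
  have pt: "(\<Sum>j<k. R j \<omega>)\<^sup>2 \<le> (\<Sum>j<k. \<rho> ^ j) * (\<Sum>j<k. (R j \<omega>)\<^sup>2 / \<rho> ^ j)" for \<omega>
  proof -
    have "(\<Sum>j<k. sqrt (\<rho> ^ j) * (R j \<omega> / sqrt (\<rho> ^ j)))\<^sup>2
        \<le> (\<Sum>j<k. (sqrt (\<rho> ^ j))\<^sup>2) * (\<Sum>j<k. (R j \<omega> / sqrt (\<rho> ^ j))\<^sup>2)"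
      by (rule Cauchy_Schwarz_ineq_sum)
    then show ?thesis using \<rho> by (simp add: power_divide)
  qed
  have Ri: "integrable M (\<lambda>\<omega>. (R j \<omega>)\<^sup>2)" for j using square_integrableD(2) [OF R] by simp
  have "expectation (\<lambda>\<omega>. (\<Sum>j<k. R j \<omega>)\<^sup>2) \<le> expectation (\<lambda>\<omega>. (\<Sum>j<k. \<rho> ^ j) * (\<Sum>j<k. (R j \<omega>)\<^sup>2 / \<rho> ^ j))"
  proof (rule integral_mono [OF _ _ pt])
    show "integrable M (\<lambda>\<omega>. (\<Sum>j<k. R j \<omega>)\<^sup>2)"
      using square_integrableD(2) [OF square_integrable_sum [of "{..<k}", OF R]] by simp
    show "integrable M (\<lambda>\<omega>. (\<Sum>j<k. \<rho> ^ j) * (\<Sum>j<k. (R j \<omega>)\<^sup>2 / \<rho> ^ j))"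
      by (intro integrable_mult_right Bochner_Integration.integrable_sum integrable_divide_zero Ri)
  qed
  also have "\<dots> = (\<Sum>j<k. \<rho> ^ j) * (\<Sum>j<k. expectation (\<lambda>\<omega>. (R j \<omega>)\<^sup>2) / \<rho> ^ j)"
    by (simp add: Bochner_Integration.integral_sum Ri)
  also have "\<dots> \<le> (\<Sum>j<k. \<rho> ^ j) * (\<Sum>j<k. V * \<rho> ^ j)"
  proof (intro mult_left_mono sum_mono g0)
    fix j
    have "expectation (\<lambda>\<omega>. (R j \<omega>)\<^sup>2) / \<rho> ^ j \<le> V * (\<rho> ^ j)\<^sup>2 / \<rho> ^ j"
      using V \<rho> by (intro divide_right_mono) auto
    then show "expectation (\<lambda>\<omega>. (R j \<omega>)\<^sup>2) / \<rho> ^ j \<le> V * \<rho> ^ j"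
      using \<rho> by (simp add: power2_eq_square)
  qed
  also have "\<dots> = V * ((\<Sum>j<k. \<rho> ^ j) * (\<Sum>j<k. \<rho> ^ j))"
    by (simp add: sum_distrib_left [symmetric])
  also have "\<dots> \<le> V * ((1 / (1 - \<rho>)) * (1 / (1 - \<rho>)))"
    using V0 geo g0 \<rho> by (intro mult_left_mono mult_mono) auto
  finally show ?thesis by (simp add: power2_eq_square)
qed

text \<open>The off-diagonal covariances of the expanded square are nonnegative and are
  dropped.\<close>

lemma sum_square_ge_blocks:
  fixes R :: "nat \<Rightarrow> 'a \<Rightarrow> real"
  assumes R: "\<And>j. j < k \<Longrightarrow> square_integrable M (R j)"
    and cov: "\<And>i j. i < k \<Longrightarrow> j < k \<Longrightarrow> 0 \<le> expectation (\<lambda>\<omega>. R i \<omega> * R j \<omega>)"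
  shows "(\<Sum>j<k. expectation (\<lambda>\<omega>. (R j \<omega>)\<^sup>2)) \<le> expectation (\<lambda>\<omega>. (\<Sum>j<k. R j \<omega>)\<^sup>2)"
proof -
  have "expectation (\<lambda>\<omega>. (R j \<omega>)\<^sup>2) \<le> (\<Sum>i<k. expectation (\<lambda>\<omega>. R j \<omega> * R i \<omega>))" if "j < k" for j
    using member_le_sum [of j "{..<k}" "\<lambda>i. expectation (\<lambda>\<omega>. R j \<omega> * R i \<omega>)"] cov that
    by (simp add: power2_eq_square)
  then have "(\<Sum>j<k. expectation (\<lambda>\<omega>. (R j \<omega>)\<^sup>2)) \<le> (\<Sum>j<k. \<Sum>i<k. expectation (\<lambda>\<omega>. R j \<omega> * R i \<omega>))"
    by (intro sum_mono) auto
  then show ?thesis using R by (subst expectation_sum_square) auto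
qed

end

text \<open>The upper bound is free of \<open>c\<close>, so that later constants are uniform in the
  degree. In the lower bound the condition on \<open>r\<close> makes the correction
  \<open>z / Gamma (2 * \<beta>)\<close> at most half of the leading term
  \<open>1 / Gamma \<beta>\<close>.\<close>

lemma
  assumes b: "0 < \<beta>" "\<beta> \<le> 1" and c: "0 \<le> c" and s: "s < t"
  shows noise_kernel_nonneg: "0 \<le> noise_kernel \<beta> c t s"
    and noise_kernel_le: "0 < r \<Longrightarrow> r \<le> t - s \<Longrightarrow> noise_kernel \<beta> c t s \<le> r powr (\<beta> - 1) / Gamma \<beta>"
    and noise_kernel_ge: "t - s \<le> r \<Longrightarrow> r powr \<beta> * c \<le> Gamma (2 * \<beta>) / (2 * Gamma \<beta>) \<Longrightarrow>
      r powr (\<beta> - 1) / (2 * Gamma \<beta>) \<le> noise_kernel \<beta> c t s"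
proof -
  define z where "z = (t - s) powr \<beta> * c"
  have z: "0 \<le> z" using c by (simp add: z_def)
  have nk: "noise_kernel \<beta> c t s = (t - s) powr (\<beta> - 1) * mittag_leffler \<beta> \<beta> (- z)"
    by (simp add: noise_kernel_def z_def)
  show n0: "0 \<le> noise_kernel \<beta> c t s"
    unfolding nk using mittag_leffler_diag_nonneg [OF b z] by simp
  have G: "0 < Gamma \<beta>" "0 < Gamma (2 * \<beta>)" using b by (auto intro!: Gamma_real_pos)
  show "noise_kernel \<beta> c t s \<le> r powr (\<beta> - 1) / Gamma \<beta>" if "0 < r" "r \<le> t - s"
  proof -
    have "(t - s) powr (\<beta> - 1) * mittag_leffler \<beta> \<beta> (- z) \<le> r powr (\<beta> - 1) * (1 / Gamma \<beta>)"
      using that b mittag_leffler_diag_nonneg [OF b z] mittag_leffler_diag_le [OF b z] by (intro mult_mono powr_mono2') auto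
    then show ?thesis by (simp add: nk)
  qed
  show "r powr (\<beta> - 1) / (2 * Gamma \<beta>) \<le> noise_kernel \<beta> c t s"
    if "t - s \<le> r" "r powr \<beta> * c \<le> Gamma (2 * \<beta>) / (2 * Gamma \<beta>)"
  proof -
    have "z \<le> r powr \<beta> * c" unfolding z_def using that s b c by (intro mult_right_mono powr_mono2) auto
    then have "z / Gamma (2 * \<beta>) \<le> 1 / (2 * Gamma \<beta>)"
    proof -
      have "z * (2 * Gamma \<beta>) \<le> Gamma (2 * \<beta>) / (2 * Gamma \<beta>) * (2 * Gamma \<beta>)"
        using \<open>z \<le> r powr \<beta> * c\<close> that(2) G by (intro mult_right_mono) auto
      then show ?thesis using G by (simp add: field_simps)
    qed
    then have "1 / (2 * Gamma \<beta>) \<le> mittag_leffler \<beta> \<beta> (- z)"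
      using mittag_leffler_diag_ge [OF b z] by simp
    then have "r powr (\<beta> - 1) * (1 / (2 * Gamma \<beta>)) \<le> (t - s) powr (\<beta> - 1) * mittag_leffler \<beta> \<beta> (- z)"
      using that b s G by (intro mult_mono powr_mono2') auto
    then show ?thesis by (simp add: nk)
  qed
qed

text \<open>Grid points accumulating geometrically at \<open>t\<close>: each of the blocks of \<open>n\<close> consecutive intervals
  halves the distance to the singularity of the kernel.\<close>
definition grid :: "real \<Rightarrow> nat \<Rightarrow> nat \<Rightarrow> real" where
  "grid t n m = t * (1 - 2 powr (- (real m / real n)))"

lemma grid_0 [simp]: "grid t n 0 = 0" by (simp add: grid_def)

lemma grid_strict_mono:
  assumes "0 < t" "0 < n" shows "strict_mono (grid t n)"
proof (rule strict_monoI)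
  fix i j :: nat assume "i < j"
  then have "2 powr (- (real j / real n)) < 2 powr (- (real i / real n))"
    using assms by (intro powr_less_mono) (auto simp: divide_strict_right_mono)
  then show "grid t n i < grid t n j" using assms by (simp add: grid_def)
qed

lemma grid_mono: "0 < t \<Longrightarrow> 0 < n \<Longrightarrow> mono (grid t n)"
  by (simp add: grid_strict_mono strict_mono_mono)

lemma grid_nonneg: "0 < t \<Longrightarrow> 0 < n \<Longrightarrow> 0 \<le> grid t n m"
  using monoD [OF grid_mono, of t n 0 m] by simp

lemma grid_block: "0 < n \<Longrightarrow> grid t n (j * n) = t * (1 - (1/2) ^ j)"
  by (simp add: grid_def powr_minus powr_realpow power_one_over inverse_eq_divide)

lemma grid_less: "0 < t \<Longrightarrow> grid t n m < t"
  by (simp add: grid_def right_diff_distrib)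

text \<open>Steps shrink towards \<open>t\<close>, so the first one bounds the mesh, uniformly in
  the number of blocks.\<close>

lemma grid_step_le:
  assumes "0 < t" "0 < n" shows "grid t n (Suc i) - grid t n i \<le> t * (1 - 2 powr (- (1 / real n)))"
proof -
  have "grid t n (Suc i) - grid t n i = t * (2 powr (- (real i / real n)) * (1 - 2 powr (- (1 / real n))))"
    by (simp add: grid_def algebra_simps add_divide_distrib powr_add [symmetric])
  also have "\<dots> \<le> t * (1 * (1 - 2 powr (- (1 / real n))))"
  proof (intro mult_left_mono mult_right_mono)
    show "2 powr (- (real i / real n)) \<le> 1" by (simp add: powr_minus field_simps ge_one_powr_ge_zero)
    show "0 \<le> 1 - 2 powr (- (1 / real n))" by (simp add: powr_minus field_simps ge_one_powr_ge_zero)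
  qed (use assms in auto)
  finally show ?thesis by simp
qed

section \<open>Variance of the noise over dyadic blocks\<close>

context prob_space
begin

lemma fbm_block_square_integrable:
  assumes B: "real_fbm M H A B" and s: "\<And>i. 0 \<le> s i"
  shows "square_integrable M (\<lambda>\<omega>. \<Sum>i\<in>I. w i * (B (s (Suc i)) \<omega> - B (s i) \<omega>))"
  by (intro square_integrable_sum square_integrable_cmult fbm_increment_square_integrable [OF B] s)

lemma increment_sum_square_integrable:
  assumes "real_fbm M H A B" "\<And>i. 0 \<le> s i" shows "square_integrable M (increment_sum B w s N)"
  by (rule centred_normal_square_integrable(1) [OF fbm_increment_sum_normal [OF assms]])

text \<open>Every weight is at most the sum of all absolute weights, and the telescoped variance
  carries the factor \<open>A = 0\<close>. This provides the bound by a multiple of \<open>A\<close>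
  when \<open>\<beta> + H \<le> 1\<close>.\<close>

lemma increment_sum_degenerate:
  assumes B: "real_fbm M H 0 B" and H: "1/2 \<le> H" and s: "mono s" "0 \<le> s 0"
  shows "expectation (\<lambda>\<omega>. (increment_sum B w s N \<omega>)\<^sup>2) \<le> 0"
proof -
  have s0: "0 \<le> s i" for i using s monoD [OF s(1), of 0 i] by simp
  have "expectation (\<lambda>\<omega>. (\<Sum>i\<in>{0..<N}. w i * (B (s (Suc i)) \<omega> - B (s i) \<omega>))\<^sup>2)
      \<le> (\<Sum>i\<in>{0..<N}. \<bar>w i\<bar>)\<^sup>2 * expectation (\<lambda>\<omega>. (\<Sum>i\<in>{0..<N}. B (s (Suc i)) \<omega> - B (s i) \<omega>)\<^sup>2)"
    by (intro weighted_sum_square_le fbm_increment_square_integrable [OF B] s0 fbm_grid_covariance_nonneg [OF B H s] member_le_sum) auto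
  then show ?thesis
    using fbm_block_telescope [OF B s, of 0 N] by (simp add: increment_sum_def atLeast0LessThan)
qed

text \<open>On a block the kernel is at most a multiple of \<open>r powr (\<beta> - 1)\<close> and
  the increment has variance \<open>A * r powr (2 * H)\<close>, where \<open>r\<close> halves from
  block to block; hence the ratio \<open>(1/2) powr (\<beta> + H - 1)\<close>. The bound depends
  neither on the grid nor on \<open>c\<close>.\<close>

lemma noise_grid_variance_le:
  assumes B: "real_fbm M H A B" and H: "1/2 \<le> H" and b: "0 < \<beta>" "\<beta> \<le> 1" and bH: "1 < \<beta> + H"
    and c: "0 \<le> c" and t: "0 < t" and n: "0 < n"
  shows "expectation (\<lambda>\<omega>. (increment_sum B (\<lambda>i. noise_kernel \<beta> c t (grid t n i)) (grid t n) (k * n) \<omega>)\<^sup>2)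
    \<le> A * ((t / 2) powr (2 * (\<beta> + H - 1)) / (Gamma \<beta>)\<^sup>2 / (1 - (1/2) powr (\<beta> + H - 1))\<^sup>2)"
proof -
  let ?s = "grid t n" and ?w = "\<lambda>i. noise_kernel \<beta> c t (grid t n i)"
  define \<theta> where "\<theta> = \<beta> + H - 1"
  have th: "0 < \<theta>" using bH by (simp add: \<theta>_def)
  define R where "R j \<omega> = (\<Sum>i\<in>{j*n..<j*n+n}. ?w i * (B (?s (Suc i)) \<omega> - B (?s i) \<omega>))" for j \<omega>
  note s = grid_mono [OF t n] grid_nonneg [OF t n, of 0]
  have G: "0 < Gamma \<beta>" using b by (intro Gamma_real_pos) auto
  have A: "0 \<le> A" by (rule fbm_variance_nonneg [OF B])
  have "expectation (\<lambda>\<omega>. (R j \<omega>)\<^sup>2) \<le> A * ((t / 2) powr (2 * \<theta>) / (Gamma \<beta>)\<^sup>2) * (((1/2) powr \<theta>) ^ j)\<^sup>2" for j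
  proof -
    \<comment> \<open>The block reaches from \<open>t - 2 * r\<close> to \<open>t - r\<close>:
      \<open>r\<close> is its length and also its smallest distance to \<open>t\<close>, where the
      kernel bound is largest.\<close>
    define r where "r = t / 2 * (1/2) ^ j"
    have r: "0 < r" using t by (simp add: r_def)
    have step: "?s (j * n + n) - ?s (j * n) = r"
      using grid_block [OF n, of t "Suc j"] grid_block [OF n, of t j] by (simp add: r_def algebra_simps)
    have "\<bar>?w i\<bar> \<le> r powr (\<beta> - 1) / Gamma \<beta>" if i: "i \<in> {j*n..<j*n+n}" for i
    proof -
      have "?s i \<le> ?s (Suc j * n)" using i by (intro monoD [OF s(1)]) auto
      also have "\<dots> = t - r" using grid_block [OF n, of t "Suc j"] by (simp add: r_def algebra_simps)
      finally have "r \<le> t - ?s i" by simp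
      then have "?w i \<le> r powr (\<beta> - 1) / Gamma \<beta>" by (rule noise_kernel_le [OF b c grid_less [OF t] r])
      then show ?thesis using noise_kernel_nonneg [OF b c grid_less [OF t]] by simp
    qed
    then have "expectation (\<lambda>\<omega>. (R j \<omega>)\<^sup>2) \<le> (r powr (\<beta> - 1) / Gamma \<beta>)\<^sup>2
        * expectation (\<lambda>\<omega>. (\<Sum>i\<in>{j*n..<j*n+n}. B (?s (Suc i)) \<omega> - B (?s i) \<omega>)\<^sup>2)"
      unfolding R_def
      by (intro weighted_sum_square_le fbm_increment_square_integrable [OF B] grid_nonneg t n fbm_grid_covariance_nonneg [OF B H s])
    also have "\<dots> = (r powr (\<beta> - 1) / Gamma \<beta>)\<^sup>2 * (A * r powr (2 * H))"
      using fbm_block_telescope [OF B s, of "j * n" "j * n + n"] by (simp add: step)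
    also have "\<dots> = A / (Gamma \<beta>)\<^sup>2 * (r powr (\<beta> - 1) * r powr (\<beta> - 1) * r powr (2 * H))"
      by (simp add: power2_eq_square)
    also have "r powr (\<beta> - 1) * r powr (\<beta> - 1) * r powr (2 * H) = r powr (2 * \<theta>)"
      by (simp add: \<theta>_def powr_add [symmetric] algebra_simps)
    also have "r powr (2 * \<theta>) = (t / 2) powr (2 * \<theta>) * (((1/2) powr \<theta>) ^ j)\<^sup>2"
    proof -
      have "((1/2) ^ j) powr (2 * \<theta>) = (((1/2) powr \<theta>) ^ j)\<^sup>2"
        by (simp add: powr_realpow [symmetric] powr_powr mult_ac)
      then show ?thesis using t by (simp only: r_def powr_mult)
    qed
    finally show ?thesis by (simp add: mult_ac)
  qed
  then have "expectation (\<lambda>\<omega>. (\<Sum>j<k. R j \<omega>)\<^sup>2) \<le> A * ((t / 2) powr (2 * \<theta>) / (Gamma \<beta>)\<^sup>2) / (1 - (1/2) powr \<theta>)\<^sup>2"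
  proof (rule geometric_block_sum_le [rotated])
    show "(1/2) powr \<theta> < 1" using powr_less_mono2 [of \<theta> "1/2" 1] th by simp
    show "square_integrable M (R j)" for j
      unfolding R_def [abs_def] by (rule fbm_block_square_integrable [OF B grid_nonneg [OF t n]])
  qed (use A in auto)
  then show ?thesis by (simp add: increment_sum_blocks R_def \<theta>_def)
qed

text \<open>For \<open>\<beta> + H \<le> 1\<close> the contributions of the blocks do not decay
  towards \<open>t\<close>: from \<open>j0\<close> on each is at least \<open>A * \<kappa>\<close>,
  and nonnegative correlation lets them add up. The bound grows linearly in the number
  \<open>k\<close> of blocks, whatever the \<open>n\<close>.\<close>

lemma noise_grid_variance_ge:
  assumes B: "real_fbm M H A B" and H: "1/2 \<le> H" and b: "0 < \<beta>" "\<beta> \<le> 1" and bH: "\<beta> + H \<le> 1"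
    and c: "0 \<le> c" and t: "0 < t"
  obtains j0 :: nat and \<kappa> where "0 < \<kappa>" and
    "\<And>k n. 0 < n \<Longrightarrow> A * \<kappa> * (real k - real j0) \<le>
      expectation (\<lambda>\<omega>. (increment_sum B (\<lambda>i. noise_kernel \<beta> c t (grid t n i)) (grid t n) (k * n) \<omega>)\<^sup>2)"
proof -
  have G: "0 < Gamma \<beta>" "0 < Gamma (2 * \<beta>)" using b by (auto intro!: Gamma_real_pos)
  have A: "0 \<le> A" by (rule fbm_variance_nonneg [OF B])
  define d where "d = Gamma (2 * \<beta>) / (2 * Gamma \<beta>)"
  have d: "0 < d" using G by (simp add: d_def)
  have "(\<lambda>j. (t * (1/2) ^ j) powr \<beta> * c) \<longlonglongrightarrow> 0"
  proof -
    have "(\<lambda>j. (t * (1/2) ^ j)) \<longlonglongrightarrow> t * 0" by (intro tendsto_mult tendsto_const LIMSEQ_power_zero) auto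
    then have "(\<lambda>j. (t * (1/2) ^ j) powr \<beta>) \<longlonglongrightarrow> 0 powr \<beta>"
      using b t by (intro tendsto_powr') auto
    then have "(\<lambda>j. (t * (1/2) ^ j) powr \<beta> * c) \<longlonglongrightarrow> 0 powr \<beta> * c" by (intro tendsto_mult tendsto_const)
    then show ?thesis by simp
  qed
  then have "\<forall>\<^sub>F j in sequentially. (t * (1/2) ^ j) powr \<beta> * c < d"
    using d by (rule order_tendstoD)
  \<comment> \<open>From the block \<open>j0\<close> on the Mittag-Leffler factor is at least half
    its value at 0, by the condition in \<open>noise_kernel_ge\<close>.\<close>
  then obtain j0 where j0: "\<And>j. j0 \<le> j \<Longrightarrow> (t * (1/2) ^ j) powr \<beta> * c < d"
    unfolding eventually_sequentially by blast
  define \<theta> where "\<theta> = \<beta> + H - 1"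
  \<comment> \<open>The bound for one block, the square of
    \<open>r powr (\<beta> - 1) / (2 * Gamma \<beta>)\<close> times
    \<open>(r / 2) powr (2 * H)\<close>, evaluated at \<open>r = t\<close>. Since
    \<open>\<theta> \<le> 0\<close>, a smaller \<open>r\<close> cannot decrease it.\<close>
  define \<kappa> where "\<kappa> = t powr (2 * \<theta>) * (1/2) powr (2 * H) / (4 * (Gamma \<beta>)\<^sup>2)"
  have kap: "0 < \<kappa>" using t G by (simp add: \<kappa>_def)
  show thesis
  proof (rule that [OF kap])
    fix k n :: nat assume n: "0 < n"
    let ?s = "grid t n" and ?w = "\<lambda>i. noise_kernel \<beta> c t (grid t n i)"
    note s = grid_mono [OF t n] grid_nonneg [OF t n, of 0]
    define R where "R j \<omega> = (\<Sum>i\<in>{j*n..<j*n+n}. ?w i * (B (?s (Suc i)) \<omega> - B (?s i) \<omega>))" for j \<omega>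
    have R: "square_integrable M (R j)" for j
      unfolding R_def [abs_def] by (rule fbm_block_square_integrable [OF B grid_nonneg [OF t n]])
    have w0: "0 \<le> ?w i" for i by (rule noise_kernel_nonneg [OF b c grid_less [OF t]])
    have inc: "square_integrable M (\<lambda>\<omega>. B (?s (Suc i)) \<omega> - B (?s i) \<omega>)" for i
      by (intro fbm_increment_square_integrable [OF B] grid_nonneg t n)
    have cov: "0 \<le> expectation (\<lambda>\<omega>. R i \<omega> * R j \<omega>)" for i j
    proof -
      have "expectation (\<lambda>\<omega>. R i \<omega> * R j \<omega>) = (\<Sum>p\<in>{i*n..<i*n+n}. \<Sum>q\<in>{j*n..<j*n+n}.
          expectation (\<lambda>\<omega>. (?w p * (B (?s (Suc p)) \<omega> - B (?s p) \<omega>)) * (?w q * (B (?s (Suc q)) \<omega> - B (?s q) \<omega>))))"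
        unfolding R_def sum_product
        by (subst Bochner_Integration.integral_sum | intro sum.cong refl Bochner_Integration.integrable_sum
          square_integrable_mult square_integrable_cmult inc)+
      also have "\<dots> = (\<Sum>p\<in>{i*n..<i*n+n}. \<Sum>q\<in>{j*n..<j*n+n}.
          ?w p * ?w q * expectation (\<lambda>\<omega>. (B (?s (Suc p)) \<omega> - B (?s p) \<omega>) * (B (?s (Suc q)) \<omega> - B (?s q) \<omega>)))"
        by (intro sum.cong refl expectation_cmult_mult)
      also have "\<dots> \<ge> 0"
        by (intro sum_nonneg mult_nonneg_nonneg w0 fbm_grid_covariance_nonneg [OF B H s])
      finally show ?thesis .
    qed
    have lower: "A * \<kappa> \<le> expectation (\<lambda>\<omega>. (R j \<omega>)\<^sup>2)" if j: "j0 \<le> j" for j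
    proof -
      \<comment> \<open>Here \<open>r\<close> is the largest distance to \<open>t\<close> in the
        block, whose length is \<open>r / 2\<close>, because the kernel is now bounded from
        below.\<close>
      define r where "r = t * (1/2) ^ j"
      have r: "0 < r" "r \<le> t" using t by (auto simp: r_def power_le_one)
      have step: "?s (j * n + n) - ?s (j * n) = r * (1/2)"
        using grid_block [OF n, of t "Suc j"] grid_block [OF n, of t j] by (simp add: r_def algebra_simps)
      have w: "r powr (\<beta> - 1) / (2 * Gamma \<beta>) \<le> ?w i" if i: "i \<in> {j*n..<j*n+n}" for i
      proof (rule noise_kernel_ge [OF b c grid_less [OF t]])
        have "t - r = ?s (j * n)" using grid_block [OF n, of t j] by (simp add: r_def algebra_simps)
        also have "\<dots> \<le> ?s i" using i by (intro monoD [OF s(1)]) auto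
        finally show "t - ?s i \<le> r" by simp
        show "r powr \<beta> * c \<le> Gamma (2 * \<beta>) / (2 * Gamma \<beta>)" using j0 [OF j] by (simp add: r_def d_def)
      qed
      have "r powr (2 * \<theta>) \<ge> t powr (2 * \<theta>)"
        using r bH by (intro powr_mono2') (auto simp: \<theta>_def)
      then have "A * \<kappa> \<le> A * (r powr (2 * \<theta>) * (1/2) powr (2 * H) / (4 * (Gamma \<beta>)\<^sup>2))"
        unfolding \<kappa>_def using A by (intro mult_left_mono divide_right_mono mult_right_mono) auto
      also have "r powr (2 * \<theta>) = r powr (\<beta> - 1) * r powr (\<beta> - 1) * r powr (2 * H)"
        by (simp add: \<theta>_def powr_add [symmetric] algebra_simps)
      also have "A * (r powr (\<beta> - 1) * r powr (\<beta> - 1) * r powr (2 * H) * (1/2) powr (2 * H) / (4 * (Gamma \<beta>)\<^sup>2))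
          = (r powr (\<beta> - 1) / (2 * Gamma \<beta>))\<^sup>2 * (A * (r * (1/2)) powr (2 * H))"
        using r by (simp only: powr_mult) (simp add: power2_eq_square)
      also have "\<dots> = (r powr (\<beta> - 1) / (2 * Gamma \<beta>))\<^sup>2
          * expectation (\<lambda>\<omega>. (\<Sum>i\<in>{j*n..<j*n+n}. B (?s (Suc i)) \<omega> - B (?s i) \<omega>)\<^sup>2)"
        using fbm_block_telescope [OF B s, of "j * n" "j * n + n"] by (simp only: step)
      also have "\<dots> \<le> expectation (\<lambda>\<omega>. (R j \<omega>)\<^sup>2)"
        unfolding R_def using G
        by (intro weighted_sum_square_ge inc fbm_grid_covariance_nonneg [OF B H s] w) auto
      finally show ?thesis .
    qed
    have "A * \<kappa> * (real k - real j0) \<le> (\<Sum>j\<in>{j0..<k}. A * \<kappa>)"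
      using A kap mult_left_mono [of "real k - real j0" "real (k - j0)" "A * \<kappa>"] by (simp add: mult.commute)
    also have "\<dots> \<le> (\<Sum>j\<in>{j0..<k}. expectation (\<lambda>\<omega>. (R j \<omega>)\<^sup>2))"
      using lower by (intro sum_mono) auto
    also have "\<dots> \<le> (\<Sum>j<k. expectation (\<lambda>\<omega>. (R j \<omega>)\<^sup>2))"
      by (intro sum_mono2) auto
    also have "\<dots> \<le> expectation (\<lambda>\<omega>. (\<Sum>j<k. R j \<omega>)\<^sup>2)"
      by (intro sum_square_ge_blocks R cov)
    finally show "A * \<kappa> * (real k - real j0) \<le>
        expectation (\<lambda>\<omega>. (increment_sum B (\<lambda>i. noise_kernel \<beta> c t (grid t n i)) (grid t n) (k * n) \<omega>)\<^sup>2)"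
      by (simp add: increment_sum_blocks R_def)
  qed
qed

end

section \<open>The stochastic integrals\<close>

lemma grid_tagged_division:
  fixes s :: "nat \<Rightarrow> real"
  assumes s: "strict_mono s" and N: "0 < N"
  shows "(\<lambda>i. (s i, {s i..s (Suc i)})) ` {..<N} tagged_division_of {s 0..s N}"
proof -
  have single: "{(s i, {s i..s (Suc i)})} tagged_division_of {s i..s (Suc i)}" for i
    using tagged_division_of_self [of "s i" "s i" "s (Suc i)"] strict_monoD [OF s, of i "Suc i"] by simp
  have "1 \<le> N" using N by simp
  then show ?thesis
  proof (induction rule: dec_induct)
    case base
    then show ?case using single [of 0] by (simp add: lessThan_Suc)
  next
    case (step n)
    have le: "s 0 \<le> s n" "s n \<le> s (Suc n)" using monoD [OF strict_mono_mono [OF s], of 0 n] strict_monoD [OF s, of n "Suc n"] by auto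
    have "insert (s n, {s n..s (Suc n)}) ((\<lambda>i. (s i, {s i..s (Suc i)})) ` {..<n})
        tagged_division_of {s n..s (Suc n)} \<union> {s 0..s n}"
      using tagged_division_Un [OF single [of n] step.IH] le by simp
    moreover have "{s n..s (Suc n)} \<union> {s 0..s n} = {s 0..s (Suc n)}" using le by auto
    ultimately show ?case by (simp add: lessThan_Suc)
  qed
qed

text \<open>\<open>rs_sum\<close> adds over a set of tagged intervals; strict monotonicity keeps
  those of different indices distinct, so no summand is lost.\<close>

lemma rs_sum_grid:
  assumes s: "strict_mono s"
  shows "rs_sum B g ((\<lambda>i. (s i, {s i..s (Suc i)})) ` {..<N}) \<omega> = increment_sum B (\<lambda>i. g (s i)) s N \<omega>"
proof -
  have "inj_on (\<lambda>i. (s i, {s i..s (Suc i)})) {..<N}"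
    using strict_mono_eq [OF s] by (auto simp: inj_on_def)
  moreover have "s i \<le> s (Suc i)" for i using strict_monoD [OF s, of i "Suc i"] by simp
  ultimately show ?thesis by (simp add: rs_sum_def increment_sum_def sum.reindex)
qed

lemma grid_mesh_tendsto: "(\<lambda>n. t * (1 - 2 powr (- (1 / real n)))) \<longlonglongrightarrow> 0"
proof -
  have "(\<lambda>n. t * (1 - 2 powr (- (1 / real n)))) \<longlonglongrightarrow> t * (1 - 2 powr (- 0))"
    by (intro tendsto_intros lim_1_over_n) auto
  then show ?thesis by simp
qed

section \<open>Approximation of the improper integrals by grid sums\<close>

context prob_space
begin

lemma prob_triangle:
  fixes X Y Z :: "'a \<Rightarrow> real"
  assumes [measurable]: "X \<in> borel_measurable M" "Y \<in> borel_measurable M" "Z \<in> borel_measurable M"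
  shows "prob {\<omega> \<in> space M. \<bar>X \<omega> - Z \<omega>\<bar> > a + b} \<le>
    prob {\<omega> \<in> space M. \<bar>X \<omega> - Y \<omega>\<bar> > a} + prob {\<omega> \<in> space M. \<bar>Y \<omega> - Z \<omega>\<bar> > b}"
proof -
  have "prob {\<omega> \<in> space M. \<bar>X \<omega> - Z \<omega>\<bar> > a + b} \<le>
    prob ({\<omega> \<in> space M. \<bar>X \<omega> - Y \<omega>\<bar> > a} \<union> {\<omega> \<in> space M. \<bar>Y \<omega> - Z \<omega>\<bar> > b})"
    by (intro finite_measure_mono) auto
  also have "\<dots> \<le> prob {\<omega> \<in> space M. \<bar>X \<omega> - Y \<omega>\<bar> > a} + prob {\<omega> \<in> space M. \<bar>Y \<omega> - Z \<omega>\<bar> > b}"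
    by (intro measure_Un_le) auto
  finally show ?thesis .
qed

text \<open>The number of blocks \<open>k\<close> is fixed first, which puts the cut
  \<open>u = t * (1 - (1/2) ^ k)\<close> close enough to \<open>t\<close>; then the mesh, governed
  by \<open>n\<close>, is adapted to the integral over \<open>{0..u}\<close>. Hence \<open>N\<close>
  depends on \<open>k\<close>.\<close>

lemma improper_rs_integral_grid:
  assumes I: "has_improper_rs_integral M B g t I" and t: "0 < t" and e: "0 < e"
    and B: "\<And>s. 0 \<le> s \<Longrightarrow> B s \<in> borel_measurable M"
  obtains K where "\<And>k. K \<le> k \<Longrightarrow> \<exists>N. \<forall>n\<ge>N.
    prob {\<omega> \<in> space M. \<bar>increment_sum B (\<lambda>i. g (grid t n i)) (grid t n) (k * n) \<omega> - I \<omega>\<bar> > e} < e"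
proof -
  obtain J where J: "\<And>u. u \<in> {0<..<t} \<Longrightarrow> has_rs_integral M B g u (J u)"
    and JI: "\<And>\<epsilon>. 0 < \<epsilon> \<Longrightarrow> ((\<lambda>u. prob {\<omega> \<in> space M. \<bar>J u \<omega> - I \<omega>\<bar> > \<epsilon>}) \<longlongrightarrow> 0) (at_left t)"
    and Im [measurable]: "I \<in> borel_measurable M"
    using I unfolding has_improper_rs_integral_def by blast
  have "\<forall>\<^sub>F u in at_left t. prob {\<omega> \<in> space M. \<bar>J u \<omega> - I \<omega>\<bar> > e/2} < e/2"
    using e by (intro order_tendstoD(2) [OF JI]) auto
  then obtain b where b: "b < t" and P: "\<And>u. b < u \<Longrightarrow> u < t \<Longrightarrow> prob {\<omega> \<in> space M. \<bar>J u \<omega> - I \<omega>\<bar> > e/2} < e/2"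
    unfolding eventually_at_left_field by blast
  have "(\<lambda>k. t * (1/2) ^ k) \<longlonglongrightarrow> t * 0" by (intro tendsto_mult tendsto_const LIMSEQ_power_zero) auto
  then have "\<forall>\<^sub>F k in sequentially. t * (1/2) ^ k < t - b"
    using b by (intro order_tendstoD(2)) auto
  then obtain K where K: "\<And>k. K \<le> k \<Longrightarrow> t * (1/2) ^ k < t - b"
    unfolding eventually_sequentially by blast
  show thesis
  \<comment> \<open>\<open>k = 0\<close> would give \<open>u = 0\<close>, where no integral is
    provided.\<close>
  proof (rule that [of "max K 1"])
    fix k assume k: "max K 1 \<le> k"
    define u where "u = t * (1 - (1/2) ^ k)"
    have "(1/2 :: real) ^ k \<le> (1/2) ^ 1" using k by (intro power_decreasing) auto
    then have "(1/2 :: real) ^ k < 1" by simp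
    then have u: "u \<in> {0<..<t}" using t by (auto simp: u_def right_diff_distrib)
    have bu: "b < u" using K [of k] k by (simp add: u_def right_diff_distrib)
    have JIu: "prob {\<omega> \<in> space M. \<bar>J u \<omega> - I \<omega>\<bar> > e/2} < e/2" using P [OF bu] u by simp
    have Jm [measurable]: "J u \<in> borel_measurable M" using J [OF u] by (simp add: has_rs_integral_def)
    obtain \<delta> where \<delta>: "0 < \<delta>" and rs: "\<And>p. p tagged_division_of {0..u} \<Longrightarrow> (\<lambda>c. ball c \<delta>) fine p \<Longrightarrow>
        prob {\<omega> \<in> space M. \<bar>rs_sum B g p \<omega> - J u \<omega>\<bar> > e/2} < e/2"
      using J [OF u] e unfolding has_rs_integral_def by (meson half_gt_zero)
    have "\<forall>\<^sub>F n in sequentially. t * (1 - 2 powr (- (1 / real n))) < \<delta> \<and> 0 < n"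
      using order_tendstoD(2) [OF grid_mesh_tendsto \<delta>] eventually_gt_at_top by (rule eventually_conj)
    then obtain N where N: "\<And>n. N \<le> n \<Longrightarrow> t * (1 - 2 powr (- (1 / real n))) < \<delta> \<and> 0 < n"
      unfolding eventually_sequentially by blast
    show "\<exists>N. \<forall>n\<ge>N. prob {\<omega> \<in> space M. \<bar>increment_sum B (\<lambda>i. g (grid t n i)) (grid t n) (k * n) \<omega> - I \<omega>\<bar> > e} < e"
    proof (intro exI allI impI)
      fix n assume "N \<le> n"
      then have mesh: "t * (1 - 2 powr (- (1 / real n))) < \<delta>" and n: "0 < n" using N by auto
      let ?s = "grid t n"
      let ?p = "(\<lambda>i. (?s i, {?s i..?s (Suc i)})) ` {..<k * n}"
      note s = grid_strict_mono [OF t n]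
      have "?p tagged_division_of {0..u}"
        using grid_tagged_division [OF s, of "k * n"] k n grid_block [OF n, of t k] by (simp add: u_def)
      moreover have "(\<lambda>c. ball c \<delta>) fine ?p"
      proof -
        have "{?s i..?s (Suc i)} \<subseteq> ball (?s i) \<delta>" for i
          using grid_step_le [OF t n, of i] mesh by (auto simp: dist_real_def)
        then show ?thesis by (auto simp: fine_def)
      qed
      ultimately have "prob {\<omega> \<in> space M. \<bar>rs_sum B g ?p \<omega> - J u \<omega>\<bar> > e/2} < e/2" by (rule rs)
      then have R: "prob {\<omega> \<in> space M. \<bar>increment_sum B (\<lambda>i. g (?s i)) ?s (k * n) \<omega> - J u \<omega>\<bar> > e/2} < e/2"
        by (simp only: rs_sum_grid [OF s])
      have "increment_sum B (\<lambda>i. g (?s i)) ?s (k * n) \<in> borel_measurable M"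
        unfolding increment_sum_def [abs_def]
        by (intro borel_measurable_sum borel_measurable_scaleR borel_measurable_const borel_measurable_diff B grid_nonneg t n)
      from prob_triangle [OF this Jm Im, of "e/2" "e/2"] R JIu
      show "prob {\<omega> \<in> space M. \<bar>increment_sum B (\<lambda>i. g (?s i)) ?s (k * n) \<omega> - I \<omega>\<bar> > e} < e"
        unfolding field_sum_of_halves by linarith
    qed
  qed
qed

lemma AE_tendsto_of_fast_convergence:
  fixes R :: "nat \<Rightarrow> 'a \<Rightarrow> real"
  assumes [measurable]: "\<And>q. R q \<in> borel_measurable M" "I \<in> borel_measurable M"
    and P: "\<And>q. prob {\<omega> \<in> space M. \<bar>R q \<omega> - I \<omega>\<bar> > (1/2) ^ q} < (1/2) ^ q"
  shows "AE \<omega> in M. (\<lambda>q. R q \<omega>) \<longlonglongrightarrow> I \<omega>"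
proof -
  let ?A = "\<lambda>q. {\<omega> \<in> space M. \<bar>R q \<omega> - I \<omega>\<bar> > (1/2) ^ q}"
  have "AE \<omega> in M. \<forall>\<^sub>F q in sequentially. \<omega> \<in> space M - ?A q"
  proof (rule borel_cantelli_AE1)
    show "?A q \<in> sets M" for q by measurable
    show "emeasure M (?A q) < \<infinity>" for q by (simp add: emeasure_eq_measure)
    show "summable (\<lambda>q. prob (?A q))"
      using P by (intro summable_comparison_test' [OF summable_geometric [of "1/2 :: real"]]) (auto intro: less_imp_le)
  qed
  then show ?thesis
  proof eventually_elim
    case (elim \<omega>)
    have "\<forall>\<^sub>F q in sequentially. norm (R q \<omega> - I \<omega>) \<le> (1/2) ^ q"
      using elim by eventually_elim auto
    moreover have "(\<lambda>q. (1/2 :: real) ^ q) \<longlonglongrightarrow> 0" by (rule LIMSEQ_power_zero) simp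
    ultimately have "(\<lambda>q. R q \<omega> - I \<omega>) \<longlonglongrightarrow> 0" by (rule Lim_null_comparison)
    then show ?case by (rule LIM_zero_cancel)
  qed
qed

text \<open>A common grid serves the real and the imaginary part, so that the complex sums converge.
  The number of blocks is forced up by \<open>q \<le> k q\<close>, and the deviation in probability
  is recorded for the real part; both are used when the noise is shown to vanish.\<close>

lemma complex_rs_integral_grid:
  assumes B: "complex_fbm M H A B" and I: "has_complex_rs_integral M B g t I" and t: "0 < t"
  obtains k n :: "nat \<Rightarrow> nat" where "\<And>q. q \<le> k q" "\<And>q. 0 < n q" "I \<in> borel_measurable M"
    "AE \<omega> in M. (\<lambda>q. increment_sum B (\<lambda>i. g (grid t (n q) i)) (grid t (n q)) (k q * n q) \<omega>) \<longlonglongrightarrow> I \<omega>"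
    "\<And>q. prob {\<omega> \<in> space M. \<bar>increment_sum (\<lambda>s \<omega>. Re (B s \<omega>)) (\<lambda>i. g (grid t (n q) i)) (grid t (n q)) (k q * n q) \<omega>
       - Re (I \<omega>)\<bar> > (1/2) ^ q} < (1/2) ^ q"
proof -
  obtain I1 I2 where I12: "has_improper_rs_integral M (\<lambda>s \<omega>. Re (B s \<omega>)) g t I1"
      "has_improper_rs_integral M (\<lambda>s \<omega>. Im (B s \<omega>)) g t I2"
    and Ieq: "\<And>\<omega>. I \<omega> = complex_of_real (I1 \<omega>) + \<i> * complex_of_real (I2 \<omega>)"
    using I unfolding has_complex_rs_integral_def by blast
  have m [measurable]: "I1 \<in> borel_measurable M" "I2 \<in> borel_measurable M"
    using I12 by (auto simp: has_improper_rs_integral_def)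
  let ?B1 = "\<lambda>s \<omega>. Re (B s \<omega>)" and ?B2 = "\<lambda>s \<omega>. Im (B s \<omega>)"
  have f: "real_fbm M H A ?B1" "real_fbm M H A ?B2" using B by (auto simp: complex_fbm_def)
  have Bm: "?B1 s \<in> borel_measurable M" "?B2 s \<in> borel_measurable M" if "0 \<le> s" for s
    using fbm_square_integrable [OF f(1) that] fbm_square_integrable [OF f(2) that] by (auto simp: square_integrable_def)
  let ?R = "\<lambda>B n k. increment_sum B (\<lambda>i. g (grid t n i)) (grid t n) (k * n)"
  have ex: "\<exists>k n. q \<le> k \<and> 0 < n \<and> prob {\<omega> \<in> space M. \<bar>?R ?B1 n k \<omega> - I1 \<omega>\<bar> > (1/2) ^ q} < (1/2) ^ q
     \<and> prob {\<omega> \<in> space M. \<bar>?R ?B2 n k \<omega> - I2 \<omega>\<bar> > (1/2) ^ q} < (1/2) ^ q" for q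
  proof -
    obtain K1 where K1: "\<And>k. K1 \<le> k \<Longrightarrow> \<exists>N. \<forall>n\<ge>N. prob {\<omega> \<in> space M. \<bar>?R ?B1 n k \<omega> - I1 \<omega>\<bar> > (1/2) ^ q} < (1/2) ^ q"
      by (rule improper_rs_integral_grid [OF I12(1) t _ Bm(1), of "(1/2) ^ q"]) auto
    obtain K2 where K2: "\<And>k. K2 \<le> k \<Longrightarrow> \<exists>N. \<forall>n\<ge>N. prob {\<omega> \<in> space M. \<bar>?R ?B2 n k \<omega> - I2 \<omega>\<bar> > (1/2) ^ q} < (1/2) ^ q"
      by (rule improper_rs_integral_grid [OF I12(2) t _ Bm(2), of "(1/2) ^ q"]) auto
    define k where "k = max q (max K1 K2)"
    obtain N1 where N1: "\<And>n. N1 \<le> n \<Longrightarrow> prob {\<omega> \<in> space M. \<bar>?R ?B1 n k \<omega> - I1 \<omega>\<bar> > (1/2) ^ q} < (1/2) ^ q"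
      using K1 [of k] max.cobounded1 max.coboundedI2 unfolding k_def by blast
    obtain N2 where N2: "\<And>n. N2 \<le> n \<Longrightarrow> prob {\<omega> \<in> space M. \<bar>?R ?B2 n k \<omega> - I2 \<omega>\<bar> > (1/2) ^ q} < (1/2) ^ q"
      using K2 [of k] max.cobounded2 max.coboundedI2 unfolding k_def by blast
    show ?thesis
      by (rule exI [of _ k], rule exI [of _ "max 1 (max N1 N2)"], intro conjI N1 N2) (auto simp: k_def)
  qed
  obtain k where "\<forall>q. \<exists>n. q \<le> k q \<and> 0 < n \<and> prob {\<omega> \<in> space M. \<bar>?R ?B1 n (k q) \<omega> - I1 \<omega>\<bar> > (1/2) ^ q} < (1/2) ^ q
     \<and> prob {\<omega> \<in> space M. \<bar>?R ?B2 n (k q) \<omega> - I2 \<omega>\<bar> > (1/2) ^ q} < (1/2) ^ q"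
    using choice [OF allI, OF ex] by (rule exE)
  from choice [OF this] obtain n where kn: "\<And>q. q \<le> k q" "\<And>q. 0 < n q"
    and P1: "\<And>q. prob {\<omega> \<in> space M. \<bar>?R ?B1 (n q) (k q) \<omega> - I1 \<omega>\<bar> > (1/2) ^ q} < (1/2) ^ q"
    and P2: "\<And>q. prob {\<omega> \<in> space M. \<bar>?R ?B2 (n q) (k q) \<omega> - I2 \<omega>\<bar> > (1/2) ^ q} < (1/2) ^ q"
    by blast
  have Rm: "?R ?B1 (n q) (k q) \<in> borel_measurable M" "?R ?B2 (n q) (k q) \<in> borel_measurable M" for q
    using increment_sum_square_integrable [OF f(1) grid_nonneg [OF t kn(2)]]
      increment_sum_square_integrable [OF f(2) grid_nonneg [OF t kn(2)]] by (auto simp: square_integrable_def)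
  have "AE \<omega> in M. (\<lambda>q. ?R B (n q) (k q) \<omega>) \<longlonglongrightarrow> I \<omega>"
    using AE_tendsto_of_fast_convergence [OF Rm(1) m(1) P1] AE_tendsto_of_fast_convergence [OF Rm(2) m(2) P2]
  proof eventually_elim
    case (elim \<omega>)
    have "?R B n k \<omega> = complex_of_real (?R ?B1 n k \<omega>) + \<i> * complex_of_real (?R ?B2 n k \<omega>)" for n k
      by (simp add: complex_eq_iff increment_sum_def)
    moreover have "(\<lambda>q. complex_of_real (?R ?B1 (n q) (k q) \<omega>) + \<i> * complex_of_real (?R ?B2 (n q) (k q) \<omega>))
        \<longlonglongrightarrow> complex_of_real (I1 \<omega>) + \<i> * complex_of_real (I2 \<omega>)"
      by (intro tendsto_intros elim)
    ultimately show ?case by (simp only: Ieq)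
  qed
  moreover have "I \<in> borel_measurable M"
    using m unfolding Ieq [abs_def] by measurable
  moreover have "Re (I \<omega>) = I1 \<omega>" for \<omega> by (simp add: Ieq)
  ultimately show thesis using kn P1 by (intro that [of k n]) (auto simp only:)
qed

text \<open>For \<open>\<beta> + H \<le> 1\<close> the variances of the Gaussian sums diverge unless the noise vanishes, so the sums
  cannot converge in probability.\<close>
lemma noise_integral_degenerate:
  assumes B: "complex_fbm M H A B" and I: "has_complex_rs_integral M B (noise_kernel \<beta> c t) t I" and t: "0 < t"
    and H: "1/2 \<le> H" and b: "0 < \<beta>" "\<beta> \<le> 1" and bH: "\<beta> + H \<le> 1" and c: "0 \<le> c"
  shows "A = 0"
proof (rule ccontr)
  assume "A \<noteq> 0"
  let ?B = "\<lambda>s \<omega>. Re (B s \<omega>)"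
  have f: "real_fbm M H A ?B" using B by (simp add: complex_fbm_def)
  then have A: "0 < A" using fbm_variance_nonneg \<open>A \<noteq> 0\<close> by fastforce
  obtain k n where kn: "\<And>q. q \<le> k q" "\<And>q. 0 < n q" and Im [measurable]: "I \<in> borel_measurable M"
    and lim: "AE \<omega> in M. (\<lambda>q. increment_sum B (\<lambda>i. noise_kernel \<beta> c t (grid t (n q) i)) (grid t (n q)) (k q * n q) \<omega>) \<longlonglongrightarrow> I \<omega>"
    and P: "\<And>q. prob {\<omega> \<in> space M. \<bar>increment_sum ?B (\<lambda>i. noise_kernel \<beta> c t (grid t (n q) i)) (grid t (n q)) (k q * n q) \<omega>
       - Re (I \<omega>)\<bar> > (1/2) ^ q} < (1/2) ^ q"
    by (rule complex_rs_integral_grid [OF B I t]) blast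
  define R where "R q = increment_sum ?B (\<lambda>i. noise_kernel \<beta> c t (grid t (n q) i)) (grid t (n q)) (k q * n q)" for q
  have Rn: "centred_normal M (R q)" for q
    unfolding R_def by (rule fbm_increment_sum_normal [OF f grid_nonneg [OF t kn(2)]])
  have [measurable]: "R q \<in> borel_measurable M" for q using Rn by (simp add: centred_normal_def)
  obtain j0 \<kappa> where kap: "0 < \<kappa>" and var: "\<And>k n. 0 < n \<Longrightarrow> A * \<kappa> * (real k - real j0) \<le>
      expectation (\<lambda>\<omega>. (increment_sum ?B (\<lambda>i. noise_kernel \<beta> c t (grid t n i)) (grid t n) (k * n) \<omega>)\<^sup>2)"
    by (rule noise_grid_variance_ge [OF f H b bH c t]) blast
  have v: "A * \<kappa> * (real q - real j0) \<le> expectation (\<lambda>\<omega>. (R q \<omega>)\<^sup>2)" for q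
  proof -
    have "A * \<kappa> * (real q - real j0) \<le> A * \<kappa> * (real (k q) - real j0)"
      using kn(1) [of q] A kap by (intro mult_left_mono) auto
    then show ?thesis using var [OF kn(2), of "k q" q] by (simp add: R_def)
  qed
  \<comment> \<open>Up to a small probability \<open>Re (I \<omega>)\<close> lies within
    \<open>(1/2) ^ q \<le> 1\<close> of \<open>R q\<close>, hence the radius \<open>K + 1\<close>;
    the small ball estimate with growing variance then leaves no mass in any bounded
    interval.\<close>
  have zero: "prob {\<omega> \<in> space M. \<bar>Re (I \<omega>)\<bar> \<le> real K} = 0" for K
  proof -
    have "prob {\<omega> \<in> space M. \<bar>Re (I \<omega>)\<bar> \<le> real K} \<le> 2 * (real K + 1) / sqrt (A * \<kappa> * (real q - real j0)) + (1/2) ^ q"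
      if q: "j0 < q" for q
    proof -
      have pos: "0 < A * \<kappa> * (real q - real j0)" using A kap q by simp
      have "prob {\<omega> \<in> space M. \<bar>Re (I \<omega>)\<bar> \<le> real K}
          \<le> prob ({\<omega> \<in> space M. \<bar>R q \<omega>\<bar> \<le> real K + 1} \<union> {\<omega> \<in> space M. \<bar>R q \<omega> - Re (I \<omega>)\<bar> > (1/2) ^ q})"
      proof (intro finite_measure_mono subsetI)
        fix \<omega> assume "\<omega> \<in> {\<omega> \<in> space M. \<bar>Re (I \<omega>)\<bar> \<le> real K}"
        moreover have "(1/2 :: real) ^ q \<le> 1" by (rule power_le_one) auto
        ultimately show "\<omega> \<in> {\<omega> \<in> space M. \<bar>R q \<omega>\<bar> \<le> real K + 1} \<union> {\<omega> \<in> space M. \<bar>R q \<omega> - Re (I \<omega>)\<bar> > (1/2) ^ q}"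
          by auto
      qed measurable
      also have "\<dots> \<le> prob {\<omega> \<in> space M. \<bar>R q \<omega>\<bar> \<le> real K + 1} + prob {\<omega> \<in> space M. \<bar>R q \<omega> - Re (I \<omega>)\<bar> > (1/2) ^ q}"
        by (intro measure_Un_le) measurable
      also have "\<dots> \<le> 2 * (real K + 1) / sqrt (expectation (\<lambda>\<omega>. (R q \<omega>)\<^sup>2)) + (1/2) ^ q"
        using pos v [of q] P [of q]
        by (intro add_mono centred_normal_small_ball [OF Rn]) (auto simp: R_def [symmetric] intro: less_imp_le)
      also have "\<dots> \<le> 2 * (real K + 1) / sqrt (A * \<kappa> * (real q - real j0)) + (1/2) ^ q"
        using pos v [of q] by (intro add_right_mono divide_left_mono mult_pos_pos) auto
      finally show ?thesis .
    qed
    then have ev: "\<forall>\<^sub>F q in sequentially. prob {\<omega> \<in> space M. \<bar>Re (I \<omega>)\<bar> \<le> real K}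
        \<le> 2 * (real K + 1) / sqrt (A * \<kappa> * (real q - real j0)) + (1/2) ^ q"
      by (intro eventually_mono [OF eventually_gt_at_top [of j0]])
    have "0 < A * \<kappa>" using A kap by simp
    moreover have "(\<lambda>q. d / sqrt (a * (real q - e)) + (1/2) ^ q) \<longlonglongrightarrow> 0" if "0 < a" for a d e :: real
      using that by real_asymp
    ultimately have "(\<lambda>q. 2 * (real K + 1) / sqrt (A * \<kappa> * (real q - real j0)) + (1/2) ^ q) \<longlonglongrightarrow> 0"
      by blast
    then have "prob {\<omega> \<in> space M. \<bar>Re (I \<omega>)\<bar> \<le> real K} \<le> 0"
      using ev by (rule tendsto_lowerbound) simp
    then show ?thesis by (simp add: measure_le_0_iff)
  qed
  have "AE \<omega> in M. \<not> \<bar>Re (I \<omega>)\<bar> \<le> real K" for K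
    using zero [of K] by (subst AE_iff_measurable [of "{\<omega> \<in> space M. \<bar>Re (I \<omega>)\<bar> \<le> real K}"]) (auto simp: emeasure_eq_measure)
  then have "AE \<omega> in M. \<forall>K. \<not> \<bar>Re (I \<omega>)\<bar> \<le> real K" by (simp add: AE_all_countable)
  then have "AE \<omega> in M. False"
  proof eventually_elim
    case (elim \<omega>)
    then show ?case using real_arch_simple by blast
  qed
  then show False by simp
qed

text \<open>One constant for all kernel parameters \<open>c\<close> and all intensities
  \<open>A\<close>. The two regimes of \<open>\<beta> + H\<close> are merged here, the second one
  occurring only with \<open>A = 0\<close>.\<close>

lemma complex_noise_integral:
  assumes H: "1/2 \<le> H" and b: "0 < \<beta>" "\<beta> \<le> 1" and t: "0 < t"
  obtains C where "0 \<le> C" and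
    "\<And>c A B I. 0 \<le> c \<Longrightarrow> complex_fbm M H A B \<Longrightarrow> has_complex_rs_integral M B (noise_kernel \<beta> c t) t I \<Longrightarrow>
      \<exists>W. (\<forall>q. (\<exists>w s N. (\<forall>i. 0 \<le> s i) \<and> W q = increment_sum B w s N) \<and> square_integrable M (W q) \<and>
          expectation (\<lambda>\<omega>. (cmod (W q \<omega>))\<^sup>2) \<le> C * A) \<and>
        I \<in> borel_measurable M \<and> (AE \<omega> in M. (\<lambda>q. W q \<omega>) \<longlonglongrightarrow> I \<omega>)"
proof -
  \<comment> \<open>At \<open>\<beta> + H = 1\<close> the last denominator is 0 and the quotient
    takes the value 0; in that regime only \<open>A = 0\<close> occurs, so the bound
    \<open>C * A\<close> remains correct.\<close>
  define C where "C = (t / 2) powr (2 * (\<beta> + H - 1)) / (Gamma \<beta>)\<^sup>2 / (1 - (1/2) powr (\<beta> + H - 1))\<^sup>2"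
  have C: "0 \<le> C" by (simp add: C_def)
  show thesis
  \<comment> \<open>One summand \<open>C * A\<close> for the real and one for the imaginary
    part.\<close>
  proof (rule that [of "2 * C"])
    fix c A B I
    assume c: "0 \<le> c" and B: "complex_fbm M H A B" and I: "has_complex_rs_integral M B (noise_kernel \<beta> c t) t I"
    let ?B1 = "\<lambda>s \<omega>. Re (B s \<omega>)" and ?B2 = "\<lambda>s \<omega>. Im (B s \<omega>)"
    have f: "real_fbm M H A ?B1" "real_fbm M H A ?B2" using B by (auto simp: complex_fbm_def)
    obtain k n where kn: "\<And>q. q \<le> k q" "\<And>q. 0 < n q" and Im: "I \<in> borel_measurable M"
      and lim: "AE \<omega> in M. (\<lambda>q. increment_sum B (\<lambda>i. noise_kernel \<beta> c t (grid t (n q) i)) (grid t (n q)) (k q * n q) \<omega>) \<longlonglongrightarrow> I \<omega>"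
      by (rule complex_rs_integral_grid [OF B I t]) blast
    let ?R = "\<lambda>B q. increment_sum B (\<lambda>i. noise_kernel \<beta> c t (grid t (n q) i)) (grid t (n q)) (k q * n q)"
    have R: "expectation (\<lambda>\<omega>. (?R B' q \<omega>)\<^sup>2) \<le> C * A" if B': "real_fbm M H A B'" for B' q
    proof (cases "1 < \<beta> + H")
      case True
      then show ?thesis using noise_grid_variance_le [OF B' H b True c t kn(2), of q "k q"] by (simp add: C_def mult_ac)
    next
      case False
      then have "A = 0" by (intro noise_integral_degenerate [OF B I t H b _ c]) simp
      then show ?thesis
        using increment_sum_degenerate [of H B' "grid t (n q)"] B' H grid_mono [OF t kn(2)] by simp
    qed
    have s: "square_integrable M (?R ?B1 q)" "square_integrable M (?R ?B2 q)" for q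
      by (intro increment_sum_square_integrable [OF f(1)] increment_sum_square_integrable [OF f(2)] grid_nonneg t kn)+
    have eq: "?R B q \<omega> = complex_of_real (?R ?B1 q \<omega>) + \<i> * complex_of_real (?R ?B2 q \<omega>)" for q \<omega>
      by (simp add: complex_eq_iff increment_sum_def)
    have sB: "square_integrable M (?R B q)" for q
    proof -
      have "square_integrable M (\<lambda>\<omega>. complex_of_real (?R ?B1 q \<omega>) + \<i> * complex_of_real (?R ?B2 q \<omega>))"
        by (intro square_integrable_add square_integrable_cmult square_integrable_of_real s)
      then show ?thesis by (simp only: eq [symmetric])
    qed
    have "expectation (\<lambda>\<omega>. (cmod (?R B q \<omega>))\<^sup>2) \<le> 2 * C * A" for q
    proof -
      have "(cmod (?R B q \<omega>))\<^sup>2 = (?R ?B1 q \<omega>)\<^sup>2 + (?R ?B2 q \<omega>)\<^sup>2" for \<omega>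
        unfolding eq by (simp add: cmod_power2)
      moreover have "expectation (\<lambda>\<omega>. (?R ?B1 q \<omega>)\<^sup>2 + (?R ?B2 q \<omega>)\<^sup>2)
          = expectation (\<lambda>\<omega>. (?R ?B1 q \<omega>)\<^sup>2) + expectation (\<lambda>\<omega>. (?R ?B2 q \<omega>)\<^sup>2)"
        using square_integrableD(2) [OF s(1)] square_integrableD(2) [OF s(2)]
        by (intro Bochner_Integration.integral_add) simp_all
      ultimately show ?thesis using R [OF f(1), of q] R [OF f(2), of q] by simp
    qed
    then show "\<exists>W. (\<forall>q. (\<exists>w s N. (\<forall>i. 0 \<le> s i) \<and> W q = increment_sum B w s N) \<and> square_integrable M (W q) \<and>
          expectation (\<lambda>\<omega>. (cmod (W q \<omega>))\<^sup>2) \<le> 2 * C * A) \<and>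
        I \<in> borel_measurable M \<and> (AE \<omega> in M. (\<lambda>q. W q \<omega>) \<longlonglongrightarrow> I \<omega>)"
      by (intro exI [of _ "?R B"] conjI allI sB Im lim)
        (rule exI, rule exI, rule exI, rule conjI, rule allI, rule grid_nonneg [OF t kn(2)], rule refl)
  qed (use C in simp)
qed

end

section \<open>Uncorrelated coefficients\<close>

context prob_space
begin

lemma increment_sum_orthogonal:
  fixes F :: "'a \<Rightarrow> complex"
  assumes F: "square_integrable M F" and B: "\<And>s. 0 \<le> s \<Longrightarrow> square_integrable M (B s)"
    and 0: "\<And>s. 0 \<le> s \<Longrightarrow> expectation (\<lambda>\<omega>. F \<omega> * cnj (B s \<omega>)) = 0" and s: "\<And>i. 0 \<le> s i"
  shows "expectation (\<lambda>\<omega>. F \<omega> * cnj (increment_sum B w s N \<omega>)) = 0"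
proof -
  have i: "integrable M (\<lambda>\<omega>. F \<omega> * cnj (B (s k) \<omega>))" for k
    by (intro square_integrable_mult F square_integrable_cnj B s)
  have "F \<omega> * cnj (increment_sum B w s N \<omega>)
      = (\<Sum>i<N. complex_of_real (w i) * (F \<omega> * cnj (B (s (Suc i)) \<omega>) - F \<omega> * cnj (B (s i) \<omega>)))" for \<omega>
    by (simp add: increment_sum_def sum_distrib_left scaleR_conv_of_real algebra_simps)
  then have "expectation (\<lambda>\<omega>. F \<omega> * cnj (increment_sum B w s N \<omega>))
      = (\<Sum>j<N. expectation (\<lambda>\<omega>. complex_of_real (w j) * (F \<omega> * cnj (B (s (Suc j)) \<omega>) - F \<omega> * cnj (B (s j) \<omega>))))"
    by (simp only:) (intro Bochner_Integration.integral_sum integrable_mult_right Bochner_Integration.integrable_diff i)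
  also have "\<dots> = 0"
    by (simp add: i 0 s Bochner_Integration.integral_diff)
  finally show ?thesis .
qed

lemma expectation_cnj_flip:
  "expectation (\<lambda>\<omega>. F \<omega> * cnj (G \<omega>)) = 0 \<Longrightarrow> expectation (\<lambda>\<omega>. G \<omega> * cnj (F \<omega>)) = 0"
proof -
  have "expectation (\<lambda>\<omega>. G \<omega> * cnj (F \<omega>)) = expectation (\<lambda>\<omega>. cnj (F \<omega> * cnj (G \<omega>)))"
    by (simp add: mult.commute)
  also have "\<dots> = cnj (expectation (\<lambda>\<omega>. F \<omega> * cnj (G \<omega>)))" by (rule Bochner_Integration.integral_cnj)
  finally show "expectation (\<lambda>\<omega>. F \<omega> * cnj (G \<omega>)) = 0 \<Longrightarrow> ?thesis" by simp
qed

text \<open>The interface between the stochastic integrals and the second moment argument: the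
  approximants are combinations of values of \<open>B\<close> at nonnegative times, so a variable
  uncorrelated with these values is uncorrelated with the approximants.\<close>

definition noise_approx :: "(real \<Rightarrow> 'a \<Rightarrow> complex) \<Rightarrow> real \<Rightarrow> ('a \<Rightarrow> complex) \<Rightarrow> (nat \<Rightarrow> 'a \<Rightarrow> complex) \<Rightarrow> bool" where
  "noise_approx B V I W \<longleftrightarrow> (\<forall>q. (\<exists>w s N. (\<forall>i. 0 \<le> s i) \<and> W q = increment_sum B w s N) \<and> square_integrable M (W q) \<and>
     expectation (\<lambda>\<omega>. (cmod (W q \<omega>))\<^sup>2) \<le> V) \<and> I \<in> borel_measurable M \<and> (AE \<omega> in M. (\<lambda>q. W q \<omega>) \<longlonglongrightarrow> I \<omega>)"

lemma noise_approx_moments: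
  assumes W: "noise_approx B V I W"
  shows "square_integrable M I" and "expectation (\<lambda>\<omega>. (cmod (I \<omega>))\<^sup>2) \<le> V"
    and "\<And>F. square_integrable M F \<Longrightarrow> (\<And>q. expectation (\<lambda>\<omega>. F \<omega> * cnj (W q \<omega>)) = 0) \<Longrightarrow>
      expectation (\<lambda>\<omega>. F \<omega> * cnj (I \<omega>)) = 0"
  using AE_limit_second_moments [of W V I] W unfolding noise_approx_def by blast+

lemma noise_approx_orthogonal:
  assumes W: "noise_approx B V I W" and B: "\<And>s. 0 \<le> s \<Longrightarrow> square_integrable M (B s)"
    and F: "square_integrable M F" and 0: "\<And>s. 0 \<le> s \<Longrightarrow> expectation (\<lambda>\<omega>. F \<omega> * cnj (B s \<omega>)) = 0"
  shows "expectation (\<lambda>\<omega>. F \<omega> * cnj (W q \<omega>)) = 0" "expectation (\<lambda>\<omega>. F \<omega> * cnj (I \<omega>)) = 0"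
proof -
  show *: "expectation (\<lambda>\<omega>. F \<omega> * cnj (W q \<omega>)) = 0" for q
  proof -
    obtain w s N where s: "\<And>i. 0 \<le> s i" and eq: "W q = increment_sum B w s N"
      using W unfolding noise_approx_def by blast
    show ?thesis unfolding eq by (rule increment_sum_orthogonal [OF F B 0 s])
  qed
  show "expectation (\<lambda>\<omega>. F \<omega> * cnj (I \<omega>)) = 0"
    by (rule noise_approx_moments(3) [OF W F *])
qed

text \<open>Limits are taken in one argument at a time: the limit \<open>I\<close> is tested against
  a fixed \<open>B' s'\<close>, then the limit \<open>I'\<close> against \<open>I\<close>.\<close>

lemma noise_integrals_orthogonal:
  assumes W: "noise_approx B V I W" and W': "noise_approx B' V' I' W'"
    and B: "\<And>s. 0 \<le> s \<Longrightarrow> square_integrable M (B s)" and B': "\<And>s. 0 \<le> s \<Longrightarrow> square_integrable M (B' s)"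
    and 0: "\<And>s s'. 0 \<le> s \<Longrightarrow> 0 \<le> s' \<Longrightarrow> expectation (\<lambda>\<omega>. B s \<omega> * cnj (B' s' \<omega>)) = 0"
  shows "expectation (\<lambda>\<omega>. I \<omega> * cnj (I' \<omega>)) = 0"
proof (rule noise_approx_orthogonal(2) [OF W' B' noise_approx_moments(1) [OF W]])
  fix s' :: real assume s': "0 \<le> s'"
  have "expectation (\<lambda>\<omega>. B' s' \<omega> * cnj (I \<omega>)) = 0"
    by (rule noise_approx_orthogonal(2) [OF W B B' [OF s']]) (auto intro: expectation_cnj_flip 0 s')
  then show "expectation (\<lambda>\<omega>. I \<omega> * cnj (B' s' \<omega>)) = 0" by (rule expectation_cnj_flip)
qed

lemma complex_fbm_square_integrable:
  assumes "complex_fbm M H A B" "0 \<le> s"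
  shows "square_integrable M (B s)" "expectation (B s) = 0"
proof -
  have f: "real_fbm M H A (\<lambda>s \<omega>. Re (B s \<omega>))" "real_fbm M H A (\<lambda>s \<omega>. Im (B s \<omega>))"
    using assms by (auto simp: complex_fbm_def)
  note s = fbm_square_integrable [OF f(1) assms(2)] fbm_square_integrable [OF f(2) assms(2)]
  have "square_integrable M (\<lambda>\<omega>. complex_of_real (Re (B s \<omega>)) + \<i> * complex_of_real (Im (B s \<omega>)))"
    by (intro square_integrable_add square_integrable_cmult square_integrable_of_real s)
  then show sq: "square_integrable M (B s)" by (simp flip: complex_eq)
  have i: "integrable M (B s)" by (rule square_integrable_integrable [OF sq])
  then show "expectation (B s) = 0"
    using fbm_expectation [OF f(1) assms(2)] fbm_expectation [OF f(2) assms(2)]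
    unfolding complex_eq_iff integral_Re [OF i, symmetric] integral_Im [OF i, symmetric] by simp
qed

text \<open>Evaluation at a time is measurable on path space, so independence of whole paths makes
  the expectation of the product factorise, and one factor has mean zero.\<close>

lemma indep_paths_orthogonal:
  fixes B :: "'i \<Rightarrow> real \<Rightarrow> 'a \<Rightarrow> complex"
  assumes ind: "indep_vars (\<lambda>_. Pi\<^sub>M {0..} (\<lambda>_. borel)) (\<lambda>i. sample_path (B i)) K"
    and ij: "i \<in> K" "j \<in> K" "i \<noteq> j"
    and sq: "square_integrable M (B i s)" "square_integrable M (B j s')" and z: "expectation (B i s) = 0"
    and s: "0 \<le> s" "0 \<le> s'"
  shows "expectation (\<lambda>\<omega>. B i s \<omega> * cnj (B j s' \<omega>)) = 0"
proof -
  \<comment> \<open>A single family of maps on paths: evaluation at \<open>s\<close> for the index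
    \<open>i\<close>, conjugated evaluation at \<open>s'\<close> for \<open>j\<close>.\<close>
  define Y where "Y k = (if k = i then (\<lambda>p. p s) else (\<lambda>p. cnj (p s')))" for k and p :: "real \<Rightarrow> complex"
  define Z where "Z k \<omega> = Y k (sample_path (B k) \<omega>)" for k \<omega>
  have Z: "Z i = B i s" "Z j = (\<lambda>\<omega>. cnj (B j s' \<omega>))"
    using ij s by (auto simp: Z_def Y_def sample_path_def fun_eq_iff)
  have sub: "indep_vars (\<lambda>_. Pi\<^sub>M {0..} (\<lambda>_. borel)) (\<lambda>i. sample_path (B i)) {i, j}"
    using ij by (intro indep_vars_subset [OF ind]) auto
  have c: "(\<lambda>p. p u) \<in> borel_measurable (Pi\<^sub>M {0..} (\<lambda>_. borel :: complex measure))" if "0 \<le> u" for u :: real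
    using that by (intro measurable_component_singleton) auto
  have "cnj \<in> borel_measurable borel" by (intro borel_measurable_continuous_onI continuous_on_cnj continuous_on_id)
  from measurable_compose [OF c [OF s(2)] this]
  have "Y k \<in> borel_measurable (Pi\<^sub>M {0..} (\<lambda>_. borel))" for k
    using c [OF s(1)] by (simp add: Y_def)
  from indep_vars_compose2 [OF sub this, of "\<lambda>k. k"]
  have "indep_vars (\<lambda>_. borel) Z {i, j}" by (simp only: Z_def [abs_def])
  moreover have "integrable M (Z k)" if "k \<in> {i, j}" for k
    using that Z square_integrable_integrable [OF sq(1)] square_integrable_integrable [OF square_integrable_cnj [OF sq(2)]]
    by auto
  ultimately have "expectation (\<lambda>\<omega>. \<Prod>k\<in>{i, j}. Z k \<omega>) = (\<Prod>k\<in>{i, j}. expectation (Z k))"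
    by (intro indep_vars_lebesgue_integral) auto
  then show ?thesis using ij(3) by (simp add: Z z)
qed

text \<open>Pythagoras in each of the three components. The orthogonality is that of the random
  coefficients, while the vectors \<open>v i\<close> are arbitrary; hence the identity is available
  at a single point of the sphere.\<close>

lemma expectation_norm2_orthogonal_sum:
  fixes a :: "'i \<Rightarrow> 'a \<Rightarrow> complex" and v :: "'i \<Rightarrow> complex^3"
  assumes K: "finite K" and a: "\<And>i. i \<in> K \<Longrightarrow> square_integrable M (a i)"
    and orth: "\<And>i j. i \<in> K \<Longrightarrow> j \<in> K \<Longrightarrow> i \<noteq> j \<Longrightarrow> expectation (\<lambda>\<omega>. a i \<omega> * cnj (a j \<omega>)) = 0"
  shows "integrable M (\<lambda>\<omega>. (norm (\<Sum>i\<in>K. a i \<omega> *s v i))\<^sup>2)"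
    and "expectation (\<lambda>\<omega>. (norm (\<Sum>i\<in>K. a i \<omega> *s v i))\<^sup>2)
      = (\<Sum>i\<in>K. expectation (\<lambda>\<omega>. (cmod (a i \<omega>))\<^sup>2) * (norm (v i))\<^sup>2)"
proof -
  let ?c = "\<lambda>k \<omega>. \<Sum>i\<in>K. v i $ k * a i \<omega>"
  have n2: "(norm u)\<^sup>2 = (\<Sum>k\<in>UNIV. (cmod (u $ k))\<^sup>2)" for u :: "complex^3"
    by (simp add: norm_vec_def L2_set_def sum_nonneg)
  have comp: "(\<Sum>i\<in>K. a i \<omega> *s v i) $ k = ?c k \<omega>" for \<omega> k
    by (simp add: mult.commute)
  have sq: "square_integrable M (?c k)" for k
    by (intro square_integrable_sum square_integrable_cmult a)
  have int: "integrable M (\<lambda>\<omega>. (cmod (?c k \<omega>))\<^sup>2)" for k using sq by (rule square_integrableD)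
  have eq: "(\<lambda>\<omega>. (norm (\<Sum>i\<in>K. a i \<omega> *s v i))\<^sup>2) = (\<lambda>\<omega>. \<Sum>k\<in>UNIV. (cmod (?c k \<omega>))\<^sup>2)"
    unfolding n2 comp ..
  show "integrable M (\<lambda>\<omega>. (norm (\<Sum>i\<in>K. a i \<omega> *s v i))\<^sup>2)"
    unfolding eq by (intro Bochner_Integration.integrable_sum int)
  have "expectation (\<lambda>\<omega>. (cmod (?c k \<omega>))\<^sup>2) = (\<Sum>i\<in>K. expectation (\<lambda>\<omega>. (cmod (a i \<omega>))\<^sup>2) * (cmod (v i $ k))\<^sup>2)" for k
  proof -
    have ii: "integrable M (\<lambda>\<omega>. (v i $ k * a i \<omega>) * cnj (v j $ k * a j \<omega>))" if "i \<in> K" "j \<in> K" for i j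
      using that by (intro square_integrable_mult square_integrable_cnj square_integrable_cmult a)
    have "complex_of_real (expectation (\<lambda>\<omega>. (cmod (?c k \<omega>))\<^sup>2)) = expectation (\<lambda>\<omega>. complex_of_real ((cmod (?c k \<omega>))\<^sup>2))"
      by (rule integral_complex_of_real [symmetric])
    also have "\<dots> = expectation (\<lambda>\<omega>. \<Sum>i\<in>K. \<Sum>j\<in>K. (v i $ k * a i \<omega>) * cnj (v j $ k * a j \<omega>))"
      unfolding complex_norm_square cnj_sum sum_product ..
    also have "\<dots> = (\<Sum>i\<in>K. expectation (\<lambda>\<omega>. \<Sum>j\<in>K. (v i $ k * a i \<omega>) * cnj (v j $ k * a j \<omega>)))"
      by (intro Bochner_Integration.integral_sum Bochner_Integration.integrable_sum ii)
    also have "\<dots> = (\<Sum>i\<in>K. \<Sum>j\<in>K. expectation (\<lambda>\<omega>. (v i $ k * a i \<omega>) * cnj (v j $ k * a j \<omega>)))"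
      by (intro sum.cong refl Bochner_Integration.integral_sum ii)
    also have "\<dots> = (\<Sum>i\<in>K. \<Sum>j\<in>K. if i = j then complex_of_real (expectation (\<lambda>\<omega>. (cmod (a i \<omega>))\<^sup>2) * (cmod (v i $ k))\<^sup>2) else 0)"
    proof (intro sum.cong refl)
      fix i j assume ij: "i \<in> K" "j \<in> K"
      have "expectation (\<lambda>\<omega>. (v i $ k * a i \<omega>) * cnj (v j $ k * a j \<omega>))
          = expectation (\<lambda>\<omega>. (v i $ k * cnj (v j $ k)) * (a i \<omega> * cnj (a j \<omega>)))"
        by (simp add: mult_ac)
      also have "\<dots> = (v i $ k * cnj (v j $ k)) * expectation (\<lambda>\<omega>. a i \<omega> * cnj (a j \<omega>))"
        by (rule integral_mult_right_zero)
      finally have e: "expectation (\<lambda>\<omega>. (v i $ k * a i \<omega>) * cnj (v j $ k * a j \<omega>))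
        = (v i $ k * cnj (v j $ k)) * expectation (\<lambda>\<omega>. a i \<omega> * cnj (a j \<omega>))" .
      have d: "expectation (\<lambda>\<omega>. a i \<omega> * cnj (a i \<omega>)) = complex_of_real (expectation (\<lambda>\<omega>. (cmod (a i \<omega>))\<^sup>2))"
        unfolding complex_norm_square [symmetric] by (rule integral_complex_of_real)
      show "expectation (\<lambda>\<omega>. (v i $ k * a i \<omega>) * cnj (v j $ k * a j \<omega>))
        = (if i = j then complex_of_real (expectation (\<lambda>\<omega>. (cmod (a i \<omega>))\<^sup>2) * (cmod (v i $ k))\<^sup>2) else 0)"
        unfolding e using orth [OF ij] d by (auto simp: complex_norm_square mult.commute simp del: of_real_power)
    qed
    also have "\<dots> = complex_of_real (\<Sum>i\<in>K. expectation (\<lambda>\<omega>. (cmod (a i \<omega>))\<^sup>2) * (cmod (v i $ k))\<^sup>2)"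
      using K by (simp add: sum.delta)
    finally show ?thesis by (simp only: of_real_eq_iff)
  qed
  then have "expectation (\<lambda>\<omega>. \<Sum>k\<in>UNIV. (cmod (?c k \<omega>))\<^sup>2)
      = (\<Sum>k\<in>UNIV. \<Sum>i\<in>K. expectation (\<lambda>\<omega>. (cmod (a i \<omega>))\<^sup>2) * (cmod (v i $ k))\<^sup>2)"
    by (subst Bochner_Integration.integral_sum [OF int]) simp
  also have "\<dots> = (\<Sum>i\<in>K. expectation (\<lambda>\<omega>. (cmod (a i \<omega>))\<^sup>2) * (norm (v i))\<^sup>2)"
    unfolding n2 sum_distrib_left by (rule sum.swap)
  finally show "expectation (\<lambda>\<omega>. (norm (\<Sum>i\<in>K. a i \<omega> *s v i))\<^sup>2)
      = (\<Sum>i\<in>K. expectation (\<lambda>\<omega>. (cmod (a i \<omega>))\<^sup>2) * (norm (v i))\<^sup>2)"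
    unfolding eq .
qed

end

text \<open>The mean value theorem compares each term with a difference of consecutive values of
  \<open>y powr (- (\<nu> - 2))\<close>, and these telescope. The finitely many
  \<open>L < l0\<close> are absorbed in the constant, since no tail exceeds
  \<open>T 0\<close>.\<close>

lemma tail_le_powr:
  fixes D :: "nat \<Rightarrow> real"
  assumes D0: "\<And>l. 1 \<le> l \<Longrightarrow> 0 \<le> D l" and sm: "summable (\<lambda>l. (2 * real l + 1) * D l)"
    and nu: "2 < \<nu>" and C0: "0 < C0" and l0: "1 \<le> l0" and decay: "\<And>l. l0 \<le> l \<Longrightarrow> D l \<le> C0 * real l powr (- \<nu>)"
  obtains C where "0 < C" "\<And>L. 1 \<le> L \<Longrightarrow> (\<Sum>k. (2 * real (L + 1 + k) + 1) * D (L + 1 + k)) \<le> C * real L powr (- (\<nu> - 2))"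
proof -
  define T where "T L = (\<Sum>k. (2 * real (L + 1 + k) + 1) * D (L + 1 + k))" for L
  have sL: "summable (\<lambda>k. (2 * real (L + 1 + k) + 1) * D (L + 1 + k))" for L
    using summable_ignore_initial_segment [OF sm, of "L + 1"] by (simp add: add.commute add.left_commute)
  have t0: "0 \<le> (2 * real (L + 1 + k) + 1) * D (L + 1 + k)" for L k
    by (intro mult_nonneg_nonneg D0) auto
  have T0: "0 \<le> T L" for L unfolding T_def by (intro suminf_nonneg sL t0)
  have Tmono: "T L \<le> T 0" for L
  proof -
    have "T 0 = (\<Sum>k. (2 * real (0 + 1 + (k + L)) + 1) * D (0 + 1 + (k + L))) + (\<Sum>k<L. (2 * real (0 + 1 + k) + 1) * D (0 + 1 + k))"
      unfolding T_def by (rule suminf_split_initial_segment [OF sL])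
    moreover have "0 \<le> (\<Sum>k<L. (2 * real (0 + 1 + k) + 1) * D (0 + 1 + k))" by (intro sum_nonneg t0)
    moreover have "(\<Sum>k. (2 * real (0 + 1 + (k + L)) + 1) * D (0 + 1 + (k + L))) = T L"
      unfolding T_def by (simp add: add.commute add.left_commute)
    ultimately show ?thesis by linarith
  qed
  define p where "p = \<nu> - 2"
  have p: "0 < p" using nu by (simp add: p_def)
  \<comment> \<open>The 3 comes from \<open>2 * l + 1 \<le> 3 * l\<close>, the denominator
    \<open>p\<close> from the derivative of \<open>y powr (- p)\<close>.\<close>
  define g where "g L k = 3 * C0 / p * (real (L + k) powr (- p) - real (L + (k + 1)) powr (- p))" for L k
  have gs: "(\<lambda>k. g L k) sums (3 * C0 / p * real L powr (- p))" for L
  proof -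
    have "filterlim (\<lambda>k. real (L + k)) at_top sequentially"
      by (intro filterlim_compose [OF filterlim_real_sequentially] filterlim_subseq) (auto simp: strict_mono_def)
    then have "(\<lambda>k. real (L + k) powr (- p)) \<longlonglongrightarrow> 0"
      using p by (intro tendsto_neg_powr) auto
    from telescope_sums' [OF this]
    have "(\<lambda>k. real (L + k) powr (- p) - real (L + Suc k) powr (- p)) sums (real (L + 0) powr (- p) - 0)" .
    then have "(\<lambda>k. 3 * C0 / p * (real (L + k) powr (- p) - real (L + Suc k) powr (- p))) sums (3 * C0 / p * (real (L + 0) powr (- p) - 0))"
      by (rule sums_mult)
    then show ?thesis by (simp add: g_def)
  qed
  have term_le: "(2 * real (L + 1 + k) + 1) * D (L + 1 + k) \<le> g L k" if "l0 \<le> L" for L k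
  proof -
    define y where "y = real (L + k)"
    have "1 \<le> L + k" using that l0 by linarith
    then have "real 1 \<le> real (L + k)" by (simp only: of_nat_le_iff)
    then have y: "1 \<le> y" by (simp add: y_def)
    have l: "real (L + 1 + k) = y + 1" by (simp add: y_def)
    have "(2 * real (L + 1 + k) + 1) * D (L + 1 + k) \<le> (3 * (y + 1)) * (C0 * (y + 1) powr (- \<nu>))"
    proof -
      have "D (L + 1 + k) \<le> C0 * (y + 1) powr (- \<nu>)"
        unfolding l [symmetric] using that by (intro decay) simp
      then show ?thesis using D0 [of "L + 1 + k"] y unfolding l by (intro mult_mono) auto
    qed
    also have "\<dots> = 3 * C0 * ((y + 1) powr 1 * (y + 1) powr (- \<nu>))" using y by simp
    also have "(y + 1) powr 1 * (y + 1) powr (- \<nu>) = (y + 1) powr (- p - 1)"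
      unfolding powr_add [symmetric] by (simp add: p_def)
    also have "3 * C0 * (y + 1) powr (- p - 1) \<le> 3 * C0 * ((y powr (- p) - (y + 1) powr (- p)) / p)"
    proof -
      have "\<exists>z. z > y \<and> z < y + 1 \<and> (y + 1) powr (- p) - y powr (- p) = (y + 1 - y) * (- p * z powr (- p - 1))"
        using y by (intro MVT2) (auto intro!: derivative_eq_intros)
      then obtain z where z: "y < z" "z < y + 1" and e: "(y + 1) powr (- p) - y powr (- p) = - p * z powr (- p - 1)" by auto
      have "(y + 1) powr (- p - 1) \<le> z powr (- p - 1)" using z y p by (intro powr_mono2') auto
      also have "\<dots> = (y powr (- p) - (y + 1) powr (- p)) / p" using e p by (simp add: field_simps)
      finally show ?thesis using C0 by (intro mult_left_mono) auto
    qed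
    also have "\<dots> = g L k" by (simp add: g_def y_def add_ac)
    finally show ?thesis .
  qed
  have big: "T L \<le> 3 * C0 / p * real L powr (- p)" if "l0 \<le> L" for L
    unfolding T_def sums_unique [OF gs] by (intro suminf_le term_le that sL sums_summable [OF gs])
  \<comment> \<open>The second summand serves \<open>L < l0\<close>, where
    \<open>T L \<le> T 0\<close> and \<open>(l0 / L) powr p \<ge> 1\<close>.\<close>
  define C where "C = 3 * C0 / p + T 0 * real l0 powr p + 1"
  have C: "0 < C" "3 * C0 / p \<le> C" "T 0 * real l0 powr p \<le> C"
    using C0 p T0 [of 0] by (auto simp: C_def add_nonneg_pos)
  have "T L \<le> C * real L powr (- p)" if L: "1 \<le> L" for L
  proof (cases "l0 \<le> L")
    case True
    then show ?thesis using big [OF True] C(2) by (intro order_trans [OF big [OF True]] mult_right_mono) auto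
  next
    case False
    have "1 \<le> real l0 powr p * real L powr (- p)"
    proof -
      have "1 \<le> (real l0 / real L) powr p" using False L p by (intro ge_one_powr_ge_zero) auto
      also have "\<dots> = real l0 powr p * real L powr (- p)" using L by (simp add: powr_divide powr_minus_divide)
      finally show ?thesis .
    qed
    then have "T 0 * 1 \<le> T 0 * (real l0 powr p * real L powr (- p))" using T0 by (intro mult_left_mono)
    also have "\<dots> = T 0 * real l0 powr p * real L powr (- p)" by simp
    also have "\<dots> \<le> C * real L powr (- p)" using C by (intro mult_right_mono) auto
    finally show ?thesis using Tmono [of L] by simp
  qed
  with C(1) show thesis unfolding T_def p_def by (rule that)
qed

section \<open>Truncation error\<close>

lemma measurable_scalar_mult_vec [measurable (raw)]:
  fixes f :: "'c \<Rightarrow> complex" and g :: "'c \<Rightarrow> complex^3"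
  assumes "f \<in> borel_measurable N" "g \<in> borel_measurable N"
  shows "(\<lambda>p. f p *s g p) \<in> borel_measurable N"
proof (rule borel_measurable_continuous_Pair [OF assms])
  show "continuous_on UNIV (\<lambda>p :: complex \<times> (complex^3). fst p *s snd p)"
    unfolding vector_scalar_mult_def
    by (intro continuous_on_vec_lambda continuous_on_mult continuous_on_fst continuous_on_snd continuous_on_component continuous_on_id)
qed

lemma sum_bool_Sigma:
  assumes "finite A" "\<And>l. l \<in> A \<Longrightarrow> finite (B l)"
  shows "(\<Sum>i\<in>(UNIV :: bool set) \<times> Sigma A B. f i) = (\<Sum>l\<in>A. \<Sum>m\<in>B l. f (True, l, m) + f (False, l, m))"
proof -
  have "(\<Sum>i\<in>(UNIV :: bool set) \<times> Sigma A B. f i) = (\<Sum>b\<in>UNIV. \<Sum>p\<in>Sigma A B. f (b, p))"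
    by (simp add: sum.cartesian_product)
  also have "\<dots> = (\<Sum>p\<in>Sigma A B. f (True, p) + f (False, p))"
    by (simp add: UNIV_bool sum.distrib add.commute)
  also have "\<dots> = (\<Sum>l\<in>A. \<Sum>m\<in>B l. f (True, l, m) + f (False, l, m))"
    using assms by (subst sum.Sigma) (auto intro!: sum.cong)
  finally show ?thesis .
qed

section \<open>Second moments of the remainder\<close>

context prob_space
begin

text \<open>\<open>L2_norm_field\<close> is an iterated Bochner integral, which defaults to 0 where
  integrability fails; finiteness in the extended reals rules this out and lets Fubini's theorem
  exchange the order of integration.\<close>

lemma L2_norm_field_nn_integral:
  assumes G: "(\<lambda>p. G (fst p) (snd p)) \<in> borel_measurable (M \<Otimes>\<^sub>M sphere_measure)"
    and fin: "(\<integral>\<^sup>+x. \<integral>\<^sup>+\<omega>. ennreal ((norm (G \<omega> x :: complex^3))\<^sup>2) \<partial>M \<partial>sphere_measure) < \<infinity>"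
  shows "ennreal ((L2_norm_field M G)\<^sup>2) = (\<integral>\<^sup>+x. \<integral>\<^sup>+\<omega>. ennreal ((norm (G \<omega> x))\<^sup>2) \<partial>M \<partial>sphere_measure)"
proof -
  interpret pair_sigma_finite M sphere_measure ..
  let ?f = "\<lambda>p. (norm (G (fst p) (snd p)))\<^sup>2"
  have fm [measurable]: "?f \<in> borel_measurable (M \<Otimes>\<^sub>M sphere_measure)" using G by measurable
  have eq: "(\<integral>\<^sup>+x. \<integral>\<^sup>+\<omega>. ennreal ((norm (G \<omega> x))\<^sup>2) \<partial>M \<partial>sphere_measure) = (\<integral>\<^sup>+p. ennreal (?f p) \<partial>(M \<Otimes>\<^sub>M sphere_measure))"
    using nn_integral_snd [of "\<lambda>p. ennreal (?f p)"] by simp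
  have int: "integrable (M \<Otimes>\<^sub>M sphere_measure) ?f"
    using fin unfolding eq by (intro integrableI_bounded) auto
  have "(LINT \<omega>|M. LINT x|sphere_measure. (norm (G \<omega> x))\<^sup>2) = integral\<^sup>L (M \<Otimes>\<^sub>M sphere_measure) ?f"
    using integral_fst' [OF int] by simp
  moreover have "0 \<le> integral\<^sup>L (M \<Otimes>\<^sub>M sphere_measure) ?f" by simp
  ultimately have "(L2_norm_field M G)\<^sup>2 = integral\<^sup>L (M \<Otimes>\<^sub>M sphere_measure) ?f"
    by (simp add: L2_norm_field_def)
  then show ?thesis unfolding eq using int by (simp add: nn_integral_eq_integral)
qed

text \<open>Differences of partial sums are bounded at every point by the addition theorem, with a
  bound free of the upper index \<open>N\<close>. Large \<open>N\<close> transfer it to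
  \<open>X\<close> wherever \<open>S N\<close> comes arbitrarily close in mean square. In the
  constant 4 one factor 2 counts the two families of fields, the other is the price of splitting
  \<open>X - S L\<close> at \<open>S N\<close>.\<close>

lemma truncation_error:
  fixes a :: "bool \<times> nat \<times> int \<Rightarrow> 'a \<Rightarrow> complex" and V :: "nat \<Rightarrow> real"
  assumes basis: "spherical_harmonic_basis Y"
    and a: "\<And>i. snd i \<in> harmonic_index \<Longrightarrow> square_integrable M (a i)"
    and orth: "\<And>i j. snd i \<in> harmonic_index \<Longrightarrow> snd j \<in> harmonic_index \<Longrightarrow> i \<noteq> j \<Longrightarrow>
      expectation (\<lambda>\<omega>. a i \<omega> * cnj (a j \<omega>)) = 0"
    and var: "\<And>b l m. (l, m) \<in> harmonic_index \<Longrightarrow> expectation (\<lambda>\<omega>. (cmod (a (b, l, m) \<omega>))\<^sup>2) \<le> V l"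
    and sm: "summable (\<lambda>l. (2 * real l + 1) * V l)"
    and S: "\<And>N \<omega> x. S N \<omega> x = (\<Sum>l=1..N. \<Sum>m=- int l..int l.
      a (True, l, m) \<omega> *s vsh_y Y l m x + a (False, l, m) \<omega> *s vsh_z Y l m x)"
    and X: "is_L2_field_sum M S X"
  defines "T L \<equiv> \<Sum>k. (2 * real (L + 1 + k) + 1) * V (L + 1 + k)"
  shows "L2_norm_field M (\<lambda>\<omega> x. X \<omega> x - S L \<omega> x) \<le> sqrt (4 * T L)"
    and "AE x in sphere_measure. \<forall>\<epsilon>>0. \<forall>L.
      measure M {\<omega>\<in>space M. \<epsilon> \<le> norm (X \<omega> x - S L \<omega> x)} \<le> 4 / sphere_area * T L / \<epsilon>\<^sup>2"
    and "\<forall>x\<in>sphere 0 1. is_L2_sum_at M S X x \<longrightarrow> (\<forall>\<epsilon>>0. \<forall>L.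
      measure M {\<omega>\<in>space M. \<epsilon> \<le> norm (X \<omega> x - S L \<omega> x)} \<le> 4 / sphere_area * T L / \<epsilon>\<^sup>2)"
proof -
  obtain P where "harmonic_basis Y P" using harmonic_basis_exists [OF basis] .
  then interpret harmonic_basis Y P .
  interpret pair_sigma_finite M sphere_measure ..
  define v where "v i x = (case i of (b, l, m) \<Rightarrow> if b then vsh_y Y l m x else vsh_z Y l m x)" for i x
  define K where "K L N = (UNIV :: bool set) \<times> (SIGMA l:{Suc L..N}. {- int l..int l})" for L N
  have Kfin: "finite (K L N)" for L N by (simp add: K_def)
  have Kidx: "snd i \<in> harmonic_index" if "i \<in> K L N" for i L N
    using that by (auto simp: K_def harmonic_index_def)
  have V0: "0 \<le> V l" if "1 \<le> l" for l
    using that by (intro order_trans [OF _ var [of l 0 True]]) (auto simp: harmonic_index_def)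
  have Ssum: "S N \<omega> x = (\<Sum>i\<in>K 0 N. a i \<omega> *s v i x)" for N \<omega> x
    unfolding S K_def by (subst sum_bool_Sigma) (simp_all add: v_def)
  have Sdiff: "S N \<omega> x - S L \<omega> x = (\<Sum>i\<in>K L N. a i \<omega> *s v i x)" if "L \<le> N" for L N \<omega> x
  proof -
    let ?f = "\<lambda>l. \<Sum>m=- int l..int l. a (True, l, m) \<omega> *s vsh_y Y l m x + a (False, l, m) \<omega> *s vsh_z Y l m x"
    have "{1..N} - {1..L} = {Suc L..N}" by auto
    then have "S N \<omega> x - S L \<omega> x = (\<Sum>l\<in>{Suc L..N}. ?f l)"
      unfolding S using that sum_diff [of "{1..N}" "{1..L}" ?f] by simp
    then show ?thesis unfolding K_def by (subst sum_bool_Sigma) (simp_all add: v_def)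
  qed
  have vm: "v i \<in> borel_measurable sphere_measure" if "snd i \<in> harmonic_index" for i
    using that continuous_on_vsh [THEN continuous_measurable_sphere]
    by (cases i) (auto simp: v_def [abs_def] harmonic_index_def)
  have am: "a i \<in> borel_measurable M" if "snd i \<in> harmonic_index" for i
    using a [OF that] by (simp add: square_integrable_def)
  have Sm: "(\<lambda>p. S N (fst p) (snd p)) \<in> borel_measurable (M \<Otimes>\<^sub>M sphere_measure)" for N
    unfolding Ssum
    by (intro borel_measurable_sum measurable_scalar_mult_vec measurable_compose [OF measurable_fst am]
      measurable_compose [OF measurable_snd vm] Kidx)
  have Xm: "(\<lambda>p. X (fst p) (snd p)) \<in> borel_measurable (M \<Otimes>\<^sub>M sphere_measure)"
    and Xi: "integrable (M \<Otimes>\<^sub>M sphere_measure) (\<lambda>p. (norm (X (fst p) (snd p)))\<^sup>2)"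
    using X by (auto simp: is_L2_field_sum_def random_tangent_L2_def case_prod_beta')
  have sect: "(\<lambda>\<omega>. G \<omega> x) \<in> borel_measurable M"
    if "(\<lambda>p. G (fst p) (snd p)) \<in> borel_measurable (M \<Otimes>\<^sub>M sphere_measure)" "x \<in> sphere 0 1" for G :: "'a \<Rightarrow> real^3 \<Rightarrow> complex^3" and x
    using measurable_compose [OF measurable_Pair2' [of x sphere_measure M] that(1)] that(2) by simp
  define E where "E G x = (\<integral>\<^sup>+\<omega>. ennreal ((norm (G \<omega> x :: complex^3))\<^sup>2) \<partial>M)" for G and x :: "real^3"
  have Em: "E G \<in> borel_measurable sphere_measure"
    if "(\<lambda>p. G (fst p) (snd p)) \<in> borel_measurable (M \<Otimes>\<^sub>M sphere_measure)" for G
  proof -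
    have "(\<lambda>p. ennreal ((norm (G (fst p) (snd p)))\<^sup>2)) \<in> borel_measurable (M \<Otimes>\<^sub>M sphere_measure)"
      using that by measurable
    from sigma_finite_measure.borel_measurable_nn_integral_fst [OF prob_space_imp_sigma_finite [OF prob_space_axioms] measurable_pair_swap [OF this]] show ?thesis
      unfolding E_def [abs_def] by simp
  qed
  have E_add: "E (\<lambda>\<omega> x. G \<omega> x + G' \<omega> x) x \<le> 2 * E G x + 2 * E G' x"
    if "(\<lambda>\<omega>. G \<omega> x) \<in> borel_measurable M" "(\<lambda>\<omega>. G' \<omega> x) \<in> borel_measurable M" for G G' x
  proof -
    note [measurable] = that
    have "E (\<lambda>\<omega> x. G \<omega> x + G' \<omega> x) x \<le> (\<integral>\<^sup>+\<omega>. 2 * ennreal ((norm (G \<omega> x))\<^sup>2) + 2 * ennreal ((norm (G' \<omega> x))\<^sup>2) \<partial>M)"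
      unfolding E_def
    proof (intro nn_integral_mono)
      fix \<omega>
      have "ennreal ((norm (G \<omega> x + G' \<omega> x))\<^sup>2) \<le> ennreal (2 * (norm (G \<omega> x))\<^sup>2 + 2 * (norm (G' \<omega> x))\<^sup>2)"
        by (intro ennreal_leI norm_add_square_le)
      then show "ennreal ((norm (G \<omega> x + G' \<omega> x))\<^sup>2) \<le> 2 * ennreal ((norm (G \<omega> x))\<^sup>2) + 2 * ennreal ((norm (G' \<omega> x))\<^sup>2)"
        by (simp add: ennreal_plus ennreal_mult)
    qed
    also have "\<dots> = 2 * E G x + 2 * E G' x"
      unfolding E_def by (subst nn_integral_add) (auto simp: nn_integral_cmult)
    finally show ?thesis .
  qed
  have Tsum: "summable (\<lambda>k. (2 * real (L + 1 + k) + 1) * V (L + 1 + k))" for L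
    using summable_ignore_initial_segment [OF sm, of "L + 1"] by (simp add: add.commute add.left_commute)
  have Tterm: "0 \<le> (2 * real (L + 1 + k) + 1) * V (L + 1 + k)" for L k
    by (intro mult_nonneg_nonneg V0) auto
  have T0: "0 \<le> T L" for L unfolding T_def by (intro suminf_nonneg Tsum Tterm)
  have partial: "(\<Sum>l=Suc L..N. (2 * real l + 1) * V l) \<le> T L" for L N
  proof -
    have "(\<Sum>l=Suc L..N. (2 * real l + 1) * V l) = (\<Sum>k\<in>{..<N - L}. (2 * real (L + 1 + k) + 1) * V (L + 1 + k))"
      by (rule sum.reindex_bij_witness [of _ "\<lambda>k. L + 1 + k" "\<lambda>l. l - (L + 1)"]) auto
    also have "\<dots> \<le> T L"
      unfolding T_def by (intro sum_le_suminf Tsum Tterm) auto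
    finally show ?thesis .
  qed
  have pointwise: "E (\<lambda>\<omega> x. S N \<omega> x - S L \<omega> x) x \<le> ennreal (2 / sphere_area * T L)"
    if "L \<le> N" and x: "x \<in> sphere 0 1" for L N x
  proof -
    note o = expectation_norm2_orthogonal_sum [where K = "K L N" and a = a and v = "\<lambda>i. v i x", OF Kfin a [OF Kidx] orth [OF Kidx Kidx]]
    have "expectation (\<lambda>\<omega>. (norm (S N \<omega> x - S L \<omega> x))\<^sup>2)
        = (\<Sum>i\<in>K L N. expectation (\<lambda>\<omega>. (cmod (a i \<omega>))\<^sup>2) * (norm (v i x))\<^sup>2)"
      unfolding Sdiff [OF that(1)] by (rule o(2))
    also have "\<dots> = (\<Sum>l=Suc L..N. \<Sum>m=- int l..int l. expectation (\<lambda>\<omega>. (cmod (a (True, l, m) \<omega>))\<^sup>2) * (norm (vsh_y Y l m x))\<^sup>2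
        + expectation (\<lambda>\<omega>. (cmod (a (False, l, m) \<omega>))\<^sup>2) * (norm (vsh_z Y l m x))\<^sup>2)"
      unfolding K_def by (subst sum_bool_Sigma) (simp_all add: v_def)
    also have "\<dots> \<le> (\<Sum>l=Suc L..N. \<Sum>m=- int l..int l. V l * (norm (vsh_y Y l m x))\<^sup>2 + V l * (norm (vsh_z Y l m x))\<^sup>2)"
      by (intro sum_mono add_mono mult_right_mono var) (auto simp: harmonic_index_def)
    also have "\<dots> = (\<Sum>l=Suc L..N. 2 / sphere_area * ((2 * real l + 1) * V l))"
    proof (intro sum.cong refl)
      fix l assume "l \<in> {Suc L..N}"
      then have l: "1 \<le> l" by simp
      show "(\<Sum>m=- int l..int l. V l * (norm (vsh_y Y l m x))\<^sup>2 + V l * (norm (vsh_z Y l m x))\<^sup>2)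
          = 2 / sphere_area * ((2 * real l + 1) * V l)"
        unfolding sum.distrib sum_distrib_left [symmetric] vector_addition_theorem [OF x l] by simp
    qed
    also have "\<dots> \<le> 2 / sphere_area * T L"
      unfolding sum_distrib_left [symmetric] using sphere_area_pos by (intro mult_left_mono partial) auto
    finally have "expectation (\<lambda>\<omega>. (norm (S N \<omega> x - S L \<omega> x))\<^sup>2) \<le> 2 / sphere_area * T L" .
    moreover have "E (\<lambda>\<omega> x. S N \<omega> x - S L \<omega> x) x = ennreal (expectation (\<lambda>\<omega>. (norm (S N \<omega> x - S L \<omega> x))\<^sup>2))"
      unfolding E_def using o(1) by (intro nn_integral_eq_integral) (auto simp: Sdiff [OF that(1)])
    ultimately show ?thesis by (simp add: ennreal_leI)
  qed
  define err where "err L = E (\<lambda>\<omega> x. X \<omega> x - S L \<omega> x)" for L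
  have XSm: "(\<lambda>p. X (fst p) (snd p) - S L (fst p) (snd p)) \<in> borel_measurable (M \<Otimes>\<^sub>M sphere_measure)" for L
    by (intro borel_measurable_diff Xm Sm)
  have step: "err L x \<le> 2 * err N x + ennreal (4 / sphere_area * T L)" if "L \<le> N" "x \<in> sphere 0 1" for L N x
  proof -
    have "E (\<lambda>\<omega> x. (X \<omega> x - S N \<omega> x) + (S N \<omega> x - S L \<omega> x)) x
        \<le> 2 * err N x + 2 * E (\<lambda>\<omega> x. S N \<omega> x - S L \<omega> x) x"
      unfolding err_def by (rule E_add) (intro borel_measurable_diff sect [OF Xm that(2)] sect [OF Sm that(2)])+
    also have "\<dots> \<le> 2 * err N x + 2 * ennreal (2 / sphere_area * T L)"
      by (intro add_left_mono mult_left_mono pointwise that) simp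
    also have "2 * ennreal (2 / sphere_area * T L) = ennreal (4 / sphere_area * T L)"
      using T0 [of L] ennreal_mult' [of 2 "2 / sphere_area * T L"] by simp
    finally show ?thesis by (simp add: err_def)
  qed
  \<comment> \<open>Some \<open>N\<close> beyond \<open>L\<close> with small \<open>err N x\<close>
    is enough, so a lower limit equal to 0 suffices at \<open>x\<close>.\<close>
  have err_le: "err L x \<le> ennreal (4 / sphere_area * T L)"
    if x: "x \<in> sphere 0 1" and small: "\<And>\<epsilon>. 0 < \<epsilon> \<Longrightarrow> \<exists>N\<ge>L. err N x \<le> ennreal \<epsilon>" for L x
  proof (rule ennreal_le_epsilon)
    fix e :: real assume e: "0 < e"
    then obtain N where N: "L \<le> N" "err N x \<le> ennreal (e / 2)" using small [of "e / 2"] by auto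
    have "err L x \<le> 2 * err N x + ennreal (4 / sphere_area * T L)" by (rule step [OF N(1) x])
    also have "\<dots> \<le> 2 * ennreal (e / 2) + ennreal (4 / sphere_area * T L)"
      by (intro add_right_mono mult_left_mono N) simp
    also have "2 * ennreal (e / 2) = ennreal e"
      using e ennreal_mult' [of 2 "e / 2"] by simp
    finally show "err L x \<le> ennreal (4 / sphere_area * T L) + ennreal e" by (simp add: add.commute)
  qed
  \<comment> \<open>Finiteness turns the norm into an integral of \<open>err L\<close>. As
    \<open>S 0\<close> is the empty sum, \<open>S L\<close> itself falls under
    \<open>pointwise\<close>.\<close>
  have fin: "(\<integral>\<^sup>+x. err L x \<partial>sphere_measure) < \<infinity>" for L
  proof -
    have S0: "S 0 \<omega> x = 0" for \<omega> x unfolding S by simp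
    have "(\<integral>\<^sup>+x. err L x \<partial>sphere_measure) \<le> (\<integral>\<^sup>+x. 2 * E X x + ennreal (4 / sphere_area * T 0) \<partial>sphere_measure)"
    proof (intro nn_integral_mono)
      fix x assume "x \<in> space sphere_measure"
      then have x: "x \<in> sphere 0 1" by simp
      have "E (\<lambda>\<omega> x. X \<omega> x + - (S L \<omega> x - S 0 \<omega> x)) x \<le> 2 * E X x + 2 * E (\<lambda>\<omega> x. - (S L \<omega> x - S 0 \<omega> x)) x"
        by (rule E_add) (intro borel_measurable_uminus borel_measurable_diff sect [OF Xm x] sect [OF Sm x])+
      also have "E (\<lambda>\<omega> x. - (S L \<omega> x - S 0 \<omega> x)) x = E (\<lambda>\<omega> x. S L \<omega> x - S 0 \<omega> x) x"
        unfolding E_def norm_minus_cancel ..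
      also have "2 * E X x + 2 * E (\<lambda>\<omega> x. S L \<omega> x - S 0 \<omega> x) x \<le> 2 * E X x + 2 * ennreal (2 / sphere_area * T 0)"
        by (intro add_left_mono mult_left_mono pointwise x) auto
      also have "2 * ennreal (2 / sphere_area * T 0) = ennreal (4 / sphere_area * T 0)"
        using T0 [of 0] ennreal_mult' [of 2 "2 / sphere_area * T 0"] by simp
      finally show "err L x \<le> 2 * E X x + ennreal (4 / sphere_area * T 0)" by (simp add: err_def S0)
    qed
    also have "\<dots> = 2 * (\<integral>\<^sup>+x. E X x \<partial>sphere_measure) + ennreal (4 / sphere_area * T 0) * emeasure sphere_measure (space sphere_measure)"
      using Em [OF Xm] by (subst nn_integral_add) (auto simp: nn_integral_cmult)
    also have "(\<integral>\<^sup>+x. E X x \<partial>sphere_measure) = (\<integral>\<^sup>+p. ennreal ((norm (X (fst p) (snd p)))\<^sup>2) \<partial>(M \<Otimes>\<^sub>M sphere_measure))"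
      unfolding E_def using nn_integral_snd [of "\<lambda>p. ennreal ((norm (X (fst p) (snd p)))\<^sup>2)"] Xm by simp
    also have "2 * \<dots> + ennreal (4 / sphere_area * T 0) * emeasure sphere_measure (space sphere_measure) < \<infinity>"
      using Xi by (simp add: nn_integral_eq_integral sphere.emeasure_eq_measure ennreal_mult_less_top)
    finally show ?thesis .
  qed
  have L2: "ennreal ((L2_norm_field M (\<lambda>\<omega> x. X \<omega> x - S L \<omega> x))\<^sup>2) = (\<integral>\<^sup>+x. err L x \<partial>sphere_measure)" for L
    using L2_norm_field_nn_integral [of "\<lambda>\<omega> x. X \<omega> x - S L \<omega> x", OF XSm] fin [of L] unfolding err_def E_def by simp
  have errm: "err L \<in> borel_measurable sphere_measure" for L
    unfolding err_def by (rule Em [OF XSm])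
  have "(\<integral>\<^sup>+x. liminf (\<lambda>N. err N x) \<partial>sphere_measure) \<le> liminf (\<lambda>N. \<integral>\<^sup>+x. err N x \<partial>sphere_measure)"
    by (rule nn_integral_liminf) (rule errm)
  also have "\<dots> = 0"
  proof -
    have "(\<lambda>N. (L2_norm_field M (\<lambda>\<omega> x. X \<omega> x - S N \<omega> x))\<^sup>2) \<longlonglongrightarrow> 0\<^sup>2"
      using X unfolding is_L2_field_sum_def by (intro tendsto_power) simp
    then have "(\<lambda>N. \<integral>\<^sup>+x. err N x \<partial>sphere_measure) \<longlonglongrightarrow> ennreal 0"
      unfolding L2 [symmetric] by (intro tendsto_ennrealI) simp
    from lim_imp_Liminf [OF sequentially_bot this] show ?thesis by simp
  qed
  finally have "(\<integral>\<^sup>+x. liminf (\<lambda>N. err N x) \<partial>sphere_measure) = 0" by simp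
  then have "AE x in sphere_measure. liminf (\<lambda>N. err N x) = 0"
    by (subst (asm) nn_integral_0_iff_AE) (use errm in measurable)
  \<comment> \<open>By Fatou's lemma convergence in norm forces the lower limit of
    \<open>err N x\<close> to be 0 almost everywhere, which supplies the indices \<open>N\<close>
    for \<open>err_le\<close>.\<close>
  then have AEerr: "AE x in sphere_measure. \<forall>L. err L x \<le> ennreal (4 / sphere_area * T L)"
    using AE_space
  proof eventually_elim
    case (elim x)
    have "\<exists>N\<ge>L. err N x \<le> ennreal \<epsilon>" if "0 < \<epsilon>" for L \<epsilon>
    proof (rule ccontr)
      assume "\<not> (\<exists>N\<ge>L. err N x \<le> ennreal \<epsilon>)"
      then have "\<forall>\<^sub>F N in sequentially. ennreal \<epsilon> \<le> err N x"
        unfolding eventually_sequentially by (meson linear)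
      then have "ennreal \<epsilon> \<le> liminf (\<lambda>N. err N x)" by (rule Liminf_bounded)
      then show False using elim(1) that by simp
    qed
    then show ?case using err_le [of x] elim(2) by simp
  qed
  have markov: "measure M {\<omega>\<in>space M. \<epsilon> \<le> norm (X \<omega> x - S L \<omega> x)} \<le> 4 / sphere_area * T L / \<epsilon>\<^sup>2"
    if x: "x \<in> sphere 0 1" and e: "0 < \<epsilon>" and le: "err L x \<le> ennreal (4 / sphere_area * T L)" for x \<epsilon> L
  proof -
    have [measurable]: "(\<lambda>\<omega>. X \<omega> x - S L \<omega> x) \<in> borel_measurable M"
      by (intro borel_measurable_diff sect [OF Xm x] sect [OF Sm x])
    let ?A = "{\<omega>\<in>space M. \<epsilon> \<le> norm (X \<omega> x - S L \<omega> x)}"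
    have "ennreal (\<epsilon>\<^sup>2 * measure M ?A) = (\<integral>\<^sup>+\<omega>. ennreal (\<epsilon>\<^sup>2) * indicator ?A \<omega> \<partial>M)"
      by (subst nn_integral_cmult_indicator) (auto simp: emeasure_eq_measure ennreal_mult)
    also have "\<dots> \<le> err L x"
      unfolding err_def E_def using e
      by (intro nn_integral_mono) (auto simp: indicator_def intro!: ennreal_leI power_mono)
    also note le
    finally have "\<epsilon>\<^sup>2 * measure M ?A \<le> 4 / sphere_area * T L"
      using T0 [of L] sphere_area_pos by (simp add: ennreal_le_iff)
    then show ?thesis
      using e by (intro mult_imp_le_div_pos) (simp_all only: mult.commute zero_less_power)
  qed
  show "AE x in sphere_measure. \<forall>\<epsilon>>0. \<forall>L.
      measure M {\<omega>\<in>space M. \<epsilon> \<le> norm (X \<omega> x - S L \<omega> x)} \<le> 4 / sphere_area * T L / \<epsilon>\<^sup>2"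
    using AEerr AE_space
  proof eventually_elim
    case (elim x)
    then show ?case by (intro allI impI markov) auto
  qed
  show "\<forall>x\<in>sphere 0 1. is_L2_sum_at M S X x \<longrightarrow> (\<forall>\<epsilon>>0. \<forall>L.
      measure M {\<omega>\<in>space M. \<epsilon> \<le> norm (X \<omega> x - S L \<omega> x)} \<le> 4 / sphere_area * T L / \<epsilon>\<^sup>2)"
  proof (intro ballI impI allI)
    fix x \<epsilon> L assume x: "x \<in> sphere (0::real^3) 1" and at: "is_L2_sum_at M S X x" and e: "(0::real) < \<epsilon>"
    have "(\<lambda>N. err N x) \<longlonglongrightarrow> 0" using at unfolding is_L2_sum_at_def err_def E_def .
    then have "\<forall>\<^sub>F N in sequentially. err N x < ennreal \<delta>" if "0 < \<delta>" for \<delta>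
      using that by (intro order_tendstoD(2)) auto
    then have "\<exists>N\<ge>L. err N x \<le> ennreal \<delta>" if "0 < \<delta>" for \<delta>
      using that unfolding eventually_sequentially by (meson less_imp_le linear)
    then have "err L x \<le> ennreal (4 / sphere_area * T L)" by (rule err_le [OF x])
    then show "measure M {\<omega>\<in>space M. \<epsilon> \<le> norm (X \<omega> x - S L \<omega> x)} \<le> 4 / sphere_area * T L / \<epsilon>\<^sup>2"
      by (rule markov [OF x e])
  qed
  show "L2_norm_field M (\<lambda>\<omega> x. X \<omega> x - S L \<omega> x) \<le> sqrt (4 * T L)"
  proof -
    have "ennreal ((L2_norm_field M (\<lambda>\<omega> x. X \<omega> x - S L \<omega> x))\<^sup>2) \<le> (\<integral>\<^sup>+x. ennreal (4 / sphere_area * T L) \<partial>sphere_measure)"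
      unfolding L2 using AEerr by (intro nn_integral_mono_AE) auto
    also have "\<dots> = ennreal (4 / sphere_area * T L) * ennreal sphere_area"
      by (simp add: sphere.emeasure_eq_measure)
    also have "\<dots> = ennreal (4 * T L)"
      using T0 [of L] sphere_area_pos by (simp add: ennreal_mult [symmetric])
    finally have "(L2_norm_field M (\<lambda>\<omega> x. X \<omega> x - S L \<omega> x))\<^sup>2 \<le> 4 * T L"
      using T0 [of L] by (simp add: ennreal_le_iff)
    then show ?thesis by (rule real_le_rsqrt)
  qed
qed

end

text \<open>\<open>X\<close> is a sum in \<open>L2\<close> and hence fixed only up to null sets. The
  probability estimate is therefore stated for almost every \<open>x\<close> and, with the same
  constant, for each individual \<open>x\<close> at which the series converges in mean square. All
  constants are chosen before \<open>L\<close> and \<open>\<epsilon>\<close>.\<close>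

theorem corollary4p11:
  fixes M :: "'w measure"
    and Y :: "nat \<Rightarrow> int \<Rightarrow> real^3 \<Rightarrow> complex"
    and \<alpha> \<beta> \<gamma> H \<tau> t0 t :: real
    and c A1 A2 \<sigma>h \<sigma>t D :: "nat \<Rightarrow> real"
    and Bh Bt :: "nat \<Rightarrow> int \<Rightarrow> real \<Rightarrow> 'w \<Rightarrow> complex"
    and f0 X :: "'w \<Rightarrow> real^3 \<Rightarrow> complex^3"
    and fh ft Ih It :: "nat \<Rightarrow> int \<Rightarrow> 'w \<Rightarrow> complex"
    and S :: "nat \<Rightarrow> 'w \<Rightarrow> real^3 \<Rightarrow> complex^3"
  assumes "prob_space M"
    and "spherical_harmonic_basis Y"
    and "\<alpha> \<in> {0<..2}" and "\<alpha> + \<gamma> \<in> {0..2}" and "\<beta> \<in> {0<..1}" and "H \<in> {1/2..<1}"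
    and tau_def: "\<tau> = max (2 / \<beta> * (1 - \<beta> - H)) 0"
    and c_def: "\<And>l. c l = psi \<alpha> \<gamma> (eigval l)"
    \<comment> \<open>the noise\<close>
    and "\<And>l m. (l, m) \<in> harmonic_index \<Longrightarrow> complex_fbm M H (A1 l) (Bh l m)"
    and "\<And>l m. (l, m) \<in> harmonic_index \<Longrightarrow> complex_fbm M H (A2 l) (Bt l m)"
    and "indep_processes M Bh Bt"
    and "summable (\<lambda>l. (2 * real l + 1) * A1 l)"
    and "summable (\<lambda>l. (2 * real l + 1) * A2 l)"
    and "summable (\<lambda>l. (2 * real l + 1) * c l powr \<tau> * A1 l)"
    and "summable (\<lambda>l. (2 * real l + 1) * c l powr \<tau> * A2 l)"
    \<comment> \<open>the initial condition\<close>
    and "random_tangent_L2 M f0"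
    and "AE x in sphere_measure. (LINT \<omega>|M. f0 \<omega> x) = 0"
    and fh_def: "\<And>l m \<omega>. fh l m \<omega> = tangent_inner (f0 \<omega>) (vsh_y Y l m)"
    and ft_def: "\<And>l m \<omega>. ft l m \<omega> = tangent_inner (f0 \<omega>) (vsh_z Y l m)"
    and "\<And>l m. (l, m) \<in> harmonic_index \<Longrightarrow> complex_centred_normal M ((\<sigma>h l)\<^sup>2) (fh l m)"
    and "\<And>l m. (l, m) \<in> harmonic_index \<Longrightarrow> complex_centred_normal M ((\<sigma>t l)\<^sup>2) (ft l m)"
    and "\<And>l m l' m'. (l, m) \<in> harmonic_index \<Longrightarrow> (l', m') \<in> harmonic_index \<Longrightarrow>
           (LINT \<omega>|M. fh l m \<omega> * cnj (ft l' m' \<omega>)) = 0"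
    and "\<And>l m l' m'. (l, m) \<in> harmonic_index \<Longrightarrow> (l', m') \<in> harmonic_index \<Longrightarrow>
           (LINT \<omega>|M. fh l m \<omega> * cnj (fh l' m' \<omega>)) =
             (if l = l' \<and> m = m' then complex_of_real ((\<sigma>h l)\<^sup>2) else 0)"
    and "\<And>l m l' m'. (l, m) \<in> harmonic_index \<Longrightarrow> (l', m') \<in> harmonic_index \<Longrightarrow>
           (LINT \<omega>|M. ft l m \<omega> * cnj (ft l' m' \<omega>)) =
             (if l = l' \<and> m = m' then complex_of_real ((\<sigma>t l)\<^sup>2) else 0)"
    and "summable (\<lambda>l. (2 * real l + 1) * (\<sigma>h l)\<^sup>2)"
    and "summable (\<lambda>l. (2 * real l + 1) * (\<sigma>t l)\<^sup>2)"
    and "\<And>l m l' m' s. (l, m) \<in> harmonic_index \<Longrightarrow> (l', m') \<in> harmonic_index \<Longrightarrow> s \<ge> 0 \<Longrightarrow>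
           (LINT \<omega>|M. fh l m \<omega> * cnj (Bh l' m' s \<omega>)) = 0 \<and>
           (LINT \<omega>|M. fh l m \<omega> * cnj (Bt l' m' s \<omega>)) = 0 \<and>
           (LINT \<omega>|M. ft l m \<omega> * cnj (Bh l' m' s \<omega>)) = 0 \<and>
           (LINT \<omega>|M. ft l m \<omega> * cnj (Bt l' m' s \<omega>)) = 0"
    \<comment> \<open>the field at time \<open>t\<close> and its truncations\<close>
    and "t0 > 0" and "t > 0"
    and "\<And>l m. (l, m) \<in> harmonic_index \<Longrightarrow>
           has_complex_rs_integral M (Bh l m) (noise_kernel \<beta> (c l) t) t (Ih l m)"
    and "\<And>l m. (l, m) \<in> harmonic_index \<Longrightarrow>
           has_complex_rs_integral M (Bt l m) (noise_kernel \<beta> (c l) t) t (It l m)"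
    and S_def: "S = partial_field Y \<beta> t0 c fh ft Ih It"
    and "is_L2_field_sum M S X"
    and D_def: "\<And>l. D l = (\<sigma>h l)\<^sup>2 + (\<sigma>t l)\<^sup>2 + (A1 l + A2 l) * c l powr \<tau>"
  shows
    "(\<exists>C>0. \<forall>L. L2_norm_field M (\<lambda>\<omega> x. X \<omega> x - S L \<omega> x)
        \<le> C * sqrt (\<Sum>k. (2 * real (L + 1 + k) + 1) * D (L + 1 + k)))
     \<and> (\<forall>\<nu>>2. (\<exists>C0>0. \<exists>l0\<ge>1. \<forall>l\<ge>l0. D l \<le> C0 * real l powr (- \<nu>)) \<longrightarrow>
          (\<exists>C>0. \<forall>L\<ge>1. L2_norm_field M (\<lambda>\<omega> x. X \<omega> x - S L \<omega> x)
              \<le> C * real L powr (- (\<nu> - 2) / 2)) \<and>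
          (\<exists>C>0.
             (AE x in sphere_measure. \<forall>\<epsilon>>0. \<forall>L\<ge>1.
                measure M {\<omega>\<in>space M. \<epsilon> \<le> norm (X \<omega> x - S L \<omega> x)}
                  \<le> C / (real L powr (\<nu> - 2) * \<epsilon>\<^sup>2)) \<and>
             (\<forall>x\<in>sphere 0 1. is_L2_sum_at M S X x \<longrightarrow> (\<forall>\<epsilon>>0. \<forall>L\<ge>1.
                measure M {\<omega>\<in>space M. \<epsilon> \<le> norm (X \<omega> x - S L \<omega> x)}
                  \<le> C / (real L powr (\<nu> - 2) * \<epsilon>\<^sup>2)))))"
proof -
  interpret prob_space M by (rule assms(1))
  note basis = assms(2) and bet = assms(5) and HH = assms(6)
    and fbmh = assms(9) and fbmt = assms(10) and indep = assms(11)
    and summ = assms(14,15,25,26) and nh = assms(20) and nt = assms(21) and cross = assms(22) and hh = assms(23)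
    and tt = assms(24) and uncorr = assms(27) and t0 = assms(28) and t = assms(29) and Ih = assms(30) and It = assms(31)
    and X = assms(33)
  have b: "0 < \<beta>" "\<beta> \<le> 1" and H: "1/2 \<le> H" using bet HH by auto
  have c0: "0 \<le> c l" for l by (simp add: c_def psi_def)
  have cpos: "0 < c l" if "1 \<le> l" for l
  proof -
    have "0 < eigval l" using that by (simp add: eigval_def)
    then show ?thesis by (simp add: c_def psi_def)
  qed
  obtain C where C: "0 \<le> C" and approx: "\<And>c A B I. 0 \<le> c \<Longrightarrow> complex_fbm M H A B \<Longrightarrow>
      has_complex_rs_integral M B (noise_kernel \<beta> c t) t I \<Longrightarrow> \<exists>W. noise_approx B (C * A) I W"
    unfolding noise_approx_def by (rule complex_noise_integral [OF H b t]) blast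
  \<comment> \<open>Both families are merged under indices \<open>(b, l, m)\<close>, with
    \<open>True\<close> for \<open>vsh_y\<close> and \<open>False\<close> for \<open>vsh_z\<close>,
    so that orthogonality becomes one statement.\<close>
  define F where "F i = (case i of (b, l, m) \<Rightarrow> if b then fh l m else ft l m)" for i
  define J where "J i = (case i of (b, l, m) \<Rightarrow> if b then Ih l m else It l m)" for i
  define B where "B i = (case i of (b, l, m) \<Rightarrow> if b then Bh l m else Bt l m)" for i
  define A where "A b l = (if b then A1 l else A2 l)" for b l
  define e where "e l = mittag_leffler \<beta> 1 (- (t0 powr \<beta>) * c l)" for l
  define a where "a i \<omega> = complex_of_real (e (fst (snd i))) * F i \<omega> + J i \<omega>" for i \<omega>
  have e: "0 \<le> e l" "e l \<le> 1" for l
    using mittag_leffler_1_nonneg [OF b, of "t0 powr \<beta> * c l"]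
      mittag_leffler_1_le [OF b, of "t0 powr \<beta> * c l"] c0 [of l] by (simp_all add: e_def)
  have fbm: "complex_fbm M H (A b l) (B (b, l, m))" if "(l, m) \<in> harmonic_index" for b l m
    using fbmh [OF that] fbmt [OF that] by (simp add: A_def B_def)
  have rs: "has_complex_rs_integral M (B (b, l, m)) (noise_kernel \<beta> (c l) t) t (J (b, l, m))"
    if "(l, m) \<in> harmonic_index" for b l m
    using Ih [OF that] It [OF that] by (simp add: B_def J_def)
  have W: "\<exists>W. noise_approx (B (b, l, m)) (C * A b l) (J (b, l, m)) W" if "(l, m) \<in> harmonic_index" for b l m
    by (rule approx [OF c0 fbm [OF that] rs [OF that]])
  have Fsq: "square_integrable M (F i)" if "snd i \<in> harmonic_index" for i
    using that complex_centred_normal_square_integrable(1) [OF nh] complex_centred_normal_square_integrable(1) [OF nt]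
    by (cases i) (auto simp: F_def)
  have Bsq: "square_integrable M (B i s)" "expectation (B i s) = 0" if "snd i \<in> harmonic_index" "0 \<le> s" for i s
  proof -
    obtain b l m where i: "i = (b, l, m)" by (metis prod.exhaust)
    then have "complex_fbm M H (A b l) (B i)" using fbm [of l m b] that(1) by simp
    then show "square_integrable M (B i s)" "expectation (B i s) = 0"
      using that(2) by (rule complex_fbm_square_integrable)+
  qed
  have FF: "expectation (\<lambda>\<omega>. F i \<omega> * cnj (F j \<omega>)) = 0"
    if "snd i \<in> harmonic_index" "snd j \<in> harmonic_index" "i \<noteq> j" for i j
  proof -
    obtain b l m b' l' m' where ij: "i = (b, l, m)" "j = (b', l', m')" by (metis prod.exhaust)
    have "expectation (\<lambda>\<omega>. fh l m \<omega> * cnj (ft l' m' \<omega>)) = 0"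
      "expectation (\<lambda>\<omega>. ft l m \<omega> * cnj (fh l' m' \<omega>)) = 0"
      using that ij cross [of l m l' m'] cross [of l' m' l m] by (auto intro: expectation_cnj_flip)
    then show ?thesis using that ij hh [of l m l' m'] tt [of l m l' m'] by (cases b; cases b') (auto simp: F_def)
  qed
  have FB: "expectation (\<lambda>\<omega>. F i \<omega> * cnj (B j s \<omega>)) = 0"
    if "snd i \<in> harmonic_index" "snd j \<in> harmonic_index" "0 \<le> s" for i j s
  proof -
    obtain b l m b' l' m' where ij: "i = (b, l, m)" "j = (b', l', m')" by (metis prod.exhaust)
    then show ?thesis using that uncorr [of l m l' m' s] by (cases b; cases b') (auto simp: F_def B_def)
  qed
  have BB: "expectation (\<lambda>\<omega>. B i s \<omega> * cnj (B j s' \<omega>)) = 0"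
    if ij: "snd i \<in> harmonic_index" "snd j \<in> harmonic_index" "i \<noteq> j" and s: "0 \<le> s" "0 \<le> s'" for i j s s'
  proof (rule indep_paths_orthogonal [where K = "UNIV \<times> harmonic_index"])
    have "(\<lambda>(b, l, m). sample_path (if b then Bh l m else Bt l m)) = (\<lambda>i. sample_path (B i))"
      by (auto simp: fun_eq_iff B_def)
    then show "indep_vars (\<lambda>_. Pi\<^sub>M {0..} (\<lambda>_. borel)) (\<lambda>i. sample_path (B i)) (UNIV \<times> harmonic_index)"
      using indep by (simp add: indep_processes_def)
  qed (use ij s Bsq in \<open>auto simp: mem_Times_iff\<close>)
  have Jsq: "square_integrable M (J i)" if "snd i \<in> harmonic_index" for i
    using W that noise_approx_moments(1) by (cases i) fastforce
  have FJ: "expectation (\<lambda>\<omega>. F i \<omega> * cnj (J j \<omega>)) = 0"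
    if ij: "snd i \<in> harmonic_index" "snd j \<in> harmonic_index" for i j
  proof -
    obtain b l m where j: "j = (b, l, m)" by (metis prod.exhaust)
    then obtain W where "noise_approx (B j) (C * A b l) (J j) W" using W [of l m b] ij(2) j by auto
    then show ?thesis
      by (rule noise_approx_orthogonal(2)) (use Bsq Fsq FB ij in auto)
  qed
  have JJ: "expectation (\<lambda>\<omega>. J i \<omega> * cnj (J j \<omega>)) = 0"
    if ij: "snd i \<in> harmonic_index" "snd j \<in> harmonic_index" "i \<noteq> j" for i j
  proof -
    obtain b l m b' l' m' where eq: "i = (b, l, m)" "j = (b', l', m')" by (metis prod.exhaust)
    obtain Wi where Wi: "noise_approx (B i) (C * A b l) (J i) Wi" using W [of l m b] ij(1) eq by auto
    obtain Wj where Wj: "noise_approx (B j) (C * A b' l') (J j) Wj" using W [of l' m' b'] ij(2) eq by auto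
    show ?thesis
      by (rule noise_integrals_orthogonal [OF Wi Wj]) (use Bsq BB ij in auto)
  qed
  have asq: "square_integrable M (a i)" if "snd i \<in> harmonic_index" for i
    unfolding a_def [abs_def] by (intro square_integrable_add square_integrable_cmult Fsq Jsq that)
  have orth: "expectation (\<lambda>\<omega>. a i \<omega> * cnj (a j \<omega>)) = 0"
    if ij: "snd i \<in> harmonic_index" "snd j \<in> harmonic_index" "i \<noteq> j" for i j
  proof -
    let ?ei = "complex_of_real (e (fst (snd i)))" and ?ej = "complex_of_real (e (fst (snd j)))"
    note sq = Fsq [OF ij(1)] Fsq [OF ij(2)] Jsq [OF ij(1)] Jsq [OF ij(2)]
    note int = square_integrable_mult [OF sq(1) square_integrable_cnj [OF sq(2)]]
      square_integrable_mult [OF sq(1) square_integrable_cnj [OF sq(4)]]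
      square_integrable_mult [OF sq(3) square_integrable_cnj [OF sq(2)]]
      square_integrable_mult [OF sq(3) square_integrable_cnj [OF sq(4)]]
    have "a i \<omega> * cnj (a j \<omega>) = (?ei * ?ej) * (F i \<omega> * cnj (F j \<omega>)) + ?ei * (F i \<omega> * cnj (J j \<omega>))
        + (?ej * (J i \<omega> * cnj (F j \<omega>)) + J i \<omega> * cnj (J j \<omega>))" for \<omega>
      by (simp add: a_def algebra_simps)
    then have "expectation (\<lambda>\<omega>. a i \<omega> * cnj (a j \<omega>))
        = (?ei * ?ej) * expectation (\<lambda>\<omega>. F i \<omega> * cnj (F j \<omega>)) + ?ei * expectation (\<lambda>\<omega>. F i \<omega> * cnj (J j \<omega>))
        + (?ej * expectation (\<lambda>\<omega>. J i \<omega> * cnj (F j \<omega>)) + expectation (\<lambda>\<omega>. J i \<omega> * cnj (J j \<omega>)))"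
      by (simp only: Bochner_Integration.integral_add Bochner_Integration.integrable_add integrable_mult_right
        integral_mult_right_zero int)
    also have "\<dots> = 0"
      using FF [OF ij] FJ [OF ij(1,2)] expectation_cnj_flip [OF FJ [OF ij(2,1)]] JJ [OF ij] by simp
    finally show ?thesis .
  qed
  have A0: "0 \<le> A b l" if "1 \<le> l" for b l
  proof -
    have "(l, 0) \<in> harmonic_index" using that by (simp add: harmonic_index_def)
    from fbm [OF this, of b] show ?thesis unfolding complex_fbm_def using fbm_variance_nonneg by blast
  qed
  \<comment> \<open>For \<open>\<tau> = 0\<close> the positivity of \<open>c l\<close> matters,
    because \<open>0 powr 0 = 0\<close>. For \<open>\<tau> > 0\<close> necessarily
    \<open>\<beta> + H < 1\<close>, and the existence of the integrals forces
    \<open>A b l = 0\<close>.\<close>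
  have Atau: "A b l * c l powr \<tau> = A b l" if "1 \<le> l" for b l
  proof (cases "\<tau> = 0")
    case True
    then show ?thesis using cpos [OF that] by simp
  next
    case False
    then have "0 < 2 / \<beta> * (1 - \<beta> - H)" unfolding tau_def by (auto simp: max_def split: if_splits)
    then have "0 < 1 - \<beta> - H" using b by (simp add: zero_less_divide_iff zero_less_mult_iff)
    then have bH: "\<beta> + H \<le> 1" by simp
    have "(l, 0) \<in> harmonic_index" using that by (simp add: harmonic_index_def)
    then have "A b l = 0" by (intro noise_integral_degenerate [OF fbm rs t H _ _ bH c0] b)
    then show ?thesis by simp
  qed
  have D: "D l = (\<sigma>h l)\<^sup>2 + (\<sigma>t l)\<^sup>2 + A True l + A False l" if "1 \<le> l" for l
  proof -
    have "D l = (\<sigma>h l)\<^sup>2 + (\<sigma>t l)\<^sup>2 + (A True l * c l powr \<tau> + A False l * c l powr \<tau>)"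
      by (simp add: D_def A_def distrib_right)
    then show ?thesis by (simp only: Atau [OF that] add.assoc)
  qed
  have D0: "0 \<le> D l" if "1 \<le> l" for l using A0 [OF that] by (simp add: D [OF that])
  have Dsum: "summable (\<lambda>l. (2 * real l + 1) * D l)"
  proof -
    have "(2 * real l + 1) * D l = (2 * real l + 1) * (\<sigma>h l)\<^sup>2 + (2 * real l + 1) * (\<sigma>t l)\<^sup>2
        + ((2 * real l + 1) * c l powr \<tau> * A1 l + (2 * real l + 1) * c l powr \<tau> * A2 l)" for l
      by (simp add: D_def algebra_simps)
    then show ?thesis using summ by (simp only:) (intro summable_add)
  qed
  \<comment> \<open>The inequality for the square of a sum gives
    \<open>2 * s\<^sup>2 + 2 * C * A b l\<close>; \<open>k\<close> dominates both coefficients and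
    is positive even if \<open>C = 0\<close>.\<close>
  define k where "k = 2 + 2 * C"
  have k: "2 \<le> k" "2 * C \<le> k" using C by (simp_all add: k_def)
  have var: "expectation (\<lambda>\<omega>. (cmod (a (b, l, m) \<omega>))\<^sup>2) \<le> k * D l" if lm: "(l, m) \<in> harmonic_index" for b l m
  proof -
    have l: "1 \<le> l" using lm by (simp add: harmonic_index_def)
    let ?i = "(b, l, m)"
    have i: "snd ?i \<in> harmonic_index" using lm by simp
    define s where "s = (if b then \<sigma>h l else \<sigma>t l)"
    have F2: "expectation (\<lambda>\<omega>. (cmod (F ?i \<omega>))\<^sup>2) = s\<^sup>2"
      using complex_centred_normal_square_integrable(2) [OF nh [OF lm]]
        complex_centred_normal_square_integrable(2) [OF nt [OF lm]] by (simp add: F_def s_def)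
    have J2: "expectation (\<lambda>\<omega>. (cmod (J ?i \<omega>))\<^sup>2) \<le> C * A b l"
      using W [OF lm, of b] noise_approx_moments(2) by blast
    have "expectation (\<lambda>\<omega>. (cmod (a ?i \<omega>))\<^sup>2)
        \<le> expectation (\<lambda>\<omega>. 2 * (cmod (F ?i \<omega>))\<^sup>2 + 2 * (cmod (J ?i \<omega>))\<^sup>2)"
    proof (intro integral_mono)
      show "integrable M (\<lambda>\<omega>. (cmod (a ?i \<omega>))\<^sup>2)" by (rule square_integrableD(2) [OF asq [OF i]])
      show "integrable M (\<lambda>\<omega>. 2 * (cmod (F ?i \<omega>))\<^sup>2 + 2 * (cmod (J ?i \<omega>))\<^sup>2)"
        by (intro Bochner_Integration.integrable_add integrable_mult_right square_integrableD(2) Fsq Jsq i)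
      fix \<omega>
      have "(cmod (a ?i \<omega>))\<^sup>2 \<le> 2 * (cmod (complex_of_real (e l) * F ?i \<omega>))\<^sup>2 + 2 * (cmod (J ?i \<omega>))\<^sup>2"
        unfolding a_def fst_conv snd_conv by (rule norm_add_square_le)
      moreover have "(cmod (complex_of_real (e l) * F ?i \<omega>))\<^sup>2 \<le> (cmod (F ?i \<omega>))\<^sup>2"
        using e [of l] by (intro power_mono) (auto simp: norm_mult intro!: mult_left_le_one_le)
      ultimately show "(cmod (a ?i \<omega>))\<^sup>2 \<le> 2 * (cmod (F ?i \<omega>))\<^sup>2 + 2 * (cmod (J ?i \<omega>))\<^sup>2" by linarith
    qed
    also have "\<dots> = 2 * s\<^sup>2 + 2 * expectation (\<lambda>\<omega>. (cmod (J ?i \<omega>))\<^sup>2)"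
      using square_integrableD(2) [OF Fsq [OF i]] square_integrableD(2) [OF Jsq [OF i]]
      by (subst Bochner_Integration.integral_add) (simp_all add: F2)
    also have "\<dots> \<le> 2 * s\<^sup>2 + 2 * C * A b l" using J2 by simp
    also have "\<dots> \<le> k * s\<^sup>2 + k * A b l"
      using k A0 [OF l] by (intro add_mono mult_right_mono) auto
    also have "\<dots> = k * (s\<^sup>2 + A b l)" by (simp add: distrib_left)
    also have "\<dots> \<le> k * D l"
      using A0 [OF l, of True] A0 [OF l, of False] k by (intro mult_left_mono) (auto simp: D [OF l] s_def)
    finally show ?thesis .
  qed
  have kDsum: "summable (\<lambda>l. (2 * real l + 1) * (k * D l))"
    using summable_mult [OF Dsum, of k] by (simp add: mult_ac)
  have S: "S N \<omega> x = (\<Sum>l=1..N. \<Sum>m=- int l..int l.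
      a (True, l, m) \<omega> *s vsh_y Y l m x + a (False, l, m) \<omega> *s vsh_z Y l m x)" for N \<omega> x
    by (simp add: S_def partial_field_def a_def F_def J_def e_def mult.commute)
  define T where "T L = (\<Sum>n. (2 * real (L + 1 + n) + 1) * D (L + 1 + n))" for L
  have T: "(\<Sum>n. (2 * real (L + 1 + n) + 1) * (k * D (L + 1 + n))) = k * T L" for L
  proof -
    have "summable (\<lambda>n. (2 * real (L + 1 + n) + 1) * D (L + 1 + n))"
      using summable_ignore_initial_segment [OF Dsum, of "L + 1"] by (simp add: add.commute add.left_commute)
    from suminf_mult [OF this, of k] show ?thesis unfolding T_def by (simp add: mult_ac)
  qed
  have trunc: "L2_norm_field M (\<lambda>\<omega> x. X \<omega> x - S L \<omega> x) \<le> sqrt (4 * (k * T L))"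
    "AE x in sphere_measure. \<forall>\<epsilon>>0. \<forall>L.
      measure M {\<omega>\<in>space M. \<epsilon> \<le> norm (X \<omega> x - S L \<omega> x)} \<le> 4 / sphere_area * (k * T L) / \<epsilon>\<^sup>2"
    "\<forall>x\<in>sphere 0 1. is_L2_sum_at M S X x \<longrightarrow> (\<forall>\<epsilon>>0. \<forall>L.
      measure M {\<omega>\<in>space M. \<epsilon> \<le> norm (X \<omega> x - S L \<omega> x)} \<le> 4 / sphere_area * (k * T L) / \<epsilon>\<^sup>2)" for L
    by (rule truncation_error [OF basis asq orth var kDsum S X, unfolded T]; assumption)+
  have i: "L2_norm_field M (\<lambda>\<omega> x. X \<omega> x - S L \<omega> x) \<le> sqrt (4 * k) * sqrt (T L)" for L
    using trunc(1) [of L] by (simp add: real_sqrt_mult)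
  have ii_iii: "(\<exists>C>0. \<forall>L\<ge>1. L2_norm_field M (\<lambda>\<omega> x. X \<omega> x - S L \<omega> x) \<le> C * real L powr (- (\<nu> - 2) / 2)) \<and>
      (\<exists>C>0. (AE x in sphere_measure. \<forall>\<epsilon>>0. \<forall>L\<ge>1.
                measure M {\<omega>\<in>space M. \<epsilon> \<le> norm (X \<omega> x - S L \<omega> x)} \<le> C / (real L powr (\<nu> - 2) * \<epsilon>\<^sup>2)) \<and>
             (\<forall>x\<in>sphere 0 1. is_L2_sum_at M S X x \<longrightarrow> (\<forall>\<epsilon>>0. \<forall>L\<ge>1.
                measure M {\<omega>\<in>space M. \<epsilon> \<le> norm (X \<omega> x - S L \<omega> x)} \<le> C / (real L powr (\<nu> - 2) * \<epsilon>\<^sup>2))))"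
    if nu: "2 < \<nu>" and decay: "\<exists>C0>0. \<exists>l0\<ge>1. \<forall>l\<ge>l0. D l \<le> C0 * real l powr (- \<nu>)" for \<nu>
  proof -
    obtain C0 l0 where C0: "0 < C0" "1 \<le> l0" "\<And>l. l0 \<le> l \<Longrightarrow> D l \<le> C0 * real l powr (- \<nu>)" using decay by blast
    obtain C' where C': "0 < C'" and TC: "\<And>L. 1 \<le> L \<Longrightarrow> T L \<le> C' * real L powr (- (\<nu> - 2))"
      unfolding T_def by (rule tail_le_powr [of D \<nu> C0 l0]) (use D0 Dsum nu C0 in blast)+
    have prob_le: "p \<le> 4 / sphere_area * k * C' / (real L powr (\<nu> - 2) * \<epsilon>\<^sup>2)"
      if p: "p \<le> 4 / sphere_area * (k * T L) / \<epsilon>\<^sup>2" and "0 < \<epsilon>" and L: "1 \<le> L" for p \<epsilon> L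
    proof -
      have "4 / sphere_area * (k * T L) / \<epsilon>\<^sup>2 \<le> 4 / sphere_area * (k * (C' * real L powr (- (\<nu> - 2)))) / \<epsilon>\<^sup>2"
        using sphere_area_pos k by (intro divide_right_mono mult_left_mono TC L) auto
      also have "\<dots> = 4 / sphere_area * k * C' / (real L powr (\<nu> - 2) * \<epsilon>\<^sup>2)"
        unfolding powr_minus_divide by simp
      finally show ?thesis using p by simp
    qed
    show ?thesis
    proof (intro conjI)
      show "\<exists>C>0. \<forall>L\<ge>1. L2_norm_field M (\<lambda>\<omega> x. X \<omega> x - S L \<omega> x) \<le> C * real L powr (- (\<nu> - 2) / 2)"
      proof (intro exI conjI allI impI)
        show "0 < sqrt (4 * k) * sqrt C'" using k C' by simp
        fix L :: nat assume L: "1 \<le> L"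
        have "sqrt (T L) \<le> sqrt (C' * real L powr (- (\<nu> - 2)))" using TC [OF L] by simp
        also have "\<dots> = sqrt C' * real L powr (- (\<nu> - 2) / 2)"
          by (simp add: real_sqrt_mult powr_half_sqrt [symmetric] powr_powr)
        finally have "sqrt (4 * k) * sqrt (T L) \<le> sqrt (4 * k) * (sqrt C' * real L powr (- (\<nu> - 2) / 2))"
          using k by (intro mult_left_mono) auto
        then show "L2_norm_field M (\<lambda>\<omega> x. X \<omega> x - S L \<omega> x) \<le> sqrt (4 * k) * sqrt C' * real L powr (- (\<nu> - 2) / 2)"
          using i [of L] by simp
      qed
      show "\<exists>C>0. (AE x in sphere_measure. \<forall>\<epsilon>>0. \<forall>L\<ge>1.
                measure M {\<omega>\<in>space M. \<epsilon> \<le> norm (X \<omega> x - S L \<omega> x)} \<le> C / (real L powr (\<nu> - 2) * \<epsilon>\<^sup>2)) \<and>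
             (\<forall>x\<in>sphere 0 1. is_L2_sum_at M S X x \<longrightarrow> (\<forall>\<epsilon>>0. \<forall>L\<ge>1.
                measure M {\<omega>\<in>space M. \<epsilon> \<le> norm (X \<omega> x - S L \<omega> x)} \<le> C / (real L powr (\<nu> - 2) * \<epsilon>\<^sup>2)))"
      proof (intro exI conjI)
        show "0 < 4 / sphere_area * k * C'" using sphere_area_pos k C' by simp
        show "AE x in sphere_measure. \<forall>\<epsilon>>0. \<forall>L\<ge>1.
            measure M {\<omega>\<in>space M. \<epsilon> \<le> norm (X \<omega> x - S L \<omega> x)} \<le> 4 / sphere_area * k * C' / (real L powr (\<nu> - 2) * \<epsilon>\<^sup>2)"
          using trunc(2) by eventually_elim (intro allI impI prob_le, auto)
        show "\<forall>x\<in>sphere 0 1. is_L2_sum_at M S X x \<longrightarrow> (\<forall>\<epsilon>>0. \<forall>L\<ge>1.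
            measure M {\<omega>\<in>space M. \<epsilon> \<le> norm (X \<omega> x - S L \<omega> x)} \<le> 4 / sphere_area * k * C' / (real L powr (\<nu> - 2) * \<epsilon>\<^sup>2))"
          using trunc(3) by (intro ballI impI allI prob_le) auto
      qed
    qed
  qed
  have "\<exists>C>0. \<forall>L. L2_norm_field M (\<lambda>\<omega> x. X \<omega> x - S L \<omega> x) \<le> C * sqrt (T L)"
    using i k by (intro exI [of _ "sqrt (4 * k)"]) simp
  then show ?thesis unfolding T_def using ii_iii by blast
qed

end
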